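(* Let $\mathcal{G}$ be a species of graphs and $\mathcal{N}$ a symmetric species of 2-pole networks. The Walsh index series $W_{\mathcal{G}^{\mathrm m}\uparrow_Z\mathcal{N}}(\mathbf a;\mathbf b;\mathbf c)$ can be obtained from the extended Walsh series $W^{\mathrm m}_{\mathcal{G}}(\mathbf a;\mathbf b;\mathbf c;\beta;\gamma)$ by performing the substitutions $\beta_k:=(W^+_{\mathcal{N}})_k(\mathbf a;\mathbf b;\mathbf c)$, $\gamma_k:=(W^-_{\mathcal{N}})_k(\mathbf a;\mathbf b;\mathbf c)$, $k\ge1$. In other words, $$W_{\mathcal{G}^{\mathrm m}\uparrow_Z\mathcal{N}}(\mathbf a;\mathbf b;\mathbf c)=W^{\mathrm m}_{\mathcal{G}}\big(\mathbf a;\mathbf b;\mathbf c;(W^+_{\mathcal{N}})_1,(W^+_{\mathcal{N}})_2,\ldots;(W^-_{\mathcal{N}})_1,(W^-_{\mathcal{N}})_2,\ldots\big).$$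
   Context: All graphs are finite and simple. $K_2$ is considered 2-connected. A species of graphs is a class of (labelled) graphs closed under isomorphism. A (2-pole) network is a connected graph $N$ with two distinguished vertices $0,1$ (the poles) such that the graph $N\cup 01$, obtained by adding the edge $01$ if it is not already there, is 2-connected; the other vertices are internal. The underlying set of a network is its set $U$ of internal vertices, and $\hat N$ denotes the corresponding graph on $U\cup\{0,1\}$. Isomorphisms of networks are graph isomorphisms fixing $0$ and $1$. A species of networks is a class of networks closed under isomorphism. $\tau\cdot N$ is obtained from $N$ by interchanging the poles; $\mathcal{N}$ is symmetric if $N\in\mathcal{N}\Rightarrow\tau\cdot N\in\mathcal{N}$. $\mathcal{N}_\tau$ is the subclass of those $N\in\mathcal{N}$ with $\tau\cdot N$ isomorphic to $N$. A matching of a graph is a set of pairwise disjoint edges. $\mathcal{G}^{\mathrm m}$ is the species of matched graphs, i.e. pairs $(G_0,\mu)$ with $G_0\in\mathcal{G}$ and $\mu$ a matching of $G_0$; isomorphisms are matching-preserving graph isomorphisms. Edges in $\mu$ are of sort $Y$, edges not in $\mu$ of sort $Z$. $\mathcal{G}^{\mathrm m}\uparrow_Z\mathcal{N}$ is the class of graphs $G$ obtained from a matched graph $(G_0,\mu)\in\mathcal{G}^{\mathrm m}$ by substituting a network $N_e\in\mathcal{N}$ for each edge $e$ of sort $Z$, identifying the poles of $N_e$ with the extremities of $e$ according to some orientation (internal vertex sets of the $N_e$ pairwise disjoint and disjoint from $V(G_0)$), edges of sort $Y$ being left unchanged. Such a structure is considered together with its matched core $(G_0,\mu)$, and isomorphisms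 are graph isomorphisms preserving the matched core. Edge cycles: an automorphism $\sigma$ of a graph $G$ induces a permutation of $E(G)$; a cycle of length $l$ of it is cylindrical if $\sigma^l$ fixes both endpoints of each edge of the cycle, and Möbius if $\sigma^l$ exchanges the endpoints of each edge of the cycle. $\sigma_k$ is the number of vertex cycles of length $k$ of $\sigma$; $\mathrm{cyl}_k(G,\sigma)$, $\mathrm{m\ddot ob}_k(G,\sigma)$ are the numbers of cylindrical and Möbius edge cycles of length $k$. Put $w(G,\sigma)=\prod_{k}a_k^{\sigma_k}b_k^{\mathrm{cyl}_k(G,\sigma)}c_k^{\mathrm{m\ddot ob}_k(G,\sigma)}$. Then $W_{\mathcal{G}^{\mathrm m}\uparrow_Z\mathcal{N}}(\mathbf a;\mathbf b;\mathbf c)$ is the sum, over representatives of isomorphism classes of $(\mathcal{G}^{\mathrm m}\uparrow_Z\mathcal{N})$-structures with graph $G$, of the average of $w(G,\sigma)$ over all automorphisms $\sigma$ of the structure. For a network $N$ with internal vertex set $U$ and a permutation $\sigma$ of $U$, let $\sigma^+=(0)(1)\sigma$ and $\sigma^-=(0,1)\sigma$ on $U\cup\{0,1\}$, and let $\mathrm{Aut}^{\pm}(N)=\{\sigma:\sigma^{\pm}\in\mathrm{Aut}(\hat N)\}$. Then $$W^+_{\mathcal{N}}=\sum_{N}\frac{1}{|\mathrm{Aut}^+(N)|}\sum_{\sigma\in\mathrm{Aut}^+(N)}\frac{w(\hat N,\sigma^+)}{a_1^2},\qquad W^-_{\mathcal{N}}=\sum_{N}\frac{1}{|\mathrm{Aut}^-(N)|}\sum_{\sigma\in\mathrm{Aut}^-(N)}\frac{w(\hat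 N,\sigma^-)}{a_2},$$ with $N$ running over representatives of isomorphism classes in $\mathcal{N}$, resp. in $\mathcal{N}_\tau$; and $(W^{\pm}_{\mathcal{N}})_k=W^{\pm}_{\mathcal{N}}(a_k,a_{2k},\ldots;b_k,b_{2k},\ldots;c_k,c_{2k},\ldots)$. The extended Walsh series is $$W_{\mathcal{G}}^{\mathrm m}(\mathbf a;\mathbf b;\mathbf c;\beta;\gamma)=\sum_{G}\frac1{|\mathrm{Aut}(G)|}\sum_{\sigma\in\mathrm{Aut}(G)}\ \sum_{\mu\in\mathrm{Fix}^{\mathrm m}(\sigma)}w^\mu(\sigma),$$ with $G$ running over representatives of isomorphism classes of graphs in $\mathcal{G}$, $\mathrm{Fix}^{\mathrm m}(\sigma)$ the set of matchings $\mu$ of $G$ with $\sigma(\mu)=\mu$, and $w^\mu(\sigma)=\prod_k a_k^{\sigma_k}b_k^{\mathrm{cyl}_{k,Y}(\sigma)}c_k^{\mathrm{m\ddot ob}_{k,Y}(\sigma)}\beta_k^{\mathrm{cyl}_{k,Z}(\sigma)}\gamma_k^{\mathrm{m\ddot ob}_{k,Z}(\sigma)}$, the exponents counting the cylindrical and Möbius edge cycles of length $k$ and of sort $Y$ or $Z$. *)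

theory Defs
  imports "HOL-Combinatorics.Combinatorics" "HOL-Library.Poly_Mapping"
    "HOL-Library.Infinite_Typeclass"
begin

text \<open>
  A monomial over the variables \<open>'v\<close> is its finitely supported exponent vector
  \<open>'v \<Rightarrow>\<^sub>0 nat\<close>; multiplication (division) of monomials is addition (subtraction) of
  exponent vectors.
\<close>

typedef 'v series = "UNIV :: (('v \<Rightarrow>\<^sub>0 nat) \<Rightarrow> rat) set"
  morphisms coeff Series
  by simp

declare Series_inverse [OF UNIV_I, simp]

lemma series_eqI: "(\<And>m. coeff f m = coeff g m) \<Longrightarrow> f = g"
  by (metis coeff_inject ext)

definition splits :: "('v \<Rightarrow>\<^sub>0 nat) \<Rightarrow> (('v \<Rightarrow>\<^sub>0 nat) \<times> ('v \<Rightarrow>\<^sub>0 nat)) set" where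
  "splits m = {(p, q). p + q = m}"

instantiation series :: (type) "{zero, one, plus, minus, uminus, times}"
begin
definition "0 = Series (\<lambda>m. 0)"
definition "1 = Series (\<lambda>m. if m = 0 then 1 else 0)"
definition "f + g = Series (\<lambda>m. coeff f m + coeff g m)"
definition "f - g = Series (\<lambda>m. coeff f m - coeff g m)"
definition "- f = Series (\<lambda>m. - coeff f m)"
definition "f * g = Series (\<lambda>m. \<Sum>(p, q)\<in>splits m. coeff f p * coeff g q)"
instance ..
end

lemma coeff_zero [simp]: "coeff 0 m = 0"
  by (simp add: zero_series_def)

lemma coeff_one: "coeff 1 m = (if m = 0 then 1 else 0)"
  by (simp add: one_series_def)

lemma coeff_add [simp]: "coeff (f + g) m = coeff f m + coeff g m"
  by (simp add: plus_series_def)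

lemma coeff_diff [simp]: "coeff (f - g) m = coeff f m - coeff g m"
  by (simp add: minus_series_def)

lemma coeff_uminus [simp]: "coeff (- f) m = - coeff f m"
  by (simp add: uminus_series_def)

lemma coeff_mult: "coeff (f * g) m = (\<Sum>(p, q)\<in>splits m. coeff f p * coeff g q)"
  by (simp add: times_series_def)

lemma finite_splits [simp]: "finite (splits m)"
proof -
  define P where "P = {p. \<exists>q. p + q = m}"
  let ?l = Poly_Mapping.lookup and ?K = "Poly_Mapping.keys m"
  have le: "?l p x \<le> ?l m x" if "p \<in> P" for p x
    using that by (auto simp: P_def lookup_add)
  have "?l ` P \<subseteq> {f. \<forall>x. (x \<in> ?K \<longrightarrow> f x \<in> (\<Union>x\<in>?K. {..?l m x})) \<and> (x \<notin> ?K \<longrightarrow> f x = 0)}"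
  proof (rule image_subsetI, rule CollectI, intro allI conjI impI)
    fix p x assume p: "p \<in> P"
    show "?l p x \<in> (\<Union>x\<in>?K. {..?l m x})" if "x \<in> ?K"
      using that le[OF p, of x] by blast
    show "?l p x = 0" if "x \<notin> ?K"
      using that le[OF p, of x] by (simp add: in_keys_iff)
  qed
  moreover have "finite \<dots>"
    by (rule finite_set_of_finite_funs) auto
  ultimately have "finite (?l ` P)"
    by (rule finite_subset)
  then have "finite P"
    by (rule finite_imageD) (simp add: inj_on_def poly_mapping_eqI)
  moreover have "splits m \<subseteq> P \<times> P"
    by (auto simp: splits_def P_def) (metis add.commute)
  ultimately show ?thesis
    by (meson finite_SigmaI finite_subset)
qed

instance series :: (type) comm_ring_1
proof
  fix f g h :: "'a series"
  show "f * g * h = f * (g * h)"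
  proof (rule series_eqI)
    fix m
    have "coeff (f * g * h) m = (\<Sum>(p, q)\<in>splits m. \<Sum>(r, s)\<in>splits p.
        coeff f r * coeff g s * coeff h q)"
      by (simp add: coeff_mult sum_distrib_right case_prod_unfold)
    also have "\<dots> = (\<Sum>((p, q), (r, s))\<in>(SIGMA x:splits m. splits (fst x)).
        coeff f r * coeff g s * coeff h q)"
      by (simp add: sum.Sigma case_prod_unfold)
    also have "\<dots> = (\<Sum>((p, q), (r, s))\<in>(SIGMA x:splits m. splits (snd x)).
        coeff f p * (coeff g r * coeff h s))"
      by (rule sum.reindex_bij_witness[where
            i = "\<lambda>((p, q), (r, s)). ((p + r, s), (p, r))" and
            j = "\<lambda>((p, q), (r, s)). ((r, s + q), (s, q))"])
        (auto simp: splits_def add.assoc)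
    also have "\<dots> = (\<Sum>(p, q)\<in>splits m. \<Sum>(r, s)\<in>splits q.
        coeff f p * (coeff g r * coeff h s))"
      by (simp add: sum.Sigma case_prod_unfold)
    also have "\<dots> = coeff (f * (g * h)) m"
      by (simp add: coeff_mult sum_distrib_left case_prod_unfold)
    finally show "coeff (f * g * h) m = coeff (f * (g * h)) m" .
  qed
  show "f * g = g * f"
  proof (rule series_eqI)
    fix m
    show "coeff (f * g) m = coeff (g * f) m"
      unfolding coeff_mult
      by (rule sum.reindex_bij_witness[where i = prod.swap and j = prod.swap])
        (auto simp: splits_def add.commute mult.commute)
  qed
  show "1 * f = f"
  proof (rule series_eqI)
    fix m
    have "coeff (1 * f) m = (\<Sum>(p, q)\<in>{(0, m)}. coeff (1 :: 'a series) p * coeff f q)"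
      unfolding coeff_mult
      by (rule sum.mono_neutral_right[OF finite_splits])
        (auto simp: splits_def coeff_one split: if_splits)
    then show "coeff (1 * f) m = coeff f m"
      by (simp add: coeff_one)
  qed
  show "(f + g) * h = f * h + g * h"
    by (rule series_eqI)
      (simp add: coeff_mult sum.distrib distrib_right case_prod_unfold)
  show "(0 :: 'a series) \<noteq> 1"
    by (metis coeff_one coeff_zero zero_neq_one)
qed (auto intro!: series_eqI)

definition scale :: "rat \<Rightarrow> 'v series \<Rightarrow> 'v series" where
  "scale r f = Series (\<lambda>m. r * coeff f m)"

definition monomial_series :: "('v \<Rightarrow>\<^sub>0 nat) \<Rightarrow> 'v series" where
  "monomial_series m = Series (\<lambda>n. if n = m then 1 else 0)"

definition var :: "'v \<Rightarrow> 'v series" where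
  "var v = monomial_series (Poly_Mapping.single v 1)"

text \<open>
  Possibly infinite sums of series are formed coefficientwise: every coefficient is a sum over
  the indices contributing a nonzero value to it. All uses below are summable, i.e. only
  finitely many indices contribute to any given coefficient.
\<close>

definition series_sum :: "('i \<Rightarrow> 'v series) \<Rightarrow> 'i set \<Rightarrow> 'v series" where
  "series_sum f I = Series (\<lambda>m. \<Sum>i\<in>{i \<in> I. coeff (f i) m \<noteq> 0}. coeff (f i) m)"

definition substitute :: "('v \<Rightarrow> 'w series) \<Rightarrow> 'v series \<Rightarrow> 'w series" where
  "substitute s F =
     series_sum (\<lambda>n. scale (coeff F n)
       (\<Prod>v\<in>Poly_Mapping.keys n. s v ^ Poly_Mapping.lookup n v)) UNIV"

text \<open>
  The sum of \<open>f x\<close> over representatives \<open>x\<close> of the classes of \<open>S\<close> modulo \<open>isom\<close>; it does not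
  depend on the choice of representatives when \<open>f\<close> is invariant under \<open>isom\<close>.
\<close>

definition class_sum :: "('s \<Rightarrow> 's \<Rightarrow> bool) \<Rightarrow> 's set \<Rightarrow> ('s \<Rightarrow> 'v series) \<Rightarrow> 'v series" where
  "class_sum isom S f =
     series_sum (\<lambda>K. f (SOME x. x \<in> K)) (S // {(x, y). x \<in> S \<and> y \<in> S \<and> isom x y})"

datatype 'a graph = Graph (verts: "'a set") (edges: "'a set set")

definition simple_graph :: "'a graph \<Rightarrow> bool" where
  "simple_graph G \<longleftrightarrow> finite (verts G) \<and> (\<forall>e\<in>edges G. e \<subseteq> verts G \<and> card e = 2)"

definition graph_connected :: "'a graph \<Rightarrow> bool" where
  "graph_connected G \<longleftrightarrow> verts G \<noteq> {} \<and>
     (\<forall>u\<in>verts G. \<forall>v\<in>verts G. (u, v) \<in> {(x, y). {x, y} \<in> edges G}\<^sup>*)"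

definition delete_vertex :: "'a graph \<Rightarrow> 'a \<Rightarrow> 'a graph" where
  "delete_vertex G v = Graph (verts G - {v}) {e \<in> edges G. v \<notin> e}"

text \<open>The complete graph on two vertices is 2-connected.\<close>

definition two_connected :: "'a graph \<Rightarrow> bool" where
  "two_connected G \<longleftrightarrow> card (verts G) \<ge> 2 \<and> graph_connected G \<and>
     (\<forall>v\<in>verts G. graph_connected (delete_vertex G v))"

definition graph_iso :: "('a \<Rightarrow> 'a) \<Rightarrow> 'a graph \<Rightarrow> 'a graph \<Rightarrow> bool" where
  "graph_iso f G H \<longleftrightarrow> bij_betw f (verts G) (verts H) \<and> (image f) ` edges G = edges H"

definition graph_isomorphic :: "'a graph \<Rightarrow> 'a graph \<Rightarrow> bool" where
  "graph_isomorphic G H \<longleftrightarrow> (\<exists>f. graph_iso f G H)"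

text \<open>
  Automorphisms are extended by the identity outside the vertex set, so that each of them is
  represented by exactly one function.
\<close>

definition graph_auts :: "'a graph \<Rightarrow> ('a \<Rightarrow> 'a) set" where
  "graph_auts G = {\<sigma>. \<sigma> permutes verts G \<and> graph_iso \<sigma> G G}"

text \<open>Vertices are labelled by elements of \<open>'a\<close>, which has to be infinite for species to
  contain graphs of every finite size.\<close>

definition graph_species :: "'a graph set \<Rightarrow> bool" where
  "graph_species \<G> \<longleftrightarrow> (\<forall>G\<in>\<G>. simple_graph G) \<and>
     (\<forall>G H. G \<in> \<G> \<longrightarrow> simple_graph H \<longrightarrow> graph_isomorphic G H \<longrightarrow> H \<in> \<G>)"

definition is_matching :: "'a graph \<Rightarrow> 'a set set \<Rightarrow> bool" where
  "is_matching G \<mu> \<longleftrightarrow> \<mu> \<subseteq> edges G \<and> pairwise disjnt \<mu>"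

definition matched_graphs :: "'a graph set \<Rightarrow> ('a graph \<times> 'a set set) set" where
  "matched_graphs \<G> = {(G, \<mu>). G \<in> \<G> \<and> is_matching G \<mu>}"

text \<open>
  The poles are two distinguished vertices \<open>pole0\<close>, \<open>pole1\<close> of the same label type as the
  internal vertices, and \<open>net_graph N\<close> is the graph on all vertices of \<open>N\<close>, including the poles.
\<close>

datatype 'a network = Network (net_graph: "'a graph") (pole0: 'a) (pole1: 'a)

definition internal :: "'a network \<Rightarrow> 'a set" where
  "internal N = verts (net_graph N) - {pole0 N, pole1 N}"

definition join_poles :: "'a network \<Rightarrow> 'a graph" where
  "join_poles N =
     Graph (verts (net_graph N)) (insert {pole0 N, pole1 N} (edges (net_graph N)))"

definition is_network :: "'a network \<Rightarrow> bool" where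
  "is_network N \<longleftrightarrow> simple_graph (net_graph N) \<and> graph_connected (net_graph N) \<and>
     pole0 N \<in> verts (net_graph N) \<and> pole1 N \<in> verts (net_graph N) \<and> pole0 N \<noteq> pole1 N \<and>
     two_connected (join_poles N)"

definition network_isomorphic :: "'a network \<Rightarrow> 'a network \<Rightarrow> bool" where
  "network_isomorphic N M \<longleftrightarrow> (\<exists>f. graph_iso f (net_graph N) (net_graph M) \<and>
     f (pole0 N) = pole0 M \<and> f (pole1 N) = pole1 M)"

definition network_species :: "'a network set \<Rightarrow> bool" where
  "network_species \<N> \<longleftrightarrow> (\<forall>N\<in>\<N>. is_network N) \<and>
     (\<forall>N M. N \<in> \<N> \<longrightarrow> is_network M \<longrightarrow> network_isomorphic N M \<longrightarrow> M \<in> \<N>)"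

definition swap_poles :: "'a network \<Rightarrow> 'a network" where
  "swap_poles N = Network (net_graph N) (pole1 N) (pole0 N)"

definition symmetric_species :: "'a network set \<Rightarrow> bool" where
  "symmetric_species \<N> \<longleftrightarrow> (\<forall>N\<in>\<N>. swap_poles N \<in> \<N>)"

definition pole_symmetric :: "'a network set \<Rightarrow> 'a network set" where
  "pole_symmetric \<N> = {N \<in> \<N>. network_isomorphic (swap_poles N) N}"

text \<open>
  For \<open>\<sigma> permutes internal N\<close> the function \<open>\<sigma>\<close> fixes the poles. Hence it coincides with
  its extension \<open>(0)(1)\<sigma>\<close> to all vertices, while \<open>(0,1)\<sigma>\<close> is obtained by composing with the
  transposition of the poles.
\<close>

definition sigma_minus :: "'a network \<Rightarrow> ('a \<Rightarrow> 'a) \<Rightarrow> 'a \<Rightarrow> 'a" where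
  "sigma_minus N \<sigma> = transpose (pole0 N) (pole1 N) \<circ> \<sigma>"

definition aut_plus :: "'a network \<Rightarrow> ('a \<Rightarrow> 'a) set" where
  "aut_plus N = {\<sigma>. \<sigma> permutes internal N \<and> \<sigma> \<in> graph_auts (net_graph N)}"

definition aut_minus :: "'a network \<Rightarrow> ('a \<Rightarrow> 'a) set" where
  "aut_minus N = {\<sigma>. \<sigma> permutes internal N \<and> sigma_minus N \<sigma> \<in> graph_auts (net_graph N)}"

text \<open>
  A structure is a triple \<open>(G, G\<^sub>0, \<mu>)\<close> of a graph and its matched core. The network \<open>N e\<close>
  substituted for \<open>e\<close> is taken with the endpoints of \<open>e\<close> as its poles, in either order.
\<close>

type_synonym 'a cored_graph = "'a graph \<times> 'a graph \<times> 'a set set"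

definition edge_substitution ::
    "'a graph set \<Rightarrow> 'a network set \<Rightarrow> 'a cored_graph set" where
  "edge_substitution \<G> \<N> = {(G, G\<^sub>0, \<mu>). (G\<^sub>0, \<mu>) \<in> matched_graphs \<G> \<and>
     (\<exists>N.
        (\<forall>e\<in>edges G\<^sub>0 - \<mu>. N e \<in> \<N> \<and> {pole0 (N e), pole1 (N e)} = e \<and>
           internal (N e) \<inter> verts G\<^sub>0 = {}) \<and>
        (\<forall>e\<in>edges G\<^sub>0 - \<mu>. \<forall>e'\<in>edges G\<^sub>0 - \<mu>. e \<noteq> e' \<longrightarrow> internal (N e) \<inter> internal (N e') = {}) \<and>
        verts G = verts G\<^sub>0 \<union> (\<Union>e\<in>edges G\<^sub>0 - \<mu>. internal (N e)) \<and>
        edges G = \<mu> \<union> (\<Union>e\<in>edges G\<^sub>0 - \<mu>. edges (net_graph (N e))))}"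

fun cored_iso :: "('a \<Rightarrow> 'a) \<Rightarrow> 'a cored_graph \<Rightarrow> 'a cored_graph \<Rightarrow> bool" where
  "cored_iso f (G, G\<^sub>0, \<mu>) (H, H\<^sub>0, \<nu>) \<longleftrightarrow>
     graph_iso f G H \<and> graph_iso f G\<^sub>0 H\<^sub>0 \<and> (image f) ` \<mu> = \<nu>"

definition cored_isomorphic :: "'a cored_graph \<Rightarrow> 'a cored_graph \<Rightarrow> bool" where
  "cored_isomorphic S T \<longleftrightarrow> (\<exists>f. cored_iso f S T)"

definition cored_auts :: "'a cored_graph \<Rightarrow> ('a \<Rightarrow> 'a) set" where
  "cored_auts S = {\<sigma>. \<sigma> permutes verts (fst S) \<and> cored_iso \<sigma> S S}"

definition vertex_cycles :: "'a set \<Rightarrow> ('a \<Rightarrow> 'a) \<Rightarrow> nat \<Rightarrow> nat" where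
  "vertex_cycles V \<sigma> k = card {c \<in> orbit \<sigma> ` V. card c = k}"

text \<open>A cycle of the permutation of edges induced by \<open>\<sigma>\<close> is given by its set \<open>c\<close> of edges.\<close>

definition cylindrical :: "('a \<Rightarrow> 'a) \<Rightarrow> 'a set set \<Rightarrow> bool" where
  "cylindrical \<sigma> c \<longleftrightarrow> (\<forall>e\<in>c. \<forall>x\<in>e. (\<sigma> ^^ card c) x = x)"

definition moebius :: "('a \<Rightarrow> 'a) \<Rightarrow> 'a set set \<Rightarrow> bool" where
  "moebius \<sigma> c \<longleftrightarrow> (\<forall>u v. {u, v} \<in> c \<longrightarrow> (\<sigma> ^^ card c) u = v \<and> (\<sigma> ^^ card c) v = u)"

definition cyl :: "'a set set \<Rightarrow> ('a \<Rightarrow> 'a) \<Rightarrow> nat \<Rightarrow> nat" where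
  "cyl F \<sigma> k = card {c \<in> orbit (image \<sigma>) ` F. card c = k \<and> cylindrical \<sigma> c}"

definition moeb :: "'a set set \<Rightarrow> ('a \<Rightarrow> 'a) \<Rightarrow> nat \<Rightarrow> nat" where
  "moeb F \<sigma> k = card {c \<in> orbit (image \<sigma>) ` F. card c = k \<and> moebius \<sigma> c}"

text \<open>Only the variables with index \<open>k \<ge> 1\<close> occur in the series below.\<close>

datatype walsh_var = VA nat | VB nat | VC nat

datatype ext_var = Base walsh_var | VBeta nat | VGamma nat

text \<open>
  The weights are exponent vectors. A vertex (edge) cycle has length at most the number of
  vertices (edges), so the ranges of \<open>k\<close> comprise all cycles.
\<close>

definition walsh_weight :: "'a graph \<Rightarrow> ('a \<Rightarrow> 'a) \<Rightarrow> (walsh_var \<Rightarrow>\<^sub>0 nat)" where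
  "walsh_weight G \<sigma> =
     (\<Sum>k = 1..card (verts G). Poly_Mapping.single (VA k) (vertex_cycles (verts G) \<sigma> k)) +
     (\<Sum>k = 1..card (edges G). Poly_Mapping.single (VB k) (cyl (edges G) \<sigma> k) +
        Poly_Mapping.single (VC k) (moeb (edges G) \<sigma> k))"

definition ext_weight ::
    "'a graph \<Rightarrow> 'a set set \<Rightarrow> ('a \<Rightarrow> 'a) \<Rightarrow> (ext_var \<Rightarrow>\<^sub>0 nat)" where
  "ext_weight G \<mu> \<sigma> =
     (\<Sum>k = 1..card (verts G). Poly_Mapping.single (Base (VA k)) (vertex_cycles (verts G) \<sigma> k)) +
     (\<Sum>k = 1..card (edges G). Poly_Mapping.single (Base (VB k)) (cyl \<mu> \<sigma> k) +
        Poly_Mapping.single (Base (VC k)) (moeb \<mu> \<sigma> k) +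
        Poly_Mapping.single (VBeta k) (cyl (edges G - \<mu>) \<sigma> k) +
        Poly_Mapping.single (VGamma k) (moeb (edges G - \<mu>) \<sigma> k))"

definition average :: "'i set \<Rightarrow> ('i \<Rightarrow> 'v series) \<Rightarrow> 'v series" where
  "average I f = scale (1 / of_nat (card I)) (\<Sum>i\<in>I. f i)"

definition walsh_substitution :: "'a graph set \<Rightarrow> 'a network set \<Rightarrow> walsh_var series" where
  "walsh_substitution \<G> \<N> = class_sum cored_isomorphic (edge_substitution \<G> \<N>)
     (\<lambda>S. average (cored_auts S) (\<lambda>\<sigma>. monomial_series (walsh_weight (fst S) \<sigma>)))"

text \<open>
  The subtractions of exponent vectors do not truncate: the poles contribute two cycles of
  length 1, respectively one cycle of length 2.
\<close>

definition walsh_plus :: "'a network set \<Rightarrow> walsh_var series" where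
  "walsh_plus \<N> = class_sum network_isomorphic \<N>
     (\<lambda>N. average (aut_plus N) (\<lambda>\<sigma>. monomial_series
        (walsh_weight (net_graph N) \<sigma> - Poly_Mapping.single (VA 1) 2)))"

definition walsh_minus :: "'a network set \<Rightarrow> walsh_var series" where
  "walsh_minus \<N> = class_sum network_isomorphic (pole_symmetric \<N>)
     (\<lambda>N. average (aut_minus N) (\<lambda>\<sigma>. monomial_series
        (walsh_weight (net_graph N) (sigma_minus N \<sigma>) - Poly_Mapping.single (VA 2) 1)))"

fun dilate_var :: "nat \<Rightarrow> walsh_var \<Rightarrow> walsh_var" where
  "dilate_var k (VA i) = VA (k * i)"
| "dilate_var k (VB i) = VB (k * i)"
| "dilate_var k (VC i) = VC (k * i)"

definition dilate :: "nat \<Rightarrow> walsh_var series \<Rightarrow> walsh_var series" where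
  "dilate k W = substitute (\<lambda>v. var (dilate_var k v)) W"

definition fixed_matchings :: "'a graph \<Rightarrow> ('a \<Rightarrow> 'a) \<Rightarrow> 'a set set set" where
  "fixed_matchings G \<sigma> = {\<mu>. is_matching G \<mu> \<and> (image \<sigma>) ` \<mu> = \<mu>}"

definition extended_walsh :: "'a graph set \<Rightarrow> ext_var series" where
  "extended_walsh \<G> = class_sum graph_isomorphic \<G>
     (\<lambda>G. average (graph_auts G)
        (\<lambda>\<sigma>. \<Sum>\<mu>\<in>fixed_matchings G \<sigma>. monomial_series (ext_weight G \<mu> \<sigma>)))"

end

theory Submission
  imports Defs "HOL-Library.FuncSet"
begin

text \<open>
  Both sides are compared coefficientwise by counting labelled objects. By orbit counting, a sum
  over isomorphism classes of averages over automorphisms is \<open>1 / n!\<close> times a sum over the pairs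
  of a structure on a fixed set of \<open>n\<close> labels and an automorphism of it. A pair \<open>(G, \<sigma>)\<close> with core
  \<open>(G\<^sub>0, \<mu>)\<close> restricts to an automorphism \<open>\<tau>\<close> of the core, and since the substituted networks are
  determined by \<open>G\<close> and its core, \<open>\<sigma>\<close> permutes them along the cycles of \<open>\<tau>\<close> on the edges outside \<open>\<mu>\<close>.
  For fixed \<open>\<tau>\<close> the exponential generating function of the choices of networks is therefore a product
  over these cycles. On a cycle of length \<open>k\<close>, everything is determined up to a choice of labels by
  the network of one edge together with the return map \<open>\<sigma>\<^sup>k\<close> on it, which fixes the poles
  (cylindrical case) or exchanges them (Moebius case); all cycle lengths are multiplied by \<open>k\<close>, so
  this factor is the \<open>k\<close>-th dilation of the plus or minus series of the networks.
\<close>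

section \<open>Cycle sums\<close>

text \<open>The comparison is finite because of a grading: \<open>VA k\<close> has degree k and all
  other variables have degree 0, so the weight of an automorphism of a graph with n vertices has
  degree n. A single coefficient thus concerns label sets of one size, and the infinite label type
  contains such a set. For the extended series the same grading counts the vertices of the core
  alone. That the core determines the networks rests on 2-connectedness: deleting one pole from a
  network with joined poles leaves every internal vertex linked to the other pole. Uniqueness of the
  decomposition is in turn what forces an automorphism to permute the networks. The substituted
  edges carry no orientation. Families therefore store just a graph for each unordered edge, and
  symmetry of the species allows the poles to be taken in either order; an exchange of poles after a
  full turn is then a legitimate return map. The minus series averages over a set that need not be a
  group. It still fits orbit counting, since this set is either empty or a coset of the group fixing
  the poles.\<close>

definition cyc_sum :: "('x set \<Rightarrow> 'v) \<Rightarrow> ('x \<Rightarrow> 'x) \<Rightarrow> 'x set \<Rightarrow> ('v \<Rightarrow>\<^sub>0 nat)" where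
  "cyc_sum g f X = (\<Sum>c\<in>orbit f ` X. Poly_Mapping.single (g c) 1)"

text \<open>The second alternative stands for Moebius cycles: on an invariant finite set of
  two-element edges, \<open>moebius_iff_not_cylindrical\<close> shows that every cycle is of exactly
  one of the two types.\<close>

definition edge_var :: "(nat \<Rightarrow> 'v) \<Rightarrow> (nat \<Rightarrow> 'v) \<Rightarrow> ('a \<Rightarrow> 'a) \<Rightarrow> 'a set set \<Rightarrow> 'v" where
  "edge_var g h \<sigma> c = (if cylindrical \<sigma> c then g (card c) else h (card c))"

lemma funpow_image: "((`) (f :: 'a \<Rightarrow> 'a) ^^ n) A = (f ^^ n) ` A"
  by (induction n) (auto simp: image_comp)

lemma funpow_closed: "f ` X \<subseteq> X \<Longrightarrow> x \<in> X \<Longrightarrow> (f ^^ n) x \<in> X"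
  by (induction n) auto

lemma orbit_subset_closed: "f ` X \<subseteq> X \<Longrightarrow> x \<in> X \<Longrightarrow> orbit f x \<subseteq> X"
  by (auto simp: orbit_altdef intro: funpow_closed)

text \<open>\<open>orbit f x\<close> starts at \<open>f x\<close>, so membership of \<open>x\<close>
  itself is not automatic. The iterates stay in a finite set, hence two of them coincide, and
  injectivity cancels the common part.\<close>

lemma self_in_orbit:
  assumes "inj f" "finite X" "f ` X \<subseteq> X" "x \<in> X"
  shows "x \<in> orbit f x"
proof -
  have "range (\<lambda>n. (f ^^ n) x) \<subseteq> X" using funpow_closed[OF assms(3,4)] by blast
  then have "finite (range (\<lambda>n. (f ^^ n) x))" using assms(2) finite_subset by blast
  then have "\<not> inj (\<lambda>n. (f ^^ n) x)" using finite_imageD infinite_UNIV_nat by blast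
  then obtain i j where ij: "i < j" "(f ^^ i) x = (f ^^ j) x"
    by (metis (no_types, lifting) linorder_injI)
  have "(f ^^ i) ((f ^^ (j - i)) x) = (f ^^ i) x"
    using ij by (metis add_diff_inverse_nat comp_apply funpow_add less_imp_not_less)
  then have "(f ^^ (j - i)) x = x" using inj_fn[OF assms(1)] by (metis injD)
  then show ?thesis using ij unfolding orbit_altdef by (metis (mono_tags, lifting) mem_Collect_eq zero_less_diff)
qed

lemma orbit_eq_of_mem:
  assumes "inj f" "finite X" "f ` X \<subseteq> X" "x \<in> X" "y \<in> orbit f x"
  shows "orbit f y = orbit f x"
  using self_in_orbit[OF assms(1-4)] assms(5) orbit_cyclic_eq3 unfolding cyclic_on_def by metis

lemma funpow_card_orbit:
  assumes "inj f" "finite X" "f ` X \<subseteq> X" "x \<in> X"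
  shows "(f ^^ card (orbit f x)) x = x"
proof -
  have s: "x \<in> orbit f x" by (rule self_in_orbit[OF assms])
  have "card (orbit f x) = funpow_dist1 f x x"
    by (subst orbit_conv_funpow_dist1[OF s], subst card_image) (use inj_on_funpow_dist1[OF s] in auto)
  then show ?thesis using funpow_dist1_prop[OF s] by simp
qed

lemma cyc_sum_Un:
  assumes "finite X" "finite Y" "f ` X \<subseteq> X" "f ` Y \<subseteq> Y" "X \<inter> Y = {}"
  shows "cyc_sum g f (X \<union> Y) = cyc_sum g f X + cyc_sum g f Y"
proof -
  have "orbit f ` X \<inter> orbit f ` Y = {}"
  proof (rule ccontr)
    assume "\<not> ?thesis"
    then obtain x y where "x \<in> X" "y \<in> Y" "orbit f x = orbit f y" by auto
    then show False using orbit_subset_closed[OF assms(3)] orbit_subset_closed[OF assms(4)] assms(5)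
      orbit.base[of f x] by blast
  qed
  then show ?thesis unfolding cyc_sum_def image_Un by (intro sum.union_disjoint) (use assms in auto)
qed

lemma cyc_sum_empty [simp]: "cyc_sum g f {} = 0" by (simp add: cyc_sum_def)

lemma orbit_transport:
  assumes "f ` X \<subseteq> X" "\<And>x. x \<in> X \<Longrightarrow> f' (h x) = h (f x)" "x \<in> X"
  shows "orbit f' (h x) = h ` orbit f x"
proof -
  have "(f' ^^ n) (h x) = h ((f ^^ n) x)" for n
    by (induction n) (use assms funpow_closed[OF assms(1,3)] in auto)
  then show ?thesis unfolding orbit_altdef by auto
qed

lemma cyc_sum_transport:
  assumes "f ` X \<subseteq> X" "inj_on h X" "\<And>x. x \<in> X \<Longrightarrow> f' (h x) = h (f x)"
    "\<And>c. c \<in> orbit f ` X \<Longrightarrow> g' (h ` c) = g c"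
  shows "cyc_sum g' f' (h ` X) = cyc_sum g f X"
proof -
  have *: "orbit f' ` h ` X = (`) h ` (orbit f ` X)"
  proof -
    have "orbit f' (h x) = h ` orbit f x" if "x \<in> X" for x
      by (rule orbit_transport[where X=X]) (use assms that in auto)
    then show ?thesis by (auto simp: image_image)
  qed
  have "inj_on ((`) h) (orbit f ` X)"
    by (rule inj_onI) (use assms(2) orbit_subset_closed[OF assms(1)] in \<open>auto simp: inj_on_image_eq_iff\<close>)
  then show ?thesis unfolding cyc_sum_def *
    by (subst sum.reindex) (auto intro!: sum.cong simp: assms(4))
qed

text \<open>If \<open>X\<close> is a cross-section to which \<open>f\<close> returns after exactly
  \<open>k\<close> steps, this is the set swept out by \<open>X\<close>, and \<open>f\<close> acts
  on it as a tower of height \<open>k\<close> over \<open>f ^^ k\<close>.\<close>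

definition spread :: "nat \<Rightarrow> ('x \<Rightarrow> 'x) \<Rightarrow> 'x set \<Rightarrow> 'x set" where
  "spread k f X = (\<Union>i<k. (f ^^ i) ` X)"

lemma subset_spread: "0 < k \<Longrightarrow> X \<subseteq> spread k f X"
proof
  fix x assume "0 < k" "x \<in> X"
  then have "0 \<in> {..<k}" "x \<in> (f ^^ 0) ` X" by auto
  then show "x \<in> spread k f X" unfolding spread_def by blast
qed

text \<open>Division with remainder: n steps of \<open>f\<close> are n div k returns followed by n
  mod k steps inside the tower.\<close>

lemma orbit_spread:
  assumes "inj f" "finite X" "(f ^^ k) ` X = X" "0 < k" "x \<in> X"
  shows "orbit f x = spread k f (orbit (f ^^ k) x)"
proof
  have s: "x \<in> orbit (f ^^ k) x" by (rule self_in_orbit[OF inj_fn[OF assms(1)] assms(2)]) (use assms in auto)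
  show "orbit f x \<subseteq> spread k f (orbit (f ^^ k) x)"
  proof
    fix y assume "y \<in> orbit f x"
    then obtain n where n: "y = (f ^^ n) x" by (auto simp: orbit_altdef)
    have "y = (f ^^ (n mod k)) (((f ^^ k) ^^ (n div k)) x)"
      unfolding n by (metis comp_apply funpow_add funpow_mult mod_mult_div_eq)
    moreover have "((f ^^ k) ^^ (n div k)) x \<in> orbit (f ^^ k) x"
      by (cases "n div k = 0") (use s in \<open>auto simp: funpow_in_orbit\<close>)
    ultimately show "y \<in> spread k f (orbit (f ^^ k) x)"
      using assms(4) unfolding spread_def by auto
  qed
  show "spread k f (orbit (f ^^ k) x) \<subseteq> orbit f x"
  proof
    fix y assume "y \<in> spread k f (orbit (f ^^ k) x)"
    then obtain i n where "0 < n" "y = (f ^^ i) (((f ^^ k) ^^ n) x)"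
      by (auto simp: spread_def orbit_altdef)
    then have "y = (f ^^ (i + k * n)) x" "0 < i + k * n"
      using assms(4) by (auto simp: funpow_add funpow_mult)
    then show "y \<in> orbit f x" unfolding orbit_altdef by blast
  qed
qed

lemma spread_closed:
  assumes "(f ^^ k) ` X = X" "0 < k"
  shows "f ` spread k f X \<subseteq> spread k f X"
proof -
  have "(f ^^ Suc i) ` X \<subseteq> spread k f X" if "i < k" for i
  proof (cases "Suc i < k")
    case False
    then have "Suc i = k" using that by simp
    then have "(f ^^ Suc i) ` X = (f ^^ 0) ` X" using assms by simp
    then show ?thesis using assms(2) unfolding spread_def by blast
  qed (auto simp: spread_def)
  then show ?thesis unfolding spread_def by (auto simp: image_subset_iff)
qed

text \<open>Every cycle of \<open>f\<close> in the tower meets the base \<open>X\<close> in exactly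
  one cycle of \<open>f ^^ k\<close>, so \<open>spread k f\<close> is a bijection between the two
  sets of cycles.\<close>

lemma cyc_sum_spread:
  assumes "inj f" "finite X" "(f ^^ k) ` X = X" "0 < k"
    and d: "\<And>i. 0 < i \<Longrightarrow> i < k \<Longrightarrow> (f ^^ i) ` X \<inter> X = {}"
  shows "cyc_sum g f (spread k f X) = cyc_sum (\<lambda>c. g (spread k f c)) (f ^^ k) X"
proof -
  have sub: "c \<subseteq> X" if "c \<in> orbit (f ^^ k) ` X" for c
    using that orbit_subset_closed[of "f ^^ k" X] assms(3) by auto
  \<comment> \<open>Intersecting with the base recovers the cycle of the return map, which gives
    injectivity.\<close>
  have r: "spread k f c \<inter> X = c" if "c \<in> orbit (f ^^ k) ` X" for c
  proof -
    have "(f ^^ i) ` c \<inter> X \<subseteq> c" if "i < k" for i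
      using d[of i] that sub[OF \<open>c \<in> _\<close>] by (cases "i = 0") auto
    moreover have "c \<subseteq> spread k f c" by (rule subset_spread[OF assms(4)])
    ultimately show ?thesis using sub[OF that] unfolding spread_def by blast
  qed
  then have inj: "inj_on (spread k f) (orbit (f ^^ k) ` X)" by (metis inj_onI)
  have fs: "finite (spread k f X)" unfolding spread_def using assms(2) by auto
  have "orbit f ` spread k f X = orbit f ` X"
  proof
    show "orbit f ` X \<subseteq> orbit f ` spread k f X" using subset_spread[OF assms(4), of X f] by blast
    show "orbit f ` spread k f X \<subseteq> orbit f ` X"
    proof
      fix c assume "c \<in> orbit f ` spread k f X"
      then obtain i x where x: "x \<in> X" "i < k" "c = orbit f ((f ^^ i) x)" by (auto simp: spread_def)
      have xs: "x \<in> spread k f X" using subset_spread[OF assms(4), of X f] x by blast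
      note s = self_in_orbit[OF assms(1) fs spread_closed[OF assms(3,4)] xs]
      have "(f ^^ i) x \<in> orbit f x" using s by (cases "i = 0") (auto simp: funpow_in_orbit)
      then have "c = orbit f x" using x(3) orbit_eq_of_mem[OF assms(1) fs spread_closed[OF assms(3,4)] xs] by simp
      then show "c \<in> orbit f ` X" using x by blast
    qed
  qed
  also have "\<dots> = spread k f ` (orbit (f ^^ k) ` X)"
    using orbit_spread[OF assms(1-4)] by (auto simp: image_image)
  finally show ?thesis unfolding cyc_sum_def
    by (simp add: sum.reindex[OF inj] o_def)
qed

text \<open>The origin of the factor \<open>k\<close> in all dilations: the \<open>k\<close>
  translates of \<open>c\<close> are disjoint copies of it.\<close>

lemma card_spread:
  assumes "inj f" "finite X" "0 < k" "c \<subseteq> X"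
    and d: "\<And>i. 0 < i \<Longrightarrow> i < k \<Longrightarrow> (f ^^ i) ` X \<inter> X = {}"
  shows "card (spread k f c) = k * card c"
proof -
  have disj: "(f ^^ i) ` c \<inter> (f ^^ j) ` c = {}" if "i < j" "j < k" for i j
  proof (rule ccontr)
    assume "\<not> ?thesis"
    then obtain x y where xy: "x \<in> c" "y \<in> c" "(f ^^ i) x = (f ^^ j) y" by auto
    then have "(f ^^ i) x = (f ^^ i) ((f ^^ (j - i)) y)" using that
      by (metis add_diff_inverse_nat comp_apply funpow_add less_imp_not_less)
    then have "x = (f ^^ (j - i)) y" using inj_fn[OF assms(1)] by (metis injD)
    then have "x \<in> (f ^^ (j - i)) ` X \<inter> X" using xy(1,2) assms(4) by blast
    moreover have "(f ^^ (j - i)) ` X \<inter> X = {}" by (rule d) (use that in auto)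
    ultimately show False by simp
  qed
  have "card (spread k f c) = (\<Sum>i<k. card ((f ^^ i) ` c))"
    unfolding spread_def
  proof (rule card_UN_disjoint)
    show "\<forall>i\<in>{..<k}. \<forall>j\<in>{..<k}. i \<noteq> j \<longrightarrow> (f ^^ i) ` c \<inter> (f ^^ j) ` c = {}"
      using disj by (metis Int_commute lessThan_iff linorder_neqE_nat)
  qed (use finite_subset[OF assms(4,2)] in auto)
  also have "\<dots> = (\<Sum>i<k. card c)"
    by (intro sum.cong refl card_image) (meson assms(1) inj_fn inj_on_subset subset_UNIV)
  finally show ?thesis by simp
qed

section \<open>Degree of a monomial, counted by vertices\<close>

definition vdeg :: "walsh_var \<Rightarrow> nat" where
  "vdeg v = (case v of VA k \<Rightarrow> k | _ \<Rightarrow> 0)"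

definition mdeg :: "('v \<Rightarrow> nat) \<Rightarrow> ('v \<Rightarrow>\<^sub>0 nat) \<Rightarrow> nat" where
  "mdeg d m = (\<Sum>v\<in>Poly_Mapping.keys m. d v * Poly_Mapping.lookup m v)"

lemma mdeg_superset:
  "finite K \<Longrightarrow> Poly_Mapping.keys m \<subseteq> K \<Longrightarrow> mdeg d m = (\<Sum>v\<in>K. d v * Poly_Mapping.lookup m v)"
  unfolding mdeg_def by (rule sum.mono_neutral_left) (auto simp: in_keys_iff)

lemma mdeg_add [simp]: "mdeg d (m + n) = mdeg d m + mdeg d n"
proof -
  let ?K = "Poly_Mapping.keys m \<union> Poly_Mapping.keys n"
  have "mdeg d (m + n) = (\<Sum>v\<in>?K. d v * Poly_Mapping.lookup (m + n) v)"
    by (rule mdeg_superset) (use Poly_Mapping.keys_add[of m n] in auto)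
  then show ?thesis
    by (simp add: mdeg_superset[of ?K] lookup_add distrib_left sum.distrib)
qed

lemma mdeg_zero [simp]: "mdeg d 0 = 0" by (simp add: mdeg_def)

lemma mdeg_single [simp]: "mdeg d (Poly_Mapping.single v k) = d v * k"
  by (simp add: mdeg_def)

lemma mdeg_sum: "mdeg d (\<Sum>i\<in>I. f i) = (\<Sum>i\<in>I. mdeg d (f i))"
  by (induction I rule: infinite_finite_induct) auto

lemma sum_card_orbits:
  assumes "inj f" "finite X" "f ` X \<subseteq> X"
  shows "(\<Sum>c\<in>orbit f ` X. card c) = card X"
proof -
  have sub: "orbit f x \<subseteq> X" if "x \<in> X" for x using orbit_subset_closed[OF assms(3) that] .
  have "\<Union> (orbit f ` X) = X"
    using sub self_in_orbit[OF assms] by blast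
  moreover have "card (\<Union> (orbit f ` X)) = (\<Sum>c\<in>orbit f ` X. card c)"
  proof (rule card_Union_disjoint)
    show "pairwise disjnt (orbit f ` X)"
    proof (rule pairwiseI)
      fix c d assume "c \<in> orbit f ` X" "d \<in> orbit f ` X" "c \<noteq> d"
      then show "disjnt c d" unfolding disjnt_def
        using orbit_eq_of_mem[OF assms] by (metis (no_types, lifting) disjoint_iff imageE)
    qed
    show "\<And>c. c \<in> orbit f ` X \<Longrightarrow> finite c" using sub assms(2) finite_subset by blast
  qed
  ultimately show ?thesis by simp
qed

text \<open>Cycle lengths add up to the number of vertices. This ties the degree of a coefficient to
  the size of the label set.\<close>

lemma mdeg_cyc_sum_vertices:
  assumes "inj f" "finite X" "f ` X \<subseteq> X"
  shows "mdeg vdeg (cyc_sum (\<lambda>c. VA (card c)) f X) = card X"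
  using sum_card_orbits[OF assms] by (simp add: cyc_sum_def mdeg_sum vdeg_def)

lemma mdeg_cyc_sum_edges: "mdeg vdeg (cyc_sum (edge_var VB VC \<sigma>) f X) = 0"
  by (auto simp: cyc_sum_def mdeg_sum vdeg_def edge_var_def intro!: sum.neutral)

section \<open>Walsh weights as sums over cycles\<close>

lemma sum_single_const: "(\<Sum>c\<in>S. Poly_Mapping.single v (1::nat)) = Poly_Mapping.single v (card S)"
  by (induction S rule: infinite_finite_induct) (simp_all add: single_add[symmetric])

text \<open>The weights count cycles length by length; since no cycle is longer than
  \<open>M\<close>, collecting the cycles by length loses none of them.\<close>

lemma single_card_levels:
  assumes "finite O1" "\<And>c. c \<in> O1 \<Longrightarrow> 1 \<le> card c \<and> card c \<le> M"
  shows "(\<Sum>k = 1..M. Poly_Mapping.single (g k) (card {c \<in> O1. card c = k \<and> Q c})) =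
    (\<Sum>c\<in>{c\<in>O1. Q c}. Poly_Mapping.single (g (card c)) 1)"
proof -
  have "(\<Sum>c\<in>{c\<in>O1. Q c}. Poly_Mapping.single (g (card c)) (1::nat)) =
     (\<Sum>k = 1..M. \<Sum>c\<in>{c \<in> {c\<in>O1. Q c}. card c = k}. Poly_Mapping.single (g (card c)) 1)"
    by (rule sum.group[symmetric]) (use assms in auto)
  also have "\<dots> = (\<Sum>k = 1..M. Poly_Mapping.single (g k) (card {c \<in> O1. card c = k \<and> Q c}))"
  proof (rule sum.cong[OF refl])
    fix k
    have "(\<Sum>c\<in>{c \<in> {c\<in>O1. Q c}. card c = k}. Poly_Mapping.single (g (card c)) (1::nat)) =
      (\<Sum>c\<in>{c \<in> O1. card c = k \<and> Q c}. Poly_Mapping.single (g k) 1)"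
      by (rule sum.cong) auto
    also have "\<dots> = Poly_Mapping.single (g k) (card {c \<in> O1. card c = k \<and> Q c})"
      by (rule sum_single_const)
    finally show "(\<Sum>c\<in>{c \<in> {c\<in>O1. Q c}. card c = k}. Poly_Mapping.single (g (card c)) (1::nat)) =
      Poly_Mapping.single (g k) (card {c \<in> O1. card c = k \<and> Q c})" .
  qed
  finally show ?thesis by simp
qed

definition vweight :: "'a set \<Rightarrow> ('a \<Rightarrow> 'a) \<Rightarrow> (walsh_var \<Rightarrow>\<^sub>0 nat)" where
  "vweight X \<sigma> = cyc_sum (\<lambda>c. VA (card c)) \<sigma> X"

definition eweight :: "'a set set \<Rightarrow> ('a \<Rightarrow> 'a) \<Rightarrow> (walsh_var \<Rightarrow>\<^sub>0 nat)" where
  "eweight F \<sigma> = cyc_sum (edge_var VB VC \<sigma>) ((`) \<sigma>) F"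

lemma inj_image: "inj f \<Longrightarrow> inj ((`) f)"
  by (simp add: inj_def inj_image_eq_iff)

lemma edge_orbit_fixed:
  assumes "inj \<sigma>" "finite F" "(`) \<sigma> ` F \<subseteq> F" "c \<in> orbit ((`) \<sigma>) ` F" "e \<in> c"
  shows "(\<sigma> ^^ card c) ` e = e"
proof -
  obtain e0 where e0: "e0 \<in> F" "c = orbit ((`) \<sigma>) e0" using assms(4) by auto
  have "orbit ((`) \<sigma>) e = c"
    using orbit_eq_of_mem[OF inj_image[OF assms(1)] assms(2,3) e0(1)] assms(5) e0(2) by simp
  moreover have "e \<in> F" using orbit_subset_closed[OF assms(3) e0(1)] e0(2) assms(5) by blast
  ultimately show ?thesis
    using funpow_card_orbit[OF inj_image[OF assms(1)] assms(2,3)] by (metis funpow_image)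
qed

text \<open>The power of \<sigma> that closes the cycle maps one edge to itself, so it fixes or
  exchanges the two ends. It commutes with \<sigma>, hence the same alternative holds along the
  whole cycle; distinct ends exclude both at once.\<close>

lemma moebius_iff_not_cylindrical:
  assumes "inj \<sigma>" "finite F" "(`) \<sigma> ` F \<subseteq> F" "\<And>e. e \<in> F \<Longrightarrow> card e = 2" "c \<in> orbit ((`) \<sigma>) ` F"
  shows "moebius \<sigma> c \<longleftrightarrow> \<not> cylindrical \<sigma> c"
proof -
  let ?f = "\<sigma> ^^ card c"
  obtain e0 where e0: "e0 \<in> F" "c = orbit ((`) \<sigma>) e0" using assms(5) by auto
  have e0c: "e0 \<in> c" using self_in_orbit[OF inj_image[OF assms(1)] assms(2,3) e0(1)] e0(2) by simp
  have cF: "c \<subseteq> F" using orbit_subset_closed[OF assms(3) e0(1)] e0(2) by simp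
  have comm: "?f ((\<sigma> ^^ i) x) = (\<sigma> ^^ i) (?f x)" for i x
    by (metis add.commute comp_apply funpow_add)
  have inj: "inj ?f" by (rule inj_fn[OF assms(1)])
  obtain p q where pq: "e0 = {p, q}" "p \<noteq> q" using assms(4)[OF e0(1)] by (meson card_2_iff)
  have im: "?f ` {p, q} = {p, q}" using edge_orbit_fixed[OF assms(1-3,5) e0c] pq by simp
  have mem: "\<exists>i. e = (\<sigma> ^^ i) ` {p, q}" if "e \<in> c" for e
    using that e0(2) pq(1) by (auto simp: orbit_altdef funpow_image)
  have "?f p \<in> {p, q}" "?f q \<in> {p, q}" using im by blast+
  moreover have "?f p \<noteq> ?f q" using pq(2) inj by (simp add: inj_eq)
  ultimately consider (fx) "?f p = p" "?f q = q" | (swap) "?f p = q" "?f q = p" by auto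
  then show ?thesis
  proof cases
    case fx
    then have "cylindrical \<sigma> c" unfolding cylindrical_def using mem comm by fastforce
    moreover have "\<not> moebius \<sigma> c" unfolding moebius_def using fx pq e0c by metis
    ultimately show ?thesis by simp
  next
    case swap
    then have "\<not> cylindrical \<sigma> c" unfolding cylindrical_def using pq e0c by (metis insertI1)
    moreover have "moebius \<sigma> c" unfolding moebius_def
    proof (intro allI impI)
      fix u v assume "{u, v} \<in> c"
      then obtain i where i: "{u, v} = {(\<sigma> ^^ i) p, (\<sigma> ^^ i) q}" using mem by fastforce
      show "?f u = v \<and> ?f v = u" using i swap comm by (metis doubleton_eq_iff)
    qed
    ultimately show ?thesis by simp
  qed
qed

lemma card_orbit_bounds:
  assumes "inj f" "finite X" "f ` X \<subseteq> X" "c \<in> orbit f ` X"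
  shows "1 \<le> card c \<and> card c \<le> card X"
proof -
  obtain x where x: "x \<in> X" "c = orbit f x" using assms(4) by auto
  have "c \<subseteq> X" using orbit_subset_closed[OF assms(3) x(1)] x by simp
  moreover have "c \<noteq> {}" using x orbit.base by fast
  ultimately show ?thesis using assms(2)
    by (metis One_nat_def Suc_leI card_gt_0_iff card_mono finite_subset)
qed

lemma vertex_cycles_sum:
  assumes "inj \<sigma>" "finite V" "\<sigma> ` V \<subseteq> V"
  shows "(\<Sum>k = 1..card V. Poly_Mapping.single (g k) (vertex_cycles V \<sigma> k)) = cyc_sum (\<lambda>c. g (card c)) \<sigma> V"
  using single_card_levels[of "orbit \<sigma> ` V" "card V" g "\<lambda>_. True"] card_orbit_bounds[OF assms] assms(2)
  by (simp add: vertex_cycles_def cyc_sum_def)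

lemma edge_cycles_sum:
  assumes "inj \<sigma>" "finite F" "(`) \<sigma> ` F \<subseteq> F" "\<And>e. e \<in> F \<Longrightarrow> card e = 2" "card F \<le> M"
  shows "(\<Sum>k = 1..M. Poly_Mapping.single (g k) (cyl F \<sigma> k) + Poly_Mapping.single (h k) (moeb F \<sigma> k)) =
    cyc_sum (edge_var g h \<sigma>) ((`) \<sigma>) F"
proof -
  let ?O = "orbit ((`) \<sigma>) ` F"
  have b: "1 \<le> card c \<and> card c \<le> M" if "c \<in> ?O" for c
    using card_orbit_bounds[OF inj_image[OF assms(1)] assms(2,3) that] assms(5) by simp
  have fO: "finite ?O" using assms(2) by simp
  have m: "{c \<in> ?O. moebius \<sigma> c} = {c \<in> ?O. \<not> cylindrical \<sigma> c}"
    using moebius_iff_not_cylindrical[OF assms(1-4)] by blast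
  have 1: "(\<Sum>k = 1..M. Poly_Mapping.single (g k) (cyl F \<sigma> k)) =
      (\<Sum>c\<in>{c\<in>?O. cylindrical \<sigma> c}. Poly_Mapping.single (g (card c)) 1)"
    unfolding cyl_def by (rule single_card_levels[OF fO b])
  have 2: "(\<Sum>k = 1..M. Poly_Mapping.single (h k) (moeb F \<sigma> k)) =
      (\<Sum>c\<in>{c\<in>?O. \<not> cylindrical \<sigma> c}. Poly_Mapping.single (h (card c)) 1)"
    unfolding moeb_def using single_card_levels[OF fO b, of h "moebius \<sigma>"] m by simp
  have "cyc_sum (edge_var g h \<sigma>) ((`) \<sigma>) F =
     (\<Sum>c\<in>{c\<in>?O. cylindrical \<sigma> c} \<union> {c\<in>?O. \<not> cylindrical \<sigma> c}. Poly_Mapping.single (edge_var g h \<sigma> c) 1)"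
    unfolding cyc_sum_def by (rule sum.cong) auto
  also have "\<dots> = (\<Sum>c\<in>{c\<in>?O. cylindrical \<sigma> c}. Poly_Mapping.single (edge_var g h \<sigma> c) 1) +
     (\<Sum>c\<in>{c\<in>?O. \<not> cylindrical \<sigma> c}. Poly_Mapping.single (edge_var g h \<sigma> c) 1)"
    by (rule sum.union_disjoint) (use fO in auto)
  also have "\<dots> = (\<Sum>c\<in>{c\<in>?O. cylindrical \<sigma> c}. Poly_Mapping.single (g (card c)) 1) +
     (\<Sum>c\<in>{c\<in>?O. \<not> cylindrical \<sigma> c}. Poly_Mapping.single (h (card c)) 1)"
    by (intro arg_cong2[where f="(+)"] sum.cong) (auto simp: edge_var_def)
  finally show ?thesis using 1 2 by (simp add: sum.distrib)
qed

lemma simple_graph_finite_edges: "simple_graph G \<Longrightarrow> finite (edges G)"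
  unfolding simple_graph_def by (meson Pow_iff finite_Pow_iff finite_subset subsetI)

lemma walsh_weight_eq:
  assumes "inj \<sigma>" "simple_graph G" "\<sigma> ` verts G \<subseteq> verts G" "(`) \<sigma> ` edges G \<subseteq> edges G"
  shows "walsh_weight G \<sigma> = vweight (verts G) \<sigma> + eweight (edges G) \<sigma>"
proof -
  have "finite (verts G)" "\<And>e. e \<in> edges G \<Longrightarrow> card e = 2" using assms(2) by (auto simp: simple_graph_def)
  then show ?thesis unfolding walsh_weight_def vweight_def eweight_def
    by (intro arg_cong2[where f="(+)"] vertex_cycles_sum[OF assms(1) _ assms(3)]
      edge_cycles_sum[OF assms(1) simple_graph_finite_edges[OF assms(2)] assms(4)]) auto
qed

lemma ext_weight_eq:
  assumes "inj \<sigma>" "simple_graph G" "\<sigma> ` verts G \<subseteq> verts G" "(`) \<sigma> ` \<mu> \<subseteq> \<mu>"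
    "(`) \<sigma> ` (edges G - \<mu>) \<subseteq> edges G - \<mu>" "\<mu> \<subseteq> edges G"
  shows "ext_weight G \<mu> \<sigma> = cyc_sum (\<lambda>c. Base (VA (card c))) \<sigma> (verts G) +
    cyc_sum (edge_var (\<lambda>k. Base (VB k)) (\<lambda>k. Base (VC k)) \<sigma>) ((`) \<sigma>) \<mu> +
    cyc_sum (edge_var VBeta VGamma \<sigma>) ((`) \<sigma>) (edges G - \<mu>)"
proof -
  have f: "finite (edges G)" using assms(2) by (rule simple_graph_finite_edges)
  have v: "finite (verts G)" "\<And>e. e \<in> edges G \<Longrightarrow> card e = 2" using assms(2) by (auto simp: simple_graph_def)
  have 1: "(\<Sum>k = 1..card (edges G). Poly_Mapping.single (Base (VB k)) (cyl \<mu> \<sigma> k) + Poly_Mapping.single (Base (VC k)) (moeb \<mu> \<sigma> k)) =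
    cyc_sum (edge_var (\<lambda>k. Base (VB k)) (\<lambda>k. Base (VC k)) \<sigma>) ((`) \<sigma>) \<mu>"
    by (rule edge_cycles_sum[OF assms(1) _ assms(4)]) (use f v assms(6) finite_subset card_mono in auto)
  have 2: "(\<Sum>k = 1..card (edges G). Poly_Mapping.single (VBeta k) (cyl (edges G - \<mu>) \<sigma> k) + Poly_Mapping.single (VGamma k) (moeb (edges G - \<mu>) \<sigma> k)) =
    cyc_sum (edge_var VBeta VGamma \<sigma>) ((`) \<sigma>) (edges G - \<mu>)"
    by (rule edge_cycles_sum[OF assms(1) _ assms(5)]) (use f v card_mono[OF f, of "edges G - \<mu>"] in auto)
  show ?thesis unfolding ext_weight_def 1[symmetric] 2[symmetric]
      vertex_cycles_sum[OF assms(1) v(1) assms(3), of "\<lambda>k. Base (VA k)", symmetric]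
    by (simp add: sum.distrib add.assoc)
qed

lemma vweight_transport:
  assumes "\<sigma> ` X \<subseteq> X" "inj_on h X" "\<And>x. x \<in> X \<Longrightarrow> \<sigma>' (h x) = h (\<sigma> x)"
  shows "vweight (h ` X) \<sigma>' = vweight X \<sigma>"
  unfolding vweight_def
proof (rule cyc_sum_transport[OF assms])
  fix c assume "c \<in> orbit \<sigma> ` X"
  then have "c \<subseteq> X" using orbit_subset_closed[OF assms(1)] by auto
  then show "VA (card (h ` c)) = VA (card c)" using assms(2) by (metis card_image inj_on_subset)
qed

text \<open>Cylindrical cycles are recognised by fixed points of a power, which an injective map
  intertwining the two permutations preserves and reflects. Only vertices covered by edges
  matter.\<close>

lemma cyc_sum_edges_transport:
  assumes "(`) \<sigma> ` F \<subseteq> F" "inj h" "\<And>x. x \<in> \<Union>F \<Longrightarrow> \<sigma>' (h x) = h (\<sigma> x)"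
  shows "cyc_sum (edge_var g g' \<sigma>') ((`) \<sigma>') ((`) h ` F) = cyc_sum (edge_var g g' \<sigma>) ((`) \<sigma>) F"
proof (rule cyc_sum_transport[OF assms(1)])
  show "inj_on ((`) h) F" using inj_image[OF assms(2)] inj_on_subset by blast
  show "\<sigma>' ` h ` x = h ` \<sigma> ` x" if "x \<in> F" for x unfolding image_image by (rule image_cong[OF refl]) (use that assms(3) in auto)
  fix c assume "c \<in> orbit ((`) \<sigma>) ` F"
  then have c: "c \<subseteq> F" using orbit_subset_closed[OF assms(1)] by auto
  have cl: "(\<sigma> ^^ n) x \<in> \<Union>F" if "x \<in> \<Union>F" for n x
    by (rule funpow_closed) (use that assms(1) in auto)
  have "(\<sigma>' ^^ n) (h x) = h ((\<sigma> ^^ n) x)" if "x \<in> \<Union>F" for n x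
    by (induction n) (use assms(3) cl[OF that] in auto)
  then have *: "(\<sigma>' ^^ n) (h x) = h x \<longleftrightarrow> (\<sigma> ^^ n) x = x" if "x \<in> \<Union>F" for n x
    using that assms(2) by (simp add: inj_eq)
  have cd: "card ((`) h ` c) = card c"
    by (rule card_image) (use inj_image[OF assms(2)] inj_on_subset in blast)
  have "cylindrical \<sigma>' ((`) h ` c) \<longleftrightarrow> cylindrical \<sigma> c"
    unfolding cylindrical_def cd using *[OF UnionI[OF subsetD[OF c]]] by auto
  then show "edge_var g g' \<sigma>' ((`) h ` c) = edge_var g g' \<sigma> c" by (simp add: edge_var_def cd)
qed

lemma eweight_transport:
  assumes "(`) \<sigma> ` F \<subseteq> F" "inj h" "\<And>x. x \<in> \<Union>F \<Longrightarrow> \<sigma>' (h x) = h (\<sigma> x)"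
  shows "eweight ((`) h ` F) \<sigma>' = eweight F \<sigma>"
  unfolding eweight_def by (rule cyc_sum_edges_transport[OF assms])

lemma vweight_cong: "\<sigma> ` X \<subseteq> X \<Longrightarrow> (\<And>x. x \<in> X \<Longrightarrow> \<sigma>' x = \<sigma> x) \<Longrightarrow> vweight X \<sigma>' = vweight X \<sigma>"
  using vweight_transport[of \<sigma> X id \<sigma>'] by simp

lemma eweight_cong: "(`) \<sigma> ` F \<subseteq> F \<Longrightarrow> (\<And>x. x \<in> \<Union>F \<Longrightarrow> \<sigma>' x = \<sigma> x) \<Longrightarrow> eweight F \<sigma>' = eweight F \<sigma>"
  using eweight_transport[of \<sigma> F id \<sigma>'] by (simp add: image_image)

section \<open>Dilation of monomials along a return map\<close>

definition dilate_mon :: "nat \<Rightarrow> (walsh_var \<Rightarrow>\<^sub>0 nat) \<Rightarrow> (walsh_var \<Rightarrow>\<^sub>0 nat)" where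
  "dilate_mon k m = (\<Sum>v\<in>Poly_Mapping.keys m. Poly_Mapping.single (dilate_var k v) (Poly_Mapping.lookup m v))"

lemma dilate_mon_superset:
  "finite K \<Longrightarrow> Poly_Mapping.keys m \<subseteq> K \<Longrightarrow>
    dilate_mon k m = (\<Sum>v\<in>K. Poly_Mapping.single (dilate_var k v) (Poly_Mapping.lookup m v))"
  unfolding dilate_mon_def by (rule sum.mono_neutral_left) (auto simp: in_keys_iff)

lemma dilate_mon_add: "dilate_mon k (m + n) = dilate_mon k m + dilate_mon k n"
proof -
  let ?K = "Poly_Mapping.keys m \<union> Poly_Mapping.keys n"
  have "dilate_mon k (m + n) = (\<Sum>v\<in>?K. Poly_Mapping.single (dilate_var k v) (Poly_Mapping.lookup (m + n) v))"
    by (rule dilate_mon_superset) (use Poly_Mapping.keys_add[of m n] in auto)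
  then show ?thesis
    by (simp add: dilate_mon_superset[of ?K] lookup_add single_add sum.distrib)
qed

lemma dilate_mon_zero [simp]: "dilate_mon k 0 = 0" by (simp add: dilate_mon_def)

lemma dilate_mon_single [simp]: "dilate_mon k (Poly_Mapping.single v j) = Poly_Mapping.single (dilate_var k v) j"
  by (simp add: dilate_mon_def)

lemma dilate_mon_sum: "dilate_mon k (\<Sum>i\<in>I. f i) = (\<Sum>i\<in>I. dilate_mon k (f i))"
  by (induction I rule: infinite_finite_induct) (auto simp: dilate_mon_add)

lemma inj_dilate_var: "0 < k \<Longrightarrow> inj (dilate_var k)"
proof (rule injI)
  fix x y assume "0 < k" "dilate_var k x = dilate_var k y"
  then show "x = y" by (cases x; cases y) auto
qed

lemma lookup_dilate_mon: "0 < k \<Longrightarrow> Poly_Mapping.lookup (dilate_mon k m) (dilate_var k v) = Poly_Mapping.lookup m v"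
proof -
  assume k: "0 < k"
  have "Poly_Mapping.lookup (dilate_mon k m) (dilate_var k v) =
     (\<Sum>w\<in>insert v (Poly_Mapping.keys m). if w = v then Poly_Mapping.lookup m w else 0)"
    by (subst dilate_mon_superset[of "insert v (Poly_Mapping.keys m)"])
      (auto simp: lookup_sum lookup_single inj_eq[OF inj_dilate_var[OF k]] when_def intro!: sum.cong)
  then show ?thesis by (simp add: sum.delta)
qed

lemma inj_dilate_mon: "0 < k \<Longrightarrow> inj (dilate_mon k)"
  by (rule injI, rule poly_mapping_eqI) (metis lookup_dilate_mon)

lemma mdeg_dilate_mon: "mdeg vdeg (dilate_mon k m) = k * mdeg vdeg m"
proof -
  have "vdeg (dilate_var k v) = k * vdeg v" for v by (cases v) (auto simp: vdeg_def)
  then show ?thesis unfolding dilate_mon_def by (simp add: mdeg_sum mdeg_def[of _ m] sum_distrib_left mult.assoc)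
qed

lemma vweight_spread:
  assumes "inj f" "finite X" "(f ^^ k) ` X = X" "0 < k"
    and d: "\<And>i. 0 < i \<Longrightarrow> i < k \<Longrightarrow> (f ^^ i) ` X \<inter> X = {}"
  shows "vweight (spread k f X) f = dilate_mon k (vweight X (f ^^ k))"
proof -
  have "card (spread k f c) = k * card c" if "c \<in> orbit (f ^^ k) ` X" for c
    by (rule card_spread[OF assms(1,2,4) _ d]) (use that orbit_subset_closed[of "f ^^ k" X] assms(3) in auto)
  moreover have "vweight (spread k f X) f = cyc_sum (\<lambda>c. VA (card (spread k f c))) (f ^^ k) X"
    unfolding vweight_def by (rule cyc_sum_spread[OF assms])
  ultimately show ?thesis by (auto simp: vweight_def cyc_sum_def dilate_mon_sum intro!: sum.cong)
qed

text \<open>A cycle of length l of \<open>f ^^ k\<close> sweeps out a cycle of length k l of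
  \<open>f\<close>, and the power of \<open>f\<close> with exponent k l is the l-th power of
  \<open>f ^^ k\<close>. So the type of the cycle is kept while its length is multiplied by
  \<open>k\<close>.\<close>

lemma eweight_spread:
  assumes "inj f" "finite F" "(`) (f ^^ k) ` F = F" "0 < k"
    and d: "\<And>i. 0 < i \<Longrightarrow> i < k \<Longrightarrow> (`) (f ^^ i) ` F \<inter> F = {}"
  shows "eweight (spread k ((`) f) F) f = dilate_mon k (eweight F (f ^^ k))"
proof -
  have ik: "(`) f ^^ i = (`) (f ^^ i)" for i by (rule ext) (rule funpow_image)
  note inj = inj_image[OF assms(1)]
  have *: "edge_var VB VC f (spread k ((`) f) c) = dilate_var k (edge_var VB VC (f ^^ k) c)"
    if "c \<in> orbit ((`) (f ^^ k)) ` F" for c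
  proof -
    have "c \<subseteq> F" using that orbit_subset_closed[of "(`) (f ^^ k)" F] assms(3) by auto
    then have cd: "card (spread k ((`) f) c) = k * card c"
      by (rule card_spread[OF inj assms(2,4)]) (use d ik in auto)
    have p: "(f ^^ (k * card c)) x = ((f ^^ k) ^^ card c) x" for x by (simp add: funpow_mult)
    have "cylindrical f (spread k ((`) f) c) \<longleftrightarrow> cylindrical (f ^^ k) c"
    proof
      assume a: "cylindrical f (spread k ((`) f) c)"
      then show "cylindrical (f ^^ k) c" unfolding cylindrical_def cd p
        using subset_spread[OF assms(4), of c "(`) f"] by blast
    next
      assume a: "cylindrical (f ^^ k) c"
      \<comment> \<open>Translated edges inherit the fixed points because powers of \<open>f\<close>
        commute.\<close>
      have "(f ^^ (k * card c)) ((f ^^ i) x) = (f ^^ i) x" if "x \<in> e" "e \<in> c" for i x e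
      proof -
        have "(f ^^ (k * card c)) x = x" using a that unfolding cylindrical_def p by blast
        moreover have "(f ^^ (k * card c)) ((f ^^ i) x) = (f ^^ i) ((f ^^ (k * card c)) x)"
          by (metis add.commute comp_apply funpow_add)
        ultimately show ?thesis by simp
      qed
      then show "cylindrical f (spread k ((`) f) c)"
        unfolding cylindrical_def cd by (auto simp: spread_def ik)
    qed
    then show ?thesis by (simp add: edge_var_def cd)
  qed
  have "eweight (spread k ((`) f) F) f = cyc_sum (\<lambda>c. edge_var VB VC f (spread k ((`) f) c)) ((`) (f ^^ k)) F"
    unfolding eweight_def using cyc_sum_spread[OF inj assms(2) _ assms(4), of "edge_var VB VC f"] assms(3) d ik by simp
  also have "\<dots> = dilate_mon k (eweight F (f ^^ k))"
    unfolding eweight_def cyc_sum_def dilate_mon_sum using * by (auto intro!: sum.cong)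
  finally show ?thesis .
qed

section \<open>Sums over isomorphism classes and labelled sums\<close>

lemma coeff_scale [simp]: "coeff (scale r f) m = r * coeff f m"
  by (simp add: scale_def)

lemma coeff_monomial_series: "coeff (monomial_series n) m = (if m = n then 1 else 0)"
  by (simp add: monomial_series_def)

lemma coeff_sum [simp]: "coeff (\<Sum>i\<in>I. f i) m = (\<Sum>i\<in>I. coeff (f i) m)"
  by (induction I rule: infinite_finite_induct) auto

lemma monomial_series_mult: "monomial_series p * monomial_series q = monomial_series (p + q)"
proof (rule series_eqI)
  fix m
  have "coeff (monomial_series p * monomial_series q) m = (\<Sum>x\<in>splits m. if x = (p, q) then 1 else 0)"
    unfolding coeff_mult by (rule sum.cong) (auto simp: coeff_monomial_series split: if_splits)
  also have "\<dots> = (if p + q = m then 1 else 0)" unfolding sum.delta[OF finite_splits] by (simp add: splits_def)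
  finally show "coeff (monomial_series p * monomial_series q) m = coeff (monomial_series (p + q)) m"
    by (auto simp: coeff_monomial_series)
qed

lemma monomial_series_zero: "monomial_series 0 = 1"
  by (rule series_eqI) (simp add: coeff_monomial_series coeff_one)

text \<open>Lets an isomorphism, which is constrained on vertices only, be replaced by a permutation
  of labels. The leftovers \<open>Y - X\<close> and \<open>X - Y\<close> have the same size and are
  matched arbitrarily.\<close>

lemma extend_bij_betw:
  assumes "finite X" "finite Y" "bij_betw f X Y"
  shows "\<exists>\<pi>. \<pi> permutes (X \<union> Y) \<and> (\<forall>x\<in>X. \<pi> x = f x)"
proof -
  have "card (Y - X) = card (X - Y)"
    using bij_betw_same_card[OF assms(3)] assms(1,2)
    by (metis Int_commute card_Diff_subset_Int finite_Int)
  then obtain g where g: "bij_betw g (Y - X) (X - Y)"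
    using assms(1,2) finite_same_card_bij by blast
  define \<pi> where "\<pi> x = (if x \<in> X then f x else if x \<in> Y then g x else x)" for x
  have "bij_betw \<pi> (X \<union> (Y - X)) (Y \<union> (X - Y))"
  proof (rule bij_betw_combine)
    show "bij_betw \<pi> X Y" using assms(3) by (simp add: \<pi>_def cong: bij_betw_cong)
    show "bij_betw \<pi> (Y - X) (X - Y)"
      using g by (subst bij_betw_cong[of _ _ g]) (auto simp: \<pi>_def)
  qed auto
  then have "bij_betw \<pi> (X \<union> Y) (X \<union> Y)" by (simp add: Un_commute)
  then have "\<pi> permutes (X \<union> Y)" by (rule bij_imp_permutes) (auto simp: \<pi>_def)
  then show ?thesis by (intro exI[of _ \<pi>]) (auto simp: \<pi>_def)
qed

lemma average_coeff:
  assumes "finite A"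
  shows "coeff (average A f) m * of_nat (card A) = (\<Sum>a\<in>A. coeff (f a) m)"
  using assms by (cases "A = {}") (auto simp: average_def)

lemma average_bij_betw:
  assumes "bij_betw h A B" "\<And>a. a \<in> A \<Longrightarrow> g (h a) = f a"
  shows "average B g = average A f"
proof -
  have "sum g B = sum f A"
    using sum.reindex_bij_betw[OF assms(1), of g] assms(2) by simp
  then show ?thesis using bij_betw_same_card[OF assms(1)] by (simp add: average_def)
qed

text \<open>Isomorphism classes as orbits: bijections of the label type act on the structures, and
  being isomorphic means lying in one orbit. Graphs, cored graphs and networks are the
  instances.\<close>

locale relabelling =
  fixes S :: "'s set" and act :: "('a \<Rightarrow> 'a) \<Rightarrow> 's \<Rightarrow> 's" and isom :: "'s \<Rightarrow> 's \<Rightarrow> bool"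
  assumes act_id: "x \<in> S \<Longrightarrow> act id x = x"
    and act_comp: "x \<in> S \<Longrightarrow> bij \<pi> \<Longrightarrow> bij \<rho> \<Longrightarrow> act (\<pi> \<circ> \<rho>) x = act \<pi> (act \<rho> x)"
    and act_closed: "x \<in> S \<Longrightarrow> bij \<pi> \<Longrightarrow> act \<pi> x \<in> S"
    and isom_iff: "x \<in> S \<Longrightarrow> y \<in> S \<Longrightarrow> isom x y \<longleftrightarrow> (\<exists>\<pi>. bij \<pi> \<and> act \<pi> x = y)"
begin

lemma act_inv: "x \<in> S \<Longrightarrow> bij \<pi> \<Longrightarrow> act (inv \<pi>) (act \<pi> x) = x"
  using act_comp[of x "inv \<pi>" \<pi>] act_id by (simp add: bij_imp_bij_inv bij_is_inj inv_o_cancel)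

abbreviation "rel \<equiv> {(x, y). x \<in> S \<and> y \<in> S \<and> isom x y}"

lemma equiv_rel: "equiv S rel"
proof (rule equivI)
  show "rel \<subseteq> S \<times> S" by auto
  show "refl_on S rel" using isom_iff act_id by (auto simp: refl_on_def intro!: exI[of _ id])
  show "sym rel"
  proof (rule symI)
    fix x y assume "(x, y) \<in> rel"
    then obtain \<pi> where "x \<in> S" "y \<in> S" "bij \<pi>" "act \<pi> x = y" using isom_iff by auto
    then have "bij (inv \<pi>) \<and> act (inv \<pi>) y = x" using act_inv bij_imp_bij_inv by blast
    then show "(y, x) \<in> rel" using isom_iff \<open>x \<in> S\<close> \<open>y \<in> S\<close> by blast
  qed
  show "trans rel"
  proof (rule transI)
    fix x y z assume "(x, y) \<in> rel" "(y, z) \<in> rel"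
    then obtain \<pi> \<rho> where *: "x \<in> S" "z \<in> S" "bij \<pi>" "act \<pi> x = y" "bij \<rho>" "act \<rho> y = z" using isom_iff by auto
    then have "bij (\<rho> \<circ> \<pi>) \<and> act (\<rho> \<circ> \<pi>) x = z" using act_comp bij_comp by metis
    then show "(x, z) \<in> rel" using isom_iff * by blast
  qed
qed

text \<open>Sort the permutations of \<open>V\<close> by the image of \<open>y0\<close>. Every fibre
  is a coset of a stabiliser, and \<open>T_iso\<close> makes the images exhaust the members of
  \<open>T\<close> isomorphic to \<open>y0\<close>, although isomorphisms are bijections of all
  labels.\<close>

lemma orbit_stabilizer:
  assumes V: "finite V" and TS: "T \<subseteq> S" and finT: "finite T"
    and T_closed: "\<And>x \<pi>. x \<in> T \<Longrightarrow> \<pi> permutes V \<Longrightarrow> act \<pi> x \<in> T"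
    and T_iso: "\<And>x \<pi>. x \<in> T \<Longrightarrow> bij \<pi> \<Longrightarrow> act \<pi> x \<in> T \<Longrightarrow> \<exists>\<rho>. \<rho> permutes V \<and> act \<rho> x = act \<pi> x"
    and y0: "y0 \<in> T"
  shows "(\<Sum>y\<in>{y\<in>T. rel `` {y} = rel `` {y0}}. card {\<pi>. \<pi> permutes V \<and> act \<pi> y = y}) = fact (card V)"
proof -
  let ?P = "{\<pi>. \<pi> permutes V}" and ?O = "{y\<in>T. rel `` {y} = rel `` {y0}}"
  have bijP: "bij \<pi>" if "\<pi> permutes V" for \<pi> using that permutes_bij by blast
  have O: "y \<in> ?O \<longleftrightarrow> (\<exists>\<pi>. \<pi> permutes V \<and> act \<pi> y0 = y)" for y
  proof
    assume "y \<in> ?O"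
    then have yT: "y \<in> T" and "rel `` {y0} = rel `` {y}" by auto
    then have "(y0, y) \<in> rel" using eq_equiv_class_iff[OF equiv_rel, of y0 y] TS y0 by blast
    then obtain \<pi> where "bij \<pi>" "act \<pi> y0 = y" using isom_iff TS y0 by auto
    then show "\<exists>\<pi>. \<pi> permutes V \<and> act \<pi> y0 = y" using T_iso[OF y0] yT by blast
  next
    assume "\<exists>\<pi>. \<pi> permutes V \<and> act \<pi> y0 = y"
    then obtain \<pi> where p: "\<pi> permutes V" "act \<pi> y0 = y" by blast
    then have "y \<in> T" using T_closed y0 by blast
    moreover have "(y0, y) \<in> rel" using p isom_iff bijP TS y0 \<open>y \<in> T\<close> by blast
    ultimately show "y \<in> ?O" using equiv_class_eq[OF equiv_rel] by blast
  qed
  have fib: "card {\<pi> \<in> ?P. act \<pi> y0 = y} = card {\<pi>. \<pi> permutes V \<and> act \<pi> y = y}" if y: "y \<in> ?O" for y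
  proof -
    obtain \<pi>0 where p0: "\<pi>0 permutes V" "act \<pi>0 y0 = y" using y O by blast
    have yS: "y \<in> S" "y0 \<in> S" using y y0 TS by auto
    have i0: "inv \<pi>0 permutes V" using p0 permutes_inv by blast
    have iy: "act (inv \<pi>0) y = y0" using act_inv[OF yS(2) bijP[OF p0(1)]] p0 by simp
    \<comment> \<open>Right composition with one permutation carrying \<open>y0\<close> to
      \<open>y\<close> matches the stabiliser of \<open>y\<close> with the fibre over
      \<open>y\<close>.\<close>
    have "bij_betw (\<lambda>\<pi>. \<pi> \<circ> \<pi>0) {\<pi>. \<pi> permutes V \<and> act \<pi> y = y} {\<pi> \<in> ?P. act \<pi> y0 = y}"
    proof (rule bij_betw_byWitness[where f' = "\<lambda>\<pi>. \<pi> \<circ> inv \<pi>0"])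
      show "\<forall>\<pi>\<in>{\<pi>. \<pi> permutes V \<and> act \<pi> y = y}. (\<pi> \<circ> \<pi>0) \<circ> inv \<pi>0 = \<pi>"
        using permutes_inv_o[OF p0(1)] by (simp add: comp_assoc)
      show "\<forall>\<pi>\<in>{\<pi> \<in> ?P. act \<pi> y0 = y}. (\<pi> \<circ> inv \<pi>0) \<circ> \<pi>0 = \<pi>"
        using permutes_inv_o[OF p0(1)] by (simp add: comp_assoc)
      show "(\<lambda>\<pi>. \<pi> \<circ> \<pi>0) ` {\<pi>. \<pi> permutes V \<and> act \<pi> y = y} \<subseteq> {\<pi> \<in> ?P. act \<pi> y0 = y}"
      proof (rule image_subsetI)
        fix \<pi> assume "\<pi> \<in> {\<pi>. \<pi> permutes V \<and> act \<pi> y = y}"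
        then show "\<pi> \<circ> \<pi>0 \<in> {\<pi> \<in> ?P. act \<pi> y0 = y}"
          using p0 permutes_compose[OF p0(1)] act_comp[OF yS(2) bijP bijP[OF p0(1)]] by simp
      qed
      show "(\<lambda>\<pi>. \<pi> \<circ> inv \<pi>0) ` {\<pi> \<in> ?P. act \<pi> y0 = y} \<subseteq> {\<pi>. \<pi> permutes V \<and> act \<pi> y = y}"
      proof (rule image_subsetI)
        fix \<pi> assume "\<pi> \<in> {\<pi> \<in> ?P. act \<pi> y0 = y}"
        then show "\<pi> \<circ> inv \<pi>0 \<in> {\<pi>. \<pi> permutes V \<and> act \<pi> y = y}"
          using permutes_compose[OF i0, of \<pi>] act_comp[OF yS(1) bijP[of \<pi>] bijP[OF i0]] by (simp only: mem_Collect_eq iy simp_thms)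
      qed
    qed
    from bij_betw_same_card[OF this] show ?thesis by (rule sym)
  qed
  have "(\<Sum>y\<in>?O. card {\<pi>. \<pi> permutes V \<and> act \<pi> y = y}) = (\<Sum>y\<in>?O. \<Sum>\<pi>\<in>{\<pi> \<in> ?P. act \<pi> y0 = y}. 1)"
    by (rule sum.cong[OF refl]) (simp only: fib[symmetric], simp only: card_eq_sum)
  also have "\<dots> = (\<Sum>\<pi>\<in>?P. 1)"
  proof (rule sum.group)
    show "finite ?P" using finite_permutations V by blast
    show "(\<lambda>\<pi>. act \<pi> y0) ` ?P \<subseteq> ?O" using O by blast
  qed (use finT in simp)
  also have "\<dots> = fact (card V)" using card_permutations[OF refl V] by simp
  finally show ?thesis .
qed

text \<open>Passage from classes to labelled structures: within a class that meets \<open>T\<close>,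
  the orders of the stabilisers of its members in \<open>T\<close> add up to |V|! by
  \<open>orbit_stabilizer\<close>. By \<open>cover\<close>, classes that miss \<open>T\<close> have
  coefficient 0.\<close>

lemma coeff_class_sum:
  assumes V: "finite V" and TS: "T \<subseteq> S" and finT: "finite T"
    and T_closed: "\<And>x \<pi>. x \<in> T \<Longrightarrow> \<pi> permutes V \<Longrightarrow> act \<pi> x \<in> T"
    and T_iso: "\<And>x \<pi>. x \<in> T \<Longrightarrow> bij \<pi> \<Longrightarrow> act \<pi> x \<in> T \<Longrightarrow> \<exists>\<rho>. \<rho> permutes V \<and> act \<rho> x = act \<pi> x"
    and inv: "\<And>x \<pi>. x \<in> S \<Longrightarrow> bij \<pi> \<Longrightarrow> f (act \<pi> x) = f x"
    and cover: "\<And>x. x \<in> S \<Longrightarrow> coeff (f x) m \<noteq> 0 \<Longrightarrow> \<exists>\<pi>. bij \<pi> \<and> act \<pi> x \<in> T"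
  shows "fact (card V) * coeff (class_sum isom S f) m =
    (\<Sum>y\<in>T. coeff (f y) m * of_nat (card {\<pi>. \<pi> permutes V \<and> act \<pi> y = y}))"
proof -
  define F where "F K = coeff (f (SOME x. x \<in> K)) m" for K
  let ?cl = "\<lambda>y. rel `` {y}"
  have F: "F (?cl y) = coeff (f y) m" if yS: "y \<in> S" for y
  proof -
    have "y \<in> ?cl y" using yS equiv_class_self[OF equiv_rel] by blast
    then have "(SOME x. x \<in> ?cl y) \<in> ?cl y" by (rule someI)
    then have "isom y (SOME x. x \<in> ?cl y)" "(SOME x. x \<in> ?cl y) \<in> S" by blast+
    then obtain \<pi> where p: "bij \<pi>" "act \<pi> y = (SOME x. x \<in> ?cl y)" using isom_iff[OF yS] by blast
    show ?thesis unfolding F_def p(2)[symmetric] inv[OF yS p(1)] ..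
  qed
  have "coeff (class_sum isom S f) m = (\<Sum>K\<in>{K\<in>S // rel. F K \<noteq> 0}. F K)"
    by (simp add: class_sum_def series_sum_def F_def)
  also have "\<dots> = (\<Sum>K\<in>?cl ` T. F K)"
  proof (rule sum.mono_neutral_left)
    show "finite (?cl ` T)" using finT by simp
    show "{K\<in>S // rel. F K \<noteq> 0} \<subseteq> ?cl ` T"
    proof
      fix K assume "K \<in> {K\<in>S // rel. F K \<noteq> 0}"
      then obtain x where x: "x \<in> S" "K = ?cl x" "F (?cl x) \<noteq> 0" by (auto elim!: quotientE)
      have "coeff (f x) m \<noteq> 0" using F[OF x(1)] x(3) by simp
      then obtain \<pi> where p: "bij \<pi>" "act \<pi> x \<in> T" using cover[OF x(1)] by blast
      then have "(x, act \<pi> x) \<in> rel" using isom_iff[OF x(1), of "act \<pi> x"] x(1) TS by blast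
      then have "K = ?cl (act \<pi> x)" using equiv_class_eq[OF equiv_rel] x(2) by simp
      then show "K \<in> ?cl ` T" using p(2) by (rule image_eqI)
    qed
    show "\<forall>K\<in>?cl ` T - {K \<in> S // rel. F K \<noteq> 0}. F K = 0"
    proof
      fix K assume K: "K \<in> ?cl ` T - {K \<in> S // rel. F K \<noteq> 0}"
      then have "K \<in> S // rel" using TS by (blast intro: quotientI)
      then show "F K = 0" using K by blast
    qed
  qed
  finally have "fact (card V) * coeff (class_sum isom S f) m =
      (\<Sum>K\<in>?cl ` T. F K * fact (card V))" by (simp add: sum_distrib_left mult.commute)
  also have "\<dots> = (\<Sum>K\<in>?cl ` T. \<Sum>y\<in>{y\<in>T. ?cl y = K}. coeff (f y) m * of_nat (card {\<pi>. \<pi> permutes V \<and> act \<pi> y = y}))"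
  proof (rule sum.cong[OF refl])
    fix K assume "K \<in> ?cl ` T"
    then obtain y0 where y0: "y0 \<in> T" "K = ?cl y0" by blast
    have "(\<Sum>y\<in>{y\<in>T. ?cl y = K}. coeff (f y) m * of_nat (card {\<pi>. \<pi> permutes V \<and> act \<pi> y = y})) =
      (\<Sum>y\<in>{y\<in>T. ?cl y = K}. F K * of_nat (card {\<pi>. \<pi> permutes V \<and> act \<pi> y = y}))"
      using F TS by (intro sum.cong) auto
    also have "\<dots> = F K * of_nat (\<Sum>y\<in>{y\<in>T. ?cl y = K}. card {\<pi>. \<pi> permutes V \<and> act \<pi> y = y})"
      by (simp add: sum_distrib_left)
    also have "\<dots> = F K * fact (card V)"
      by (simp only: y0(2) orbit_stabilizer[OF V TS finT T_closed T_iso y0(1)] of_nat_fact)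
    finally show "F K * fact (card V) = (\<Sum>y\<in>{y\<in>T. ?cl y = K}. coeff (f y) m * of_nat (card {\<pi>. \<pi> permutes V \<and> act \<pi> y = y}))" ..
  qed
  also have "\<dots> = (\<Sum>y\<in>T. coeff (f y) m * of_nat (card {\<pi>. \<pi> permutes V \<and> act \<pi> y = y}))"
    by (rule sum.group) (use finT in auto)
  finally show ?thesis .
qed

end

section \<open>Relabelling of graphs, structures and networks\<close>

definition relabel :: "('a \<Rightarrow> 'a) \<Rightarrow> 'a graph \<Rightarrow> 'a graph" where
  "relabel f G = Graph (f ` verts G) ((`) f ` edges G)"

lemma verts_relabel [simp]: "verts (relabel f G) = f ` verts G"
  and edges_relabel [simp]: "edges (relabel f G) = (`) f ` edges G"
  by (simp_all add: relabel_def)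

lemma graph_eqI: "verts G = verts H \<Longrightarrow> edges G = edges H \<Longrightarrow> G = H"
  by (cases G; cases H) auto

lemma relabel_id [simp]: "relabel id G = G"
  by (rule graph_eqI) simp_all

lemma inj_imp_inj_on: "inj f \<Longrightarrow> inj_on f A"
  by (simp add: inj_on_def)

lemma relabel_comp: "relabel (f \<circ> g) G = relabel f (relabel g G)"
  by (rule graph_eqI) (simp_all add: image_comp[symmetric] image_image)

lemma edge_subset: "simple_graph G \<Longrightarrow> e \<in> edges G \<Longrightarrow> e \<subseteq> verts G"
  by (simp add: simple_graph_def)

lemma edge_card: "simple_graph G \<Longrightarrow> e \<in> edges G \<Longrightarrow> card e = 2"
  by (simp add: simple_graph_def)

lemma simple_graph_finite: "simple_graph G \<Longrightarrow> finite (verts G)"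
  by (simp add: simple_graph_def)

lemma relabel_cong:
  assumes "simple_graph G" "\<And>x. x \<in> verts G \<Longrightarrow> f x = g x"
  shows "relabel f G = relabel g G"
proof (rule graph_eqI)
  have "f ` e = g ` e" if "e \<in> edges G" for e
    using edge_subset[OF assms(1) that] assms(2) by (intro image_cong) auto
  then show "edges (relabel f G) = edges (relabel g G)" by simp
qed (use assms(2) in simp)

lemma simple_graph_relabel: "simple_graph G \<Longrightarrow> inj f \<Longrightarrow> simple_graph (relabel f G)"
  unfolding simple_graph_def by (auto simp: card_image inj_on_subset)

lemma graph_iso_iff_relabel: "inj f \<Longrightarrow> graph_iso f G H \<longleftrightarrow> relabel f G = H"
  unfolding graph_iso_def bij_betw_def relabel_def
  by (cases H) (auto simp: inj_imp_inj_on)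

text \<open>Isomorphisms constrain values on vertices only. By \<open>extend_bij_betw\<close> they
  come from bijections of all labels, which is the form the group action demands.\<close>

lemma graph_iso_extend:
  assumes "simple_graph G" "graph_iso f G H"
  shows "\<exists>\<pi>. bij \<pi> \<and> (\<forall>x\<in>verts G. \<pi> x = f x) \<and> relabel \<pi> G = H"
proof -
  have b: "bij_betw f (verts G) (verts H)" "(`) f ` edges G = edges H" using assms(2) by (auto simp: graph_iso_def)
  have "finite (verts G)" "finite (verts H)"
    using simple_graph_finite[OF assms(1)] bij_betw_finite[OF b(1)] by auto
  then obtain \<pi> where p: "\<pi> permutes (verts G \<union> verts H)" "\<forall>x\<in>verts G. \<pi> x = f x"
    using extend_bij_betw[OF _ _ b(1)] by blast
  have "relabel \<pi> G = relabel f G" by (rule relabel_cong[OF assms(1)]) (use p in auto)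
  also have "relabel f G = H" by (rule graph_eqI) (use b in \<open>auto simp: bij_betw_def\<close>)
  finally show ?thesis using p permutes_bij by blast
qed

lemma graph_auts_eq: "graph_auts G = {\<sigma>. \<sigma> permutes verts G \<and> relabel \<sigma> G = G}"
  unfolding graph_auts_def using graph_iso_iff_relabel permutes_inj by blast

definition conjugate :: "('a \<Rightarrow> 'a) \<Rightarrow> ('a \<Rightarrow> 'a) \<Rightarrow> ('a \<Rightarrow> 'a)" where
  "conjugate \<pi> \<sigma> = \<pi> \<circ> \<sigma> \<circ> inv \<pi>"

lemma conjugate_apply: "bij \<pi> \<Longrightarrow> conjugate \<pi> \<sigma> (\<pi> x) = \<pi> (\<sigma> x)"
  by (simp add: conjugate_def bij_is_inj)

lemma conjugate_permutes: "bij \<pi> \<Longrightarrow> \<sigma> permutes X \<Longrightarrow> conjugate \<pi> \<sigma> permutes \<pi> ` X"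
proof (rule bij_imp_permutes)
  assume a: "bij \<pi>" "\<sigma> permutes X"
  have inj: "inj_on g Y" if "inj g" for g :: "'a \<Rightarrow> 'a" and Y using that inj_on_subset by blast
  show "bij_betw (conjugate \<pi> \<sigma>) (\<pi> ` X) (\<pi> ` X)"
    unfolding bij_betw_def conjugate_def
  proof
    show "inj_on (\<pi> \<circ> \<sigma> \<circ> inv \<pi>) (\<pi> ` X)"
      by (rule inj, intro inj_compose) (use a(1) permutes_inj[OF a(2)] in \<open>auto simp: bij_is_inj bij_imp_bij_inv\<close>)
    show "(\<pi> \<circ> \<sigma> \<circ> inv \<pi>) ` \<pi> ` X = \<pi> ` X"
      by (simp only: image_comp[symmetric] image_inv_f_f[OF bij_is_inj[OF a(1)]] permutes_image[OF a(2)])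
  qed
  fix x assume "x \<notin> \<pi> ` X"
  then have "inv \<pi> x \<notin> X" using a(1) by (metis bij_inv_eq_iff image_eqI)
  then have "\<sigma> (inv \<pi> x) = inv \<pi> x" using a(2) by (rule permutes_not_in[rotated])
  then show "conjugate \<pi> \<sigma> x = x" using a(1) by (simp add: conjugate_def bij_is_surj surj_f_inv_f)
qed

lemma conjugate_bij_betw:
  assumes "bij \<pi>"
    and "\<And>\<sigma>. \<sigma> \<in> A \<Longrightarrow> conjugate \<pi> \<sigma> \<in> B" "\<And>\<sigma>. \<sigma> \<in> B \<Longrightarrow> conjugate (inv \<pi>) \<sigma> \<in> A"
  shows "bij_betw (conjugate \<pi>) A B"
proof (rule bij_betw_byWitness[where f' = "conjugate (inv \<pi>)"])
  have "conjugate (inv \<pi>) (conjugate \<pi> \<sigma>) = \<sigma>" "conjugate \<pi> (conjugate (inv \<pi>) \<sigma>) = \<sigma>" for \<sigma>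
    using assms(1) by (auto simp: conjugate_def fun_eq_iff inv_inv_eq bij_is_inj bij_is_surj surj_f_inv_f)
  then show "\<forall>a\<in>A. conjugate (inv \<pi>) (conjugate \<pi> a) = a" "\<forall>a\<in>B. conjugate \<pi> (conjugate (inv \<pi>) a) = a" by auto
qed (use assms in auto)

lemma relabel_inv: "bij \<pi> \<Longrightarrow> relabel (inv \<pi>) (relabel \<pi> G) = G"
  by (simp add: relabel_comp[symmetric] bij_is_inj inv_o_cancel)

lemma relabel_conjugate: "bij \<pi> \<Longrightarrow> relabel (conjugate \<pi> \<sigma>) (relabel \<pi> G) = relabel \<pi> (relabel \<sigma> G)"
  unfolding conjugate_def relabel_comp by (simp add: relabel_inv)

lemma conjugate_graph_auts: "bij \<pi> \<Longrightarrow> \<sigma> \<in> graph_auts G \<Longrightarrow> conjugate \<pi> \<sigma> \<in> graph_auts (relabel \<pi> G)"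
  by (auto simp: graph_auts_eq relabel_conjugate conjugate_permutes)

lemma bij_betw_graph_auts: "bij \<pi> \<Longrightarrow> bij_betw (conjugate \<pi>) (graph_auts G) (graph_auts (relabel \<pi> G))"
  by (rule conjugate_bij_betw)
    (metis conjugate_graph_auts bij_imp_bij_inv relabel_inv)+

lemma relabel_fixed:
  assumes "relabel \<sigma> G = G"
  shows "\<sigma> ` verts G = verts G" "(`) \<sigma> ` edges G = edges G"
  using assms by (metis verts_relabel, metis edges_relabel)

lemma walsh_weight_relabel:
  assumes "simple_graph G" "bij \<pi>" "inj \<sigma>" "relabel \<sigma> G = G"
  shows "walsh_weight (relabel \<pi> G) (conjugate \<pi> \<sigma>) = walsh_weight G \<sigma>"
proof -
  have i: "inj \<pi>" using assms(2) by (rule bij_is_inj)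
  have ic: "inj (conjugate \<pi> \<sigma>)" unfolding conjugate_def using i assms(2,3)
    by (intro inj_compose) (auto simp: bij_imp_bij_inv bij_is_inj)
  have *: "relabel (conjugate \<pi> \<sigma>) (relabel \<pi> G) = relabel \<pi> G" by (simp add: relabel_conjugate assms)
  note f = relabel_fixed[OF assms(4)] and g = relabel_fixed[OF *]
  have "vweight (\<pi> ` verts G) (conjugate \<pi> \<sigma>) = vweight (verts G) \<sigma>"
    by (rule vweight_transport) (use f inj_imp_inj_on[OF i] conjugate_apply[OF assms(2)] in auto)
  moreover have "eweight ((`) \<pi> ` edges G) (conjugate \<pi> \<sigma>) = eweight (edges G) \<sigma>"
    by (rule eweight_transport) (use f i conjugate_apply[OF assms(2)] in auto)
  ultimately show ?thesis
    using walsh_weight_eq[OF assms(3,1)] walsh_weight_eq[OF ic simple_graph_relabel[OF assms(1) i]] f g by auto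
qed

lemma graph_auts_inj: "\<sigma> \<in> graph_auts G \<Longrightarrow> inj \<sigma>"
  by (auto simp: graph_auts_def permutes_inj)

lemma finite_graphs: "finite V \<Longrightarrow> finite {G. verts G \<subseteq> V \<and> edges G \<subseteq> Pow V}"
proof -
  assume "finite V"
  then have "finite ((\<lambda>(A, E). Graph A E) ` (Pow V \<times> Pow (Pow V)))" by simp
  moreover have "{G. verts G \<subseteq> V \<and> edges G \<subseteq> Pow V} \<subseteq> (\<lambda>(A, E). Graph A E) ` (Pow V \<times> Pow (Pow V))"
  proof
    fix G assume "G \<in> {G. verts G \<subseteq> V \<and> edges G \<subseteq> Pow V}"
    then show "G \<in> (\<lambda>(A, E). Graph A E) ` (Pow V \<times> Pow (Pow V))"
      by (intro image_eqI[where x="(verts G, edges G)"]) auto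
  qed
  ultimately show ?thesis by (rule rev_finite_subset)
qed

lemma finite_simple_graphs: "finite V \<Longrightarrow> finite {G. simple_graph G \<and> verts G \<subseteq> V}"
  by (rule finite_subset[OF _ finite_graphs[of V]]) (use edge_subset in blast)+

lemma finite_graph_auts: "simple_graph G \<Longrightarrow> finite (graph_auts G)"
  unfolding graph_auts_def using finite_permutations[OF simple_graph_finite] by (metis (no_types, lifting) finite_subset mem_Collect_eq subsetI)

lemma restrict_permutes:
  assumes "inj \<pi>" "\<pi> ` V = V"
  shows "(\<lambda>x. if x \<in> V then \<pi> x else x) permutes V"
proof (rule bij_imp_permutes)
  show "bij_betw (\<lambda>x. if x \<in> V then \<pi> x else x) V V"
    using assms by (subst bij_betw_cong[of _ _ \<pi>]) (auto simp: bij_betw_def inj_imp_inj_on)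
qed simp

lemma bij_to:
  fixes X Y :: "'a set"
  assumes "finite X" "finite Y" "card X = card Y"
  shows "\<exists>\<pi>. bij \<pi> \<and> \<pi> ` X = Y"
proof -
  obtain h where h: "bij_betw h X Y" using finite_same_card_bij[OF assms] by blast
  obtain \<pi> where "\<pi> permutes (X \<union> Y)" "\<forall>x\<in>X. \<pi> x = h x" using extend_bij_betw[OF assms(1,2) h] by blast
  then show ?thesis using h permutes_bij by (intro exI[of _ \<pi>]) (auto simp: bij_betw_def)
qed

section \<open>Graph species and the labelled form of the extended Walsh series\<close>

lemma graph_species_simple: "graph_species \<G> \<Longrightarrow> G \<in> \<G> \<Longrightarrow> simple_graph G"
  by (simp add: graph_species_def)

lemma graph_species_relabel: "graph_species \<G> \<Longrightarrow> G \<in> \<G> \<Longrightarrow> bij \<pi> \<Longrightarrow> relabel \<pi> G \<in> \<G>"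
  unfolding graph_species_def graph_isomorphic_def
  by (metis bij_is_inj graph_iso_iff_relabel simple_graph_relabel)

lemma relabelling_graphs:
  assumes "graph_species \<G>"
  shows "relabelling \<G> relabel graph_isomorphic"
proof
  show "graph_isomorphic x y \<longleftrightarrow> (\<exists>\<pi>. bij \<pi> \<and> relabel \<pi> x = y)" if "x \<in> \<G>" "y \<in> \<G>" for x y
    unfolding graph_isomorphic_def
    using graph_iso_extend[OF graph_species_simple[OF assms that(1)]] graph_iso_iff_relabel bij_is_inj by metis
qed (auto simp: relabel_comp graph_species_relabel[OF assms])

text \<open>\<open>VBeta k\<close> and \<open>VGamma k\<close> get degree 0: they stand for cycles
  of core edges, whereas this degree is to count the vertices of the core.\<close>

definition edeg :: "ext_var \<Rightarrow> nat" where
  "edeg v = (case v of Base u \<Rightarrow> vdeg u | _ \<Rightarrow> 0)"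

lemma matching_invariant:
  assumes "\<sigma> \<in> graph_auts G" "\<mu> \<in> fixed_matchings G \<sigma>"
  shows "(`) \<sigma> ` \<mu> = \<mu>" "(`) \<sigma> ` (edges G - \<mu>) = edges G - \<mu>" "\<mu> \<subseteq> edges G"
proof -
  show 1: "(`) \<sigma> ` \<mu> = \<mu>" and "\<mu> \<subseteq> edges G" using assms(2) by (auto simp: fixed_matchings_def is_matching_def)
  have "inj ((`) \<sigma>)" using assms(1) graph_auts_inj inj_image by blast
  then have "(`) \<sigma> ` (edges G - \<mu>) = (`) \<sigma> ` edges G - (`) \<sigma> ` \<mu>" by (rule image_set_diff)
  then show "(`) \<sigma> ` (edges G - \<mu>) = edges G - \<mu>"
    using 1 assms(1) relabel_fixed(2)[of \<sigma> G] by (simp add: graph_auts_eq)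
qed

lemma ext_weight_eq':
  assumes "simple_graph G" "\<sigma> \<in> graph_auts G" "\<mu> \<in> fixed_matchings G \<sigma>"
  shows "ext_weight G \<mu> \<sigma> = cyc_sum (\<lambda>c. Base (VA (card c))) \<sigma> (verts G) +
    cyc_sum (edge_var (\<lambda>k. Base (VB k)) (\<lambda>k. Base (VC k)) \<sigma>) ((`) \<sigma>) \<mu> +
    cyc_sum (edge_var VBeta VGamma \<sigma>) ((`) \<sigma>) (edges G - \<mu>)"
proof (rule ext_weight_eq)
  show "\<sigma> ` verts G \<subseteq> verts G" using assms(2) relabel_fixed(1)[of \<sigma> G] by (simp add: graph_auts_eq)
qed (use assms(1) matching_invariant[OF assms(2,3)] graph_auts_inj[OF assms(2)] in auto)

lemma conjugate_fixed_matchings: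
  assumes "bij \<pi>" "\<mu> \<in> fixed_matchings G \<sigma>"
  shows "(`) \<pi> ` \<mu> \<in> fixed_matchings (relabel \<pi> G) (conjugate \<pi> \<sigma>)"
proof -
  have m: "\<mu> \<subseteq> edges G" "pairwise disjnt \<mu>" "(`) \<sigma> ` \<mu> = \<mu>"
    using assms(2) by (auto simp: fixed_matchings_def is_matching_def)
  have "pairwise disjnt ((`) \<pi> ` \<mu>)"
    using m(2) bij_is_inj[OF assms(1)] by (auto simp: pairwise_def disjnt_def image_Int[symmetric] inj_image_eq_iff)
  moreover have "conjugate \<pi> \<sigma> ` \<pi> ` e = \<pi> ` \<sigma> ` e" for e
    by (simp add: image_image conjugate_apply[OF assms(1)])
  then have "(`) (conjugate \<pi> \<sigma>) ` (`) \<pi> ` \<mu> = (`) \<pi> ` (`) \<sigma> ` \<mu>"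
    by (simp add: image_image)
  ultimately show ?thesis using m by (auto simp: fixed_matchings_def is_matching_def)
qed

lemma bij_betw_fixed_matchings:
  assumes "bij \<pi>"
  shows "bij_betw ((`) ((`) \<pi>)) (fixed_matchings G \<sigma>) (fixed_matchings (relabel \<pi> G) (conjugate \<pi> \<sigma>))"
proof (rule bij_betw_byWitness[where f' = "(`) ((`) (inv \<pi>))"])
  have c: "conjugate (inv \<pi>) (conjugate \<pi> \<sigma>) = \<sigma>"
    using assms by (auto simp: conjugate_def fun_eq_iff inv_inv_eq bij_is_inj)
  show "\<forall>a\<in>fixed_matchings G \<sigma>. (`) (inv \<pi>) ` (`) \<pi> ` a = a"
    using assms by (simp add: image_image bij_is_inj image_comp inv_o_cancel)
  show "\<forall>a\<in>fixed_matchings (relabel \<pi> G) (conjugate \<pi> \<sigma>). (`) \<pi> ` (`) (inv \<pi>) ` a = a"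
    using assms by (simp add: image_image bij_is_surj surj_f_inv_f)
  show "(`) ((`) \<pi>) ` fixed_matchings G \<sigma> \<subseteq> fixed_matchings (relabel \<pi> G) (conjugate \<pi> \<sigma>)"
    using conjugate_fixed_matchings[OF assms] by blast
  show "(`) ((`) (inv \<pi>)) ` fixed_matchings (relabel \<pi> G) (conjugate \<pi> \<sigma>) \<subseteq> fixed_matchings G \<sigma>"
    using conjugate_fixed_matchings[OF bij_imp_bij_inv[OF assms], of _ "relabel \<pi> G" "conjugate \<pi> \<sigma>"]
    by (auto simp: c relabel_inv[OF assms])
qed

lemma ext_weight_relabel:
  assumes "simple_graph G" "bij \<pi>" "\<sigma> \<in> graph_auts G" "\<mu> \<in> fixed_matchings G \<sigma>"
  shows "ext_weight (relabel \<pi> G) ((`) \<pi> ` \<mu>) (conjugate \<pi> \<sigma>) = ext_weight G \<mu> \<sigma>"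
proof -
  have i: "inj \<pi>" using assms(2) by (rule bij_is_inj)
  note inv = matching_invariant[OF assms(3,4)]
  have fv: "\<sigma> ` verts G = verts G" using assms(3) relabel_fixed(1) by (auto simp: graph_auts_eq)
  have d: "(`) \<pi> ` edges G - (`) \<pi> ` \<mu> = (`) \<pi> ` (edges G - \<mu>)"
    by (rule image_set_diff[symmetric]) (rule inj_image[OF i])
  have "cyc_sum (\<lambda>c. Base (VA (card c))) (conjugate \<pi> \<sigma>) (\<pi> ` verts G) = cyc_sum (\<lambda>c. Base (VA (card c))) \<sigma> (verts G)"
    by (rule cyc_sum_transport)
      (use fv inj_imp_inj_on[OF i] conjugate_apply[OF assms(2)] in \<open>auto simp: card_image\<close>)
  moreover have "cyc_sum (edge_var g h (conjugate \<pi> \<sigma>)) ((`) (conjugate \<pi> \<sigma>)) ((`) \<pi> ` F) = cyc_sum (edge_var g h \<sigma>) ((`) \<sigma>) F"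
    if "(`) \<sigma> ` F = F" for g h :: "nat \<Rightarrow> ext_var" and F
    by (rule cyc_sum_edges_transport) (use that i conjugate_apply[OF assms(2)] in auto)
  ultimately show ?thesis
    using ext_weight_eq'[OF assms(1,3,4)] inv d
      ext_weight_eq'[OF simple_graph_relabel[OF assms(1) i] conjugate_graph_auts[OF assms(2,3)] conjugate_fixed_matchings[OF assms(2,4)]]
    by simp
qed

text \<open>Only vertex cycles count for \<open>edeg\<close>, and their lengths add up to the number
  of vertices.\<close>

lemma mdeg_ext_weight:
  assumes "simple_graph G" "\<sigma> \<in> graph_auts G" "\<mu> \<in> fixed_matchings G \<sigma>"
  shows "mdeg edeg (ext_weight G \<mu> \<sigma>) = card (verts G)"
proof -
  have "\<sigma> ` verts G = verts G" using assms(2) relabel_fixed(1) by (auto simp: graph_auts_eq)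
  then have "(\<Sum>c\<in>orbit \<sigma> ` verts G. card c) = card (verts G)"
    by (intro sum_card_orbits graph_auts_inj[OF assms(2)] simple_graph_finite[OF assms(1)]) auto
  then show ?thesis unfolding ext_weight_eq'[OF assms] cyc_sum_def
    by (auto simp: mdeg_sum edeg_def vdeg_def edge_var_def intro!: sum.neutral)
qed

lemma average_coeff_nonzero: "coeff (average A f) m \<noteq> 0 \<Longrightarrow> \<exists>a\<in>A. coeff (f a) m \<noteq> 0"
  unfolding average_def coeff_scale coeff_sum by (metis mult_zero_right sum.neutral)

text \<open>An instance of \<open>coeff_class_sum\<close> with the graphs on \<open>V\<close>: their
  stabilisers are the automorphism groups, which cancel the denominators of the averages.\<close>

lemma coeff_extended_walsh:
  assumes \<G>: "graph_species \<G>" and V: "finite V" and n: "mdeg edeg n = card V"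
  shows "fact (card V) * coeff (extended_walsh \<G>) n =
    (\<Sum>G\<in>{G\<in>\<G>. verts G = V}. \<Sum>\<sigma>\<in>graph_auts G. \<Sum>\<mu>\<in>fixed_matchings G \<sigma>.
      coeff (monomial_series (ext_weight G \<mu> \<sigma>)) n)"
proof -
  interpret relabelling \<G> relabel graph_isomorphic by (rule relabelling_graphs[OF \<G>])
  let ?T = "{G\<in>\<G>. verts G = V}"
  let ?g = "\<lambda>G \<sigma>. \<Sum>\<mu>\<in>fixed_matchings G \<sigma>. monomial_series (ext_weight G \<mu> \<sigma>)"
  let ?f = "\<lambda>G. average (graph_auts G) (?g G)"
  note sg = graph_species_simple[OF \<G>]
  have stab: "{\<pi>. \<pi> permutes V \<and> relabel \<pi> y = y} = graph_auts y" if "y \<in> ?T" for y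
    using that by (auto simp: graph_auts_eq)
  have "fact (card V) * coeff (class_sum graph_isomorphic \<G> ?f) n =
    (\<Sum>y\<in>?T. coeff (?f y) n * of_nat (card {\<pi>. \<pi> permutes V \<and> relabel \<pi> y = y}))"
  proof (rule coeff_class_sum[OF V])
    show "?T \<subseteq> \<G>" by blast
    show "finite ?T" by (rule finite_subset[OF _ finite_simple_graphs[OF V]]) (use sg in auto)
    show "relabel \<pi> x \<in> ?T" if "x \<in> ?T" "\<pi> permutes V" for x \<pi>
      using that graph_species_relabel[OF \<G> _ permutes_bij[OF that(2)]] permutes_image[OF that(2)] by simp
    show "\<exists>\<rho>. \<rho> permutes V \<and> relabel \<rho> x = relabel \<pi> x" if "x \<in> ?T" "bij \<pi>" "relabel \<pi> x \<in> ?T" for x \<pi>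
    proof (intro exI conjI)
      \<comment> \<open>The given bijection maps \<open>V\<close> onto itself but may move other
        labels; cut off outside \<open>V\<close> it is a permutation of \<open>V\<close> with the
        same effect.\<close>
      show "(\<lambda>x. if x \<in> V then \<pi> x else x) permutes V"
        by (rule restrict_permutes) (use that bij_is_inj in auto)
      show "relabel (\<lambda>x. if x \<in> V then \<pi> x else x) x = relabel \<pi> x"
        by (rule relabel_cong) (use that sg in auto)
    qed
    show "?f (relabel \<pi> x) = ?f x" if "x \<in> \<G>" "bij \<pi>" for x \<pi>
    proof (rule average_bij_betw[OF bij_betw_graph_auts[OF that(2)]])
      fix \<sigma> assume "\<sigma> \<in> graph_auts x"
      then show "?g (relabel \<pi> x) (conjugate \<pi> \<sigma>) = ?g x \<sigma>"
        by (subst sum.reindex_bij_betw[OF bij_betw_fixed_matchings[OF that(2)], symmetric])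
          (use ext_weight_relabel[OF sg[OF that(1)] that(2)] in simp)
    qed
    show "\<exists>\<pi>. bij \<pi> \<and> relabel \<pi> x \<in> ?T" if xS: "x \<in> \<G>" and "coeff (?f x) n \<noteq> 0" for x
    proof -
      have "\<exists>\<sigma>\<in>graph_auts x. coeff (?g x \<sigma>) n \<noteq> 0"
        by (rule average_coeff_nonzero[OF that(2)])
      then obtain \<sigma> where s: "\<sigma> \<in> graph_auts x" "coeff (?g x \<sigma>) n \<noteq> 0" by blast
      then have "\<exists>\<mu>\<in>fixed_matchings x \<sigma>. coeff (monomial_series (ext_weight x \<mu> \<sigma>)) n \<noteq> 0"
        unfolding coeff_sum by (metis (no_types, lifting) sum.neutral)
      then obtain \<mu> where m: "\<mu> \<in> fixed_matchings x \<sigma>" "ext_weight x \<mu> \<sigma> = n"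
        unfolding coeff_monomial_series by (auto split: if_splits)
      \<comment> \<open>A nonzero coefficient determines the number of vertices, so the graph can be
        relabelled onto \<open>V\<close>.\<close>
      have "card (verts x) = card V" using mdeg_ext_weight[OF sg[OF that(1)] s(1) m(1)] m(2) n by simp
      then obtain \<pi> where "bij \<pi>" "\<pi> ` verts x = V"
        using bij_to[OF simple_graph_finite[OF sg[OF xS]] V] by blast
      then show ?thesis using graph_species_relabel[OF \<G> that(1)] by auto
    qed
  qed
  also have "\<dots> = (\<Sum>G\<in>?T. \<Sum>\<sigma>\<in>graph_auts G. coeff (?g G \<sigma>) n)"
  proof (rule sum.cong[OF refl])
    fix y assume y: "y \<in> ?T"
    then have "finite (graph_auts y)" using sg finite_graph_auts by blast
    then show "coeff (?f y) n * of_nat (card {\<pi>. \<pi> permutes V \<and> relabel \<pi> y = y}) = (\<Sum>\<sigma>\<in>graph_auts y. coeff (?g y \<sigma>) n)"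
      unfolding stab[OF y] by (rule average_coeff)
  qed
  finally show ?thesis by (simp add: extended_walsh_def)
qed

section \<open>Networks under relabelling\<close>

definition relabel_net :: "('a \<Rightarrow> 'a) \<Rightarrow> 'a network \<Rightarrow> 'a network" where
  "relabel_net f N = Network (relabel f (net_graph N)) (f (pole0 N)) (f (pole1 N))"

lemma relabel_net_sel [simp]:
  "net_graph (relabel_net f N) = relabel f (net_graph N)"
  "pole0 (relabel_net f N) = f (pole0 N)" "pole1 (relabel_net f N) = f (pole1 N)"
  by (simp_all add: relabel_net_def)

lemma relabel_net_id [simp]: "relabel_net id N = N" by (simp add: relabel_net_def)

lemma relabel_net_comp: "relabel_net (f \<circ> g) N = relabel_net f (relabel_net g N)"
  by (simp add: relabel_net_def relabel_comp)

lemma network_eqI: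
  "net_graph N = net_graph M \<Longrightarrow> pole0 N = pole0 M \<Longrightarrow> pole1 N = pole1 M \<Longrightarrow> N = M"
  by (cases N; cases M) auto

lemma graph_connected_relabel:
  assumes "graph_connected G"
  shows "graph_connected (relabel f G)"
proof -
  let ?r = "{(x, y). {x, y} \<in> edges G}" and ?s = "{(x, y). {x, y} \<in> edges (relabel f G)}"
  have "(f u, f v) \<in> ?s\<^sup>*" if "(u, v) \<in> ?r\<^sup>*" for u v
    using that
  proof (induction rule: rtrancl_induct)
    case (step y z)
    then have "{f y, f z} = f ` {y, z}" "{y, z} \<in> edges G" by auto
    then have "(f y, f z) \<in> ?s" unfolding edges_relabel by blast
    then show ?case using step.IH by (rule rtrancl_into_rtrancl[rotated])
  qed simp
  then show ?thesis using assms unfolding graph_connected_def by simp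
qed

lemma delete_vertex_relabel:
  "inj f \<Longrightarrow> delete_vertex (relabel f G) (f v) = relabel f (delete_vertex G v)"
  by (rule graph_eqI) (auto simp: delete_vertex_def inj_image_mem_iff inj_eq)

lemma two_connected_relabel: "inj f \<Longrightarrow> two_connected G \<Longrightarrow> two_connected (relabel f G)"
  unfolding two_connected_def
  by (auto simp: graph_connected_relabel delete_vertex_relabel card_image inj_imp_inj_on)

lemma join_poles_relabel: "join_poles (relabel_net f N) = relabel f (join_poles N)"
  by (rule graph_eqI) (simp_all add: join_poles_def)

lemma is_network_relabel: "inj f \<Longrightarrow> is_network N \<Longrightarrow> is_network (relabel_net f N)"
  unfolding is_network_def
  by (auto simp: simple_graph_relabel graph_connected_relabel join_poles_relabel two_connected_relabel inj_eq)

lemma network_species_network: "network_species \<N> \<Longrightarrow> N \<in> \<N> \<Longrightarrow> is_network N"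
  by (simp add: network_species_def)

lemma network_species_relabel:
  assumes "network_species \<N>" "N \<in> \<N>" "inj f"
  shows "relabel_net f N \<in> \<N>"
proof -
  have "is_network (relabel_net f N)"
    by (rule is_network_relabel[OF assms(3) network_species_network[OF assms(1,2)]])
  moreover have "network_isomorphic N (relabel_net f N)"
    unfolding network_isomorphic_def by (rule exI[of _ f]) (simp add: graph_iso_iff_relabel[OF assms(3)])
  ultimately show ?thesis using assms(1,2) unfolding network_species_def by blast
qed

lemma internal_relabel: "inj f \<Longrightarrow> internal (relabel_net f N) = f ` internal N"
  by (auto simp: internal_def inj_eq)

lemma network_verts: "is_network N \<Longrightarrow> verts (net_graph N) = insert (pole0 N) (insert (pole1 N) (internal N))"
  by (auto simp: is_network_def internal_def)

section \<open>Cored graphs and the labelled form of the left-hand side\<close>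

fun relabel_cored :: "('a \<Rightarrow> 'a) \<Rightarrow> 'a cored_graph \<Rightarrow> 'a cored_graph" where
  "relabel_cored f (G, G\<^sub>0, \<mu>) = (relabel f G, relabel f G\<^sub>0, (`) f ` \<mu>)"

lemma relabel_cored_id [simp]: "relabel_cored id S = S" by (cases S) simp

lemma relabel_cored_comp: "relabel_cored (f \<circ> g) S = relabel_cored f (relabel_cored g S)"
  by (cases S) (simp add: relabel_comp image_image image_comp[symmetric])

lemma fst_relabel_cored [simp]: "fst (relabel_cored f S) = relabel f (fst S)"
  by (cases S) simp

lemma cored_iso_iff_relabel: "inj f \<Longrightarrow> cored_iso f S T \<longleftrightarrow> relabel_cored f S = T"
  by (cases S; cases T) (auto simp: graph_iso_iff_relabel)

lemma cored_auts_eq: "cored_auts S = {\<sigma>. \<sigma> permutes verts (fst S) \<and> relabel_cored \<sigma> S = S}"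
  unfolding cored_auts_def using cored_iso_iff_relabel permutes_inj by blast

text \<open>The condition on the witness in \<open>edge_substitution\<close>, named so that
  witnesses can be transported and compared.\<close>

definition substitution_family ::
  "'a network set \<Rightarrow> 'a graph \<Rightarrow> 'a set set \<Rightarrow> 'a graph \<Rightarrow> ('a set \<Rightarrow> 'a network) \<Rightarrow> bool" where
  "substitution_family \<N> G\<^sub>0 \<mu> G N \<longleftrightarrow>
        (\<forall>e\<in>edges G\<^sub>0 - \<mu>. N e \<in> \<N> \<and> {pole0 (N e), pole1 (N e)} = e \<and>
           internal (N e) \<inter> verts G\<^sub>0 = {}) \<and>
        (\<forall>e\<in>edges G\<^sub>0 - \<mu>. \<forall>e'\<in>edges G\<^sub>0 - \<mu>. e \<noteq> e' \<longrightarrow> internal (N e) \<inter> internal (N e') = {}) \<and>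
        verts G = verts G\<^sub>0 \<union> (\<Union>e\<in>edges G\<^sub>0 - \<mu>. internal (N e)) \<and>
        edges G = \<mu> \<union> (\<Union>e\<in>edges G\<^sub>0 - \<mu>. edges (net_graph (N e)))"

lemma edge_substitution_iff:
  "(G, G\<^sub>0, \<mu>) \<in> edge_substitution \<G> \<N> \<longleftrightarrow>
    G\<^sub>0 \<in> \<G> \<and> is_matching G\<^sub>0 \<mu> \<and> (\<exists>N. substitution_family \<N> G\<^sub>0 \<mu> G N)"
  by (simp add: edge_substitution_def substitution_family_def matched_graphs_def)

lemma substitution_simple_graph:
  assumes \<G>: "graph_species \<G>" and \<N>: "network_species \<N>" and S: "(G, G\<^sub>0, \<mu>) \<in> edge_substitution \<G> \<N>"
  shows "simple_graph G" "simple_graph G\<^sub>0" "verts G\<^sub>0 \<subseteq> verts G" "\<mu> \<subseteq> edges G\<^sub>0"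
proof -
  obtain N where N: "substitution_family \<N> G\<^sub>0 \<mu> G N" and G0: "G\<^sub>0 \<in> \<G>" "is_matching G\<^sub>0 \<mu>"
    using S unfolding edge_substitution_iff by blast
  show s: "simple_graph G\<^sub>0" using graph_species_simple[OF \<G> G0(1)] .
  show m: "\<mu> \<subseteq> edges G\<^sub>0" using G0(2) by (simp add: is_matching_def)
  show "verts G\<^sub>0 \<subseteq> verts G" using N by (auto simp: substitution_family_def)
  have net: "is_network (N e)" "{pole0 (N e), pole1 (N e)} = e" if "e \<in> edges G\<^sub>0 - \<mu>" for e
    using N that network_species_network[OF \<N>] by (auto simp: substitution_family_def)
  have v: "verts G = verts G\<^sub>0 \<union> (\<Union>e\<in>edges G\<^sub>0 - \<mu>. internal (N e))"
    and ed: "edges G = \<mu> \<union> (\<Union>e\<in>edges G\<^sub>0 - \<mu>. edges (net_graph (N e)))"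
    using N by (auto simp: substitution_family_def)
  have sn: "simple_graph (net_graph (N e))" if "e \<in> edges G\<^sub>0 - \<mu>" for e
    using net(1)[OF that] by (simp add: is_network_def)
  have "finite (internal (N e))" if "e \<in> edges G\<^sub>0 - \<mu>" for e
    using simple_graph_finite[OF sn[OF that]] by (simp add: internal_def)
  then have "finite (verts G)" unfolding v
    using simple_graph_finite[OF s] simple_graph_finite_edges[OF s] by auto
  moreover have "d \<subseteq> verts G \<and> card d = 2" if d: "d \<in> edges G" for d
  proof (cases "d \<in> \<mu>")
    case True
    then show ?thesis using m s v by (auto simp: simple_graph_def)
  next
    case False
    then obtain e where e: "e \<in> edges G\<^sub>0 - \<mu>" "d \<in> edges (net_graph (N e))" using d ed by auto
    have "d \<subseteq> insert (pole0 (N e)) (insert (pole1 (N e)) (internal (N e)))"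
      using edge_subset[OF sn[OF e(1)] e(2)] network_verts[OF net(1)[OF e(1)]] by simp
    moreover have "pole0 (N e) \<in> e" "pole1 (N e) \<in> e" using net(2)[OF e(1)] by auto
    moreover have "e \<subseteq> verts G\<^sub>0" using edge_subset[OF s] e(1) by blast
    ultimately have "d \<subseteq> verts G" unfolding v using e(1) by blast
    then show ?thesis using edge_card[OF sn[OF e(1)] e(2)] by simp
  qed
  ultimately show "simple_graph G" by (simp add: simple_graph_def)
qed

lemma is_matching_relabel: "inj f \<Longrightarrow> is_matching G \<mu> \<Longrightarrow> is_matching (relabel f G) ((`) f ` \<mu>)"
  by (auto simp: is_matching_def pairwise_def disjnt_def image_Int[symmetric] inj_image_eq_iff)

text \<open>A witness family is moved along with the core: the network at an edge of the relabelled
  core comes from the preimage of that edge.\<close>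

lemma edge_substitution_relabel:
  assumes \<G>: "graph_species \<G>" and \<N>: "network_species \<N>" and S: "S \<in> edge_substitution \<G> \<N>" and "bij \<pi>"
  shows "relabel_cored \<pi> S \<in> edge_substitution \<G> \<N>"
proof -
  obtain G G\<^sub>0 \<mu> where SG: "S = (G, G\<^sub>0, \<mu>)" by (cases S)
  obtain N where N: "substitution_family \<N> G\<^sub>0 \<mu> G N" and G0: "G\<^sub>0 \<in> \<G>" "is_matching G\<^sub>0 \<mu>"
    using S unfolding edge_substitution_iff SG by blast
  have i: "inj \<pi>" using assms(4) by (rule bij_is_inj)
  define M where "M e = relabel_net \<pi> (N (inv \<pi> ` e))" for e
  have M: "M (\<pi> ` e) = relabel_net \<pi> (N e)" for e unfolding M_def by (simp add: image_inv_f_f[OF i])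
  have Z: "(`) \<pi> ` edges G\<^sub>0 - (`) \<pi> ` \<mu> = (`) \<pi> ` (edges G\<^sub>0 - \<mu>)"
    by (rule image_set_diff[symmetric, OF inj_image[OF i]])
  have "substitution_family \<N> (relabel \<pi> G\<^sub>0) ((`) \<pi> ` \<mu>) (relabel \<pi> G) M"
    unfolding substitution_family_def edges_relabel verts_relabel Z
  proof (intro conjI)
    show "\<forall>e\<in>(`) \<pi> ` (edges G\<^sub>0 - \<mu>). M e \<in> \<N> \<and> {pole0 (M e), pole1 (M e)} = e \<and> internal (M e) \<inter> \<pi> ` verts G\<^sub>0 = {}"
    proof (rule ballI, elim imageE)
      fix e d assume "e = \<pi> ` d" "d \<in> edges G\<^sub>0 - \<mu>"
      then have d: "N d \<in> \<N>" "{pole0 (N d), pole1 (N d)} = d" "internal (N d) \<inter> verts G\<^sub>0 = {}" "e = \<pi> ` d"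
        using N by (auto simp: substitution_family_def)
      have "{pole0 (M e), pole1 (M e)} = \<pi> ` {pole0 (N d), pole1 (N d)}" unfolding d(4) M by simp
      moreover have "internal (M e) \<inter> \<pi> ` verts G\<^sub>0 = \<pi> ` (internal (N d) \<inter> verts G\<^sub>0)"
        unfolding d(4) M internal_relabel[OF i] by (rule image_Int[OF i, symmetric])
      ultimately show "M e \<in> \<N> \<and> {pole0 (M e), pole1 (M e)} = e \<and> internal (M e) \<inter> \<pi> ` verts G\<^sub>0 = {}"
        using d network_species_relabel[OF \<N> d(1) i] M by simp
    qed
    show "\<forall>e\<in>(`) \<pi> ` (edges G\<^sub>0 - \<mu>). \<forall>e'\<in>(`) \<pi> ` (edges G\<^sub>0 - \<mu>). e \<noteq> e' \<longrightarrow> internal (M e) \<inter> internal (M e') = {}"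
    proof (intro ballI, elim imageE, intro impI)
      fix e d e' d' assume "e = \<pi> ` d" "d \<in> edges G\<^sub>0 - \<mu>" "e' = \<pi> ` d'" "d' \<in> edges G\<^sub>0 - \<mu>" "e \<noteq> e'"
      moreover from this have "d \<noteq> d'" by blast
      ultimately have "internal (N d) \<inter> internal (N d') = {}" "e = \<pi> ` d" "e' = \<pi> ` d'"
        using N unfolding substitution_family_def by blast+
      then show "internal (M e) \<inter> internal (M e') = {}"
        by (simp add: M internal_relabel[OF i] image_Int[OF i, symmetric])
    qed
    show "\<pi> ` verts G = \<pi> ` verts G\<^sub>0 \<union> (\<Union>e\<in>(`) \<pi> ` (edges G\<^sub>0 - \<mu>). internal (M e))"
      using N by (simp add: substitution_family_def M internal_relabel[OF i] image_Un image_UN)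
    show "(`) \<pi> ` edges G = (`) \<pi> ` \<mu> \<union> (\<Union>e\<in>(`) \<pi> ` (edges G\<^sub>0 - \<mu>). edges (net_graph (M e)))"
      using N by (simp add: substitution_family_def M image_Un image_UN)
  qed
  then show ?thesis unfolding SG relabel_cored.simps edge_substitution_iff
    using graph_species_relabel[OF \<G> G0(1) assms(4)] is_matching_relabel[OF i G0(2)] by blast
qed

text \<open>The core and its matching live on vertices of the substituted graph, so agreement there
  suffices for all three components.\<close>

lemma relabel_cored_cong:
  assumes "graph_species \<G>" "network_species \<N>" "S \<in> edge_substitution \<G> \<N>"
    "\<And>x. x \<in> verts (fst S) \<Longrightarrow> f x = g x"
  shows "relabel_cored f S = relabel_cored g S"
proof -
  obtain G G\<^sub>0 \<mu> where SG: "S = (G, G\<^sub>0, \<mu>)" by (cases S)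
  note s = substitution_simple_graph[OF assms(1,2) assms(3)[unfolded SG]]
  have "f ` e = g ` e" if "e \<in> \<mu>" for e
  proof (rule image_cong[OF refl])
    fix x assume "x \<in> e"
    then have "x \<in> verts G" using that s(3,4) edge_subset[OF s(2), of e] by blast
    then show "f x = g x" using assms(4) SG by simp
  qed
  then show ?thesis unfolding SG using s assms(4) SG
    by (auto intro!: relabel_cong)
qed

text \<open>The isomorphism is extended to a bijection of labels by looking at the big graph alone;
  the core follows because its vertices are among those of the big graph.\<close>

lemma relabelling_cored:
  assumes \<G>: "graph_species \<G>" and \<N>: "network_species \<N>"
  shows "relabelling (edge_substitution \<G> \<N>) relabel_cored cored_isomorphic"
proof
  fix x y assume xy: "x \<in> edge_substitution \<G> \<N>" "y \<in> edge_substitution \<G> \<N>"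
  show "cored_isomorphic x y \<longleftrightarrow> (\<exists>\<pi>. bij \<pi> \<and> relabel_cored \<pi> x = y)"
  proof
    assume "cored_isomorphic x y"
    then obtain f where f: "cored_iso f x y" by (auto simp: cored_isomorphic_def)
    obtain G G\<^sub>0 \<mu> where x: "x = (G, G\<^sub>0, \<mu>)" by (cases x)
    obtain H H\<^sub>0 \<nu> where y: "y = (H, H\<^sub>0, \<nu>)" by (cases y)
    have f': "graph_iso f G H" "graph_iso f G\<^sub>0 H\<^sub>0" "(`) f ` \<mu> = \<nu>" using f x y by auto
    note s = substitution_simple_graph[OF \<G> \<N> xy(1)[unfolded x]]
    obtain \<pi> where p: "bij \<pi>" "\<forall>x\<in>verts G. \<pi> x = f x" "relabel \<pi> G = H"
      using graph_iso_extend[OF s(1) f'(1)] by blast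
    have "relabel_cored \<pi> x = relabel_cored f x"
      by (rule relabel_cored_cong[OF \<G> \<N> xy(1)]) (use p x in auto)
    also have "relabel_cored f x = y"
      using f' unfolding x y by (auto simp: graph_iso_def bij_betw_def intro!: graph_eqI)
    finally show "\<exists>\<pi>. bij \<pi> \<and> relabel_cored \<pi> x = y" using p by blast
  next
    assume "\<exists>\<pi>. bij \<pi> \<and> relabel_cored \<pi> x = y"
    then show "cored_isomorphic x y" unfolding cored_isomorphic_def using cored_iso_iff_relabel bij_is_inj by blast
  qed
qed (auto simp: relabel_cored_comp edge_substitution_relabel[OF \<G> \<N>])

lemma mdeg_walsh_weight:
  assumes "simple_graph G" "inj \<sigma>" "relabel \<sigma> G = G"
  shows "mdeg vdeg (walsh_weight G \<sigma>) = card (verts G)"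
proof -
  note f = relabel_fixed[OF assms(3)]
  show ?thesis
    using walsh_weight_eq[OF assms(2,1)] f mdeg_cyc_sum_vertices[OF assms(2) simple_graph_finite[OF assms(1)]]
    by (simp add: vweight_def eweight_def mdeg_cyc_sum_edges)
qed

lemma relabel_cored_inv: "bij \<pi> \<Longrightarrow> relabel_cored (inv \<pi>) (relabel_cored \<pi> S) = S"
  by (simp add: relabel_cored_comp[symmetric] bij_is_inj inv_o_cancel)

lemma relabel_cored_conjugate:
  "bij \<pi> \<Longrightarrow> relabel_cored (conjugate \<pi> \<sigma>) (relabel_cored \<pi> S) = relabel_cored \<pi> (relabel_cored \<sigma> S)"
  unfolding conjugate_def relabel_cored_comp by (simp add: relabel_cored_inv)

lemma conjugate_cored_auts:
  "bij \<pi> \<Longrightarrow> \<sigma> \<in> cored_auts S \<Longrightarrow> conjugate \<pi> \<sigma> \<in> cored_auts (relabel_cored \<pi> S)"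
  by (auto simp: cored_auts_eq relabel_cored_conjugate conjugate_permutes)

text \<open>Stabilisers of structures on \<open>V\<close> are exactly the groups over which the
  series averages, so the denominators cancel. The index set is finite because core and matching are
  built from vertices in \<open>V\<close>.\<close>

lemma coeff_walsh_substitution:
  assumes \<G>: "graph_species \<G>" and \<N>: "network_species \<N>" and V: "finite V" and m: "mdeg vdeg m = card V"
  shows "fact (card V) * coeff (walsh_substitution \<G> \<N>) m =
    (\<Sum>S\<in>{S\<in>edge_substitution \<G> \<N>. verts (fst S) = V}. \<Sum>\<sigma>\<in>cored_auts S.
      coeff (monomial_series (walsh_weight (fst S) \<sigma>)) m)"
    and "finite {S\<in>edge_substitution \<G> \<N>. verts (fst S) = V}"
proof -
  interpret relabelling "edge_substitution \<G> \<N>" relabel_cored cored_isomorphic by (rule relabelling_cored[OF \<G> \<N>])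
  let ?T = "{S\<in>edge_substitution \<G> \<N>. verts (fst S) = V}"
  let ?g = "\<lambda>S \<sigma>. monomial_series (walsh_weight (fst S) \<sigma>)"
  let ?f = "\<lambda>S. average (cored_auts S) (?g S)"
  have sg: "simple_graph (fst S)" if "S \<in> edge_substitution \<G> \<N>" for S
    using substitution_simple_graph(1)[OF \<G> \<N>] that by (cases S) auto
  have stab: "{\<pi>. \<pi> permutes V \<and> relabel_cored \<pi> y = y} = cored_auts y" if "y \<in> ?T" for y
    using that by (auto simp: cored_auts_eq)
  have fin: "finite (cored_auts y)" if "y \<in> edge_substitution \<G> \<N>" for y
    unfolding cored_auts_def
    by (rule finite_subset[OF _ finite_permutations[OF simple_graph_finite[OF sg[OF that]]]]) auto
  have aut: "relabel \<sigma> (fst y) = fst y" "inj \<sigma>" if "\<sigma> \<in> cored_auts y" for y \<sigma>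
    using that permutes_inj fst_relabel_cored[of \<sigma> y] by (auto simp: cored_auts_eq simp del: fst_relabel_cored)
  show finT: "finite ?T"
  proof (rule finite_subset)
    show "finite ({G. simple_graph G \<and> verts G \<subseteq> V} \<times> {G. simple_graph G \<and> verts G \<subseteq> V} \<times> Pow (Pow V))"
      using finite_simple_graphs[OF V] V by simp
    show "?T \<subseteq> {G. simple_graph G \<and> verts G \<subseteq> V} \<times> {G. simple_graph G \<and> verts G \<subseteq> V} \<times> Pow (Pow V)"
    proof
      fix S assume S: "S \<in> ?T"
      obtain G G\<^sub>0 \<mu> where SG: "S = (G, G\<^sub>0, \<mu>)" by (cases S)
      have "(G, G\<^sub>0, \<mu>) \<in> edge_substitution \<G> \<N>" "verts G = V" using S SG by auto
      then show "S \<in> {G. simple_graph G \<and> verts G \<subseteq> V} \<times> {G. simple_graph G \<and> verts G \<subseteq> V} \<times> Pow (Pow V)"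
        using substitution_simple_graph[OF \<G> \<N>, of G G\<^sub>0 \<mu>] edge_subset[of G\<^sub>0] unfolding SG by blast
    qed
  qed
  have "fact (card V) * coeff (class_sum cored_isomorphic (edge_substitution \<G> \<N>) ?f) m =
    (\<Sum>y\<in>?T. coeff (?f y) m * of_nat (card {\<pi>. \<pi> permutes V \<and> relabel_cored \<pi> y = y}))"
  proof (rule coeff_class_sum[OF V _ finT])
    show "?T \<subseteq> edge_substitution \<G> \<N>" by blast
    show "relabel_cored \<pi> x \<in> ?T" if "x \<in> ?T" "\<pi> permutes V" for x \<pi>
      using that edge_substitution_relabel[OF \<G> \<N> _ permutes_bij[OF that(2)]] permutes_image[OF that(2)] by simp
    show "\<exists>\<rho>. \<rho> permutes V \<and> relabel_cored \<rho> x = relabel_cored \<pi> x"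
      if "x \<in> ?T" "bij \<pi>" "relabel_cored \<pi> x \<in> ?T" for x \<pi>
    proof (intro exI conjI)
      show "(\<lambda>x. if x \<in> V then \<pi> x else x) permutes V"
        by (rule restrict_permutes) (use that bij_is_inj in auto)
      show "relabel_cored (\<lambda>x. if x \<in> V then \<pi> x else x) x = relabel_cored \<pi> x"
        by (rule relabel_cored_cong[OF \<G> \<N>]) (use that in auto)
    qed
    show "?f (relabel_cored \<pi> x) = ?f x" if "x \<in> edge_substitution \<G> \<N>" "bij \<pi>" for x \<pi>
    proof (rule average_bij_betw)
      show "bij_betw (conjugate \<pi>) (cored_auts x) (cored_auts (relabel_cored \<pi> x))"
        by (rule conjugate_bij_betw[OF that(2)])
          (metis conjugate_cored_auts[OF that(2)], metis conjugate_cored_auts[OF bij_imp_bij_inv[OF that(2)]] relabel_cored_inv[OF that(2)])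
      fix \<sigma> assume "\<sigma> \<in> cored_auts x"
      then show "?g (relabel_cored \<pi> x) (conjugate \<pi> \<sigma>) = ?g x \<sigma>"
        using walsh_weight_relabel[OF sg[OF that(1)] that(2) aut(2,1)] by simp
    qed
    show "\<exists>\<pi>. bij \<pi> \<and> relabel_cored \<pi> x \<in> ?T" if xS: "x \<in> edge_substitution \<G> \<N>" and "coeff (?f x) m \<noteq> 0" for x
    proof -
      have "\<exists>\<sigma>\<in>cored_auts x. coeff (?g x \<sigma>) m \<noteq> 0"
        by (rule average_coeff_nonzero[OF that(2)])
      then obtain \<sigma> where s: "\<sigma> \<in> cored_auts x" "walsh_weight (fst x) \<sigma> = m"
        unfolding coeff_monomial_series by (auto split: if_splits)
      have "card (verts (fst x)) = card V" using mdeg_walsh_weight[OF sg[OF that(1)] aut(2,1)[OF s(1)]] s(2) m by simp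
      then obtain \<pi> where "bij \<pi>" "\<pi> ` verts (fst x) = V"
        using bij_to[OF simple_graph_finite[OF sg[OF xS]] V] by blast
      then show ?thesis using edge_substitution_relabel[OF \<G> \<N> that(1)] by auto
    qed
  qed
  also have "\<dots> = (\<Sum>S\<in>?T. \<Sum>\<sigma>\<in>cored_auts S. coeff (?g S \<sigma>) m)"
  proof (rule sum.cong[OF refl])
    fix y assume y: "y \<in> ?T"
    then have "finite (cored_auts y)" using fin by blast
    then show "coeff (?f y) m * of_nat (card {\<pi>. \<pi> permutes V \<and> relabel_cored \<pi> y = y}) = (\<Sum>\<sigma>\<in>cored_auts y. coeff (?g y \<sigma>) m)"
      unfolding stab[OF y] by (rule average_coeff)
  qed
  finally show "fact (card V) * coeff (walsh_substitution \<G> \<N>) m = (\<Sum>S\<in>?T. \<Sum>\<sigma>\<in>cored_auts S. coeff (?g S \<sigma>) m)"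
    by (simp add: walsh_substitution_def)
qed

section \<open>Plus and minus series of networks as labelled sums\<close>

lemma network_iso_iff_relabel:
  assumes "is_network N" "is_network M"
  shows "network_isomorphic N M \<longleftrightarrow> (\<exists>\<pi>. bij \<pi> \<and> relabel_net \<pi> N = M)"
proof
  have p: "pole0 N \<in> verts (net_graph N)" "pole1 N \<in> verts (net_graph N)" and s: "simple_graph (net_graph N)"
    using assms(1) by (auto simp: is_network_def)
  assume "network_isomorphic N M"
  then obtain f where f: "graph_iso f (net_graph N) (net_graph M)" "f (pole0 N) = pole0 M" "f (pole1 N) = pole1 M"
    by (auto simp: network_isomorphic_def)
  then obtain \<pi> where "bij \<pi>" "\<forall>x\<in>verts (net_graph N). \<pi> x = f x" "relabel \<pi> (net_graph N) = net_graph M"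
    using graph_iso_extend[OF s f(1)] by blast
  then show "\<exists>\<pi>. bij \<pi> \<and> relabel_net \<pi> N = M"
    using p f by (intro exI[of _ \<pi>]) (auto intro!: network_eqI)
next
  assume "\<exists>\<pi>. bij \<pi> \<and> relabel_net \<pi> N = M"
  then obtain \<pi> where "bij \<pi>" "M = relabel_net \<pi> N" by blast
  then show "network_isomorphic N M"
    unfolding network_isomorphic_def by (intro exI[of _ \<pi>]) (simp add: graph_iso_iff_relabel bij_is_inj)
qed

lemma relabelling_networks:
  assumes "\<And>N. N \<in> X \<Longrightarrow> is_network N" "\<And>N \<pi>. N \<in> X \<Longrightarrow> bij \<pi> \<Longrightarrow> relabel_net \<pi> N \<in> X"
  shows "relabelling X relabel_net network_isomorphic"
  by standard (simp_all add: relabel_net_comp assms network_iso_iff_relabel)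

lemma relabel_net_cong:
  assumes "is_network N" "\<And>x. x \<in> verts (net_graph N) \<Longrightarrow> f x = g x"
  shows "relabel_net f N = relabel_net g N"
  unfolding relabel_net_def using assms relabel_cong[of "net_graph N" f g] by (auto simp: is_network_def)

text \<open>A permutation of the internal vertices automatically fixes both poles. So
  \<open>aut_plus\<close> is the stabiliser of the network under permutations of its internal
  labels, as orbit counting requires.\<close>

lemma aut_plus_eq:
  assumes "is_network N"
  shows "aut_plus N = {\<sigma>. \<sigma> permutes internal N \<and> relabel_net \<sigma> N = N}"
proof -
  have "relabel_net \<sigma> N = N \<longleftrightarrow> relabel \<sigma> (net_graph N) = net_graph N" if "\<sigma> permutes internal N" for \<sigma>
  proof -
    have "\<sigma> (pole0 N) = pole0 N" "\<sigma> (pole1 N) = pole1 N"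
      using that by (auto simp: internal_def permutes_not_in)
    then show ?thesis by (cases N) (auto simp: relabel_net_def)
  qed
  moreover have "\<sigma> permutes verts (net_graph N)" if "\<sigma> permutes internal N" for \<sigma>
    by (rule permutes_subset[OF that]) (auto simp: internal_def)
  ultimately show ?thesis unfolding aut_plus_def graph_auts_eq by blast
qed

lemma sigma_minus_permutes:
  assumes "is_network N" "\<sigma> permutes internal N"
  shows "sigma_minus N \<sigma> permutes verts (net_graph N)"
  unfolding sigma_minus_def
  by (rule permutes_compose[OF permutes_subset[OF assms(2)]])
    (use assms(1) in \<open>auto simp: internal_def is_network_def intro!: permutes_swap_id\<close>)

lemma sigma_minus_poles:
  assumes "\<sigma> permutes internal N"
  shows "sigma_minus N \<sigma> (pole0 N) = pole1 N" "sigma_minus N \<sigma> (pole1 N) = pole0 N"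
    "x \<in> internal N \<Longrightarrow> sigma_minus N \<sigma> x = \<sigma> x"
proof -
  have "\<sigma> (pole0 N) = pole0 N" "\<sigma> (pole1 N) = pole1 N"
    using assms by (auto simp: internal_def permutes_not_in)
  then show "sigma_minus N \<sigma> (pole0 N) = pole1 N" "sigma_minus N \<sigma> (pole1 N) = pole0 N"
    by (auto simp: sigma_minus_def)
  assume "x \<in> internal N"
  then have "\<sigma> x \<in> internal N" using assms by (simp add: permutes_in_image)
  then show "sigma_minus N \<sigma> x = \<sigma> x" by (auto simp: sigma_minus_def internal_def transpose_def)
qed

lemma aut_minus_eq:
  assumes "is_network N"
  shows "aut_minus N = {\<sigma>. \<sigma> permutes internal N \<and> relabel (sigma_minus N \<sigma>) (net_graph N) = net_graph N}"
  unfolding aut_minus_def graph_auts_eq using sigma_minus_permutes[OF assms] by blast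

lemma vweight_fixpoint: "\<sigma> p = p \<Longrightarrow> vweight {p} \<sigma> = Poly_Mapping.single (VA 1) 1"
  using orbit_eq_singleton_iff[of \<sigma> p] by (simp add: vweight_def cyc_sum_def)

text \<open>The poles are two fixed points and account exactly for the monomial that
  \<open>walsh_plus\<close> subtracts.\<close>

lemma network_weight_plus:
  assumes "is_network N" "\<sigma> \<in> aut_plus N"
  shows "walsh_weight (net_graph N) \<sigma> = vweight (internal N) \<sigma> + eweight (edges (net_graph N)) \<sigma> + Poly_Mapping.single (VA 1) 2"
proof -
  have s: "\<sigma> permutes internal N" "relabel \<sigma> (net_graph N) = net_graph N" "simple_graph (net_graph N)" "pole0 N \<noteq> pole1 N"
    using assms by (auto simp: aut_plus_def graph_auts_eq is_network_def)
  have p: "\<sigma> (pole0 N) = pole0 N" "\<sigma> (pole1 N) = pole1 N"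
    using s(1) by (auto simp: internal_def permutes_not_in)
  note f = relabel_fixed[OF s(2)]
  have fi: "finite (internal N)" using simple_graph_finite[OF s(3)] by (simp add: internal_def)
  have si: "\<sigma> ` internal N = internal N" using permutes_image[OF s(1)] .
  have "verts (net_graph N) = internal N \<union> ({pole0 N} \<union> {pole1 N})" using network_verts[OF assms(1)] by auto
  then have "vweight (verts (net_graph N)) \<sigma> = vweight (internal N) \<sigma> + (vweight {pole0 N} \<sigma> + vweight {pole1 N} \<sigma>)"
    unfolding vweight_def
    using p fi si s(4) by (simp only:) (subst cyc_sum_Un, (auto simp: internal_def)[5], subst cyc_sum_Un, auto)
  also have "vweight {pole0 N} \<sigma> + vweight {pole1 N} \<sigma> = Poly_Mapping.single (VA 1) 2"
    unfolding vweight_fixpoint[of \<sigma> "pole0 N", OF p(1)] vweight_fixpoint[of \<sigma> "pole1 N", OF p(2)] single_add[symmetric] by (simp add: numeral_2_eq_2)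
  finally show ?thesis
    using walsh_weight_eq[OF permutes_inj[OF s(1)] s(3)] f by (simp add: add.assoc add.commute add.left_commute)
qed

lemma orbit_involution:
  assumes "f (f x) = x"
  shows "orbit f x = {x, f x}"
proof -
  have "orbit f x = {(f ^^ m) x | m. m < 2}"
    by (rule orbit_altdef_bounded) (simp_all add: numeral_2_eq_2 assms)
  also have "\<dots> = (\<lambda>m. (f ^^ m) x) ` {..<2}" by blast
  also have "\<dots> = {x, f x}" by (simp add: lessThan_Suc numeral_2_eq_2 insert_commute)
  finally show ?thesis .
qed

text \<open>Here the poles form one cycle of length 2. On internal vertices
  \<open>sigma_minus N \<sigma>\<close> agrees with \<sigma>, while the edges still feel the
  exchange of the poles.\<close>

lemma network_weight_minus:
  assumes "is_network N" "\<sigma> \<in> aut_minus N"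
  shows "walsh_weight (net_graph N) (sigma_minus N \<sigma>) =
    vweight (internal N) \<sigma> + eweight (edges (net_graph N)) (sigma_minus N \<sigma>) + Poly_Mapping.single (VA 2) 1"
proof -
  let ?s = "sigma_minus N \<sigma>"
  have s: "\<sigma> permutes internal N" "relabel ?s (net_graph N) = net_graph N" "simple_graph (net_graph N)" "pole0 N \<noteq> pole1 N"
    using assms by (auto simp: aut_minus_def graph_auts_eq is_network_def)
  note p = sigma_minus_poles[OF s(1)]
  note f = relabel_fixed[OF s(2)]
  have inj: "inj ?s" by (rule permutes_inj[OF sigma_minus_permutes[OF assms(1) s(1)]])
  have fi: "finite (internal N)" using simple_graph_finite[OF s(3)] by (simp add: internal_def)
  have si: "\<sigma> ` internal N = internal N" using permutes_image[OF s(1)] .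
  then have si': "?s ` internal N = internal N" using p(3) by simp
  have v: "verts (net_graph N) = internal N \<union> {pole0 N, pole1 N}" using network_verts[OF assms(1)] by auto
  have "vweight (internal N) ?s = vweight (internal N) \<sigma>" by (rule vweight_cong) (use si p(3) in auto)
  moreover have "vweight (internal N \<union> {pole0 N, pole1 N}) ?s = vweight (internal N) ?s + vweight {pole0 N, pole1 N} ?s"
    unfolding vweight_def
  proof (rule cyc_sum_Un)
    show "internal N \<inter> {pole0 N, pole1 N} = {}" by (auto simp: internal_def)
    show "?s ` {pole0 N, pole1 N} \<subseteq> {pole0 N, pole1 N}" using p(1,2) by simp
  qed (use fi si' in simp_all)
  moreover have "vweight {pole0 N, pole1 N} ?s = Poly_Mapping.single (VA 2) 1"
  proof -
    have "orbit ?s (pole0 N) = {pole0 N, pole1 N}" "orbit ?s (pole1 N) = {pole0 N, pole1 N}"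
      using orbit_involution[of ?s "pole0 N"] orbit_involution[of ?s "pole1 N"] by (simp_all add: p(1,2) insert_commute)
    then show ?thesis using s(4) by (simp add: vweight_def cyc_sum_def numeral_2_eq_2)
  qed
  moreover have "walsh_weight (net_graph N) ?s = vweight (verts (net_graph N)) ?s + eweight (edges (net_graph N)) ?s"
    by (rule walsh_weight_eq[OF inj s(3)]) (simp_all add: f)
  ultimately show ?thesis unfolding v by (simp add: add.assoc add.commute add.left_commute)
qed

text \<open>The poles are pinned to \<open>p\<close> and \<open>q\<close>, so only internal labels
  are permuted and the normalising factor is |U|!. This matches the degrees in the network series,
  from which the poles have been removed.\<close>

definition net_graphs :: "'a network set \<Rightarrow> 'a \<Rightarrow> 'a \<Rightarrow> 'a set \<Rightarrow> 'a graph set" where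
  "net_graphs \<N> p q U = {H. Network H p q \<in> \<N> \<and> verts H = insert p (insert q U)}"

lemma finite_net_graphs:
  assumes "network_species \<N>" "finite U"
  shows "finite (net_graphs \<N> p q U)"
proof (rule finite_subset)
  show "finite {G. simple_graph G \<and> verts G \<subseteq> insert p (insert q U)}"
    by (rule finite_simple_graphs) (use assms(2) in simp)
  show "net_graphs \<N> p q U \<subseteq> {G. simple_graph G \<and> verts G \<subseteq> insert p (insert q U)}"
    using network_species_network[OF assms(1)] by (force simp: net_graphs_def is_network_def)
qed

lemma internal_Network: "verts H = insert p (insert q U) \<Longrightarrow> p \<notin> U \<Longrightarrow> q \<notin> U \<Longrightarrow> internal (Network H p q) = U"
  by (auto simp: internal_def)

text \<open>One statement for both series, with \<open>A\<close> and \<open>w\<close> the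
  automorphisms and the weight in question. The stabilisers are always \<open>aut_plus\<close>, so
  averaging over another set \<open>A N\<close> works as long as it has the same
  cardinality.\<close>

lemma coeff_network_class_sum:
  fixes \<N> X :: "'a network set"
  assumes \<N>: "network_species \<N>" and X: "X \<subseteq> \<N>" "\<And>N \<pi>. N \<in> X \<Longrightarrow> bij \<pi> \<Longrightarrow> relabel_net \<pi> N \<in> X"
    and U: "finite U" "p \<noteq> q" "p \<notin> U" "q \<notin> U" and m: "mdeg vdeg m = card U"
    and A: "\<And>N. N \<in> X \<Longrightarrow> card (A N) = card (aut_plus N)" "\<And>N. N \<in> X \<Longrightarrow> finite (A N)"
    and A_rel: "\<And>N \<pi> \<sigma>. N \<in> X \<Longrightarrow> bij \<pi> \<Longrightarrow> \<sigma> \<in> A N \<Longrightarrow> conjugate \<pi> \<sigma> \<in> A (relabel_net \<pi> N)"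
    and w: "\<And>N \<pi> \<sigma>. N \<in> X \<Longrightarrow> bij \<pi> \<Longrightarrow> \<sigma> \<in> A N \<Longrightarrow> w (relabel_net \<pi> N) (conjugate \<pi> \<sigma>) = w N \<sigma>"
    and d: "\<And>N \<sigma>. N \<in> X \<Longrightarrow> \<sigma> \<in> A N \<Longrightarrow> mdeg vdeg (w N \<sigma>) = card (internal N)"
  shows "fact (card U) * coeff (class_sum network_isomorphic X (\<lambda>N. average (A N) (\<lambda>\<sigma>. monomial_series (w N \<sigma>)))) m =
    (\<Sum>H\<in>{H\<in>net_graphs \<N> p q U. Network H p q \<in> X}. \<Sum>\<sigma>\<in>A (Network H p q). coeff (monomial_series (w (Network H p q) \<sigma>)) m)"
proof -
  have net: "is_network N" if "N \<in> X" for N using that X(1) network_species_network[OF \<N>] by blast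
  interpret relabelling X relabel_net network_isomorphic by (rule relabelling_networks[OF net X(2)])
  let ?T = "(\<lambda>H. Network H p q) ` {H\<in>net_graphs \<N> p q U. Network H p q \<in> X}"
  let ?g = "\<lambda>N \<sigma>. monomial_series (w N \<sigma>)"
  let ?f = "\<lambda>N. average (A N) (?g N)"
  have T: "N \<in> ?T \<longleftrightarrow> N \<in> X \<and> pole0 N = p \<and> pole1 N = q \<and> internal N = U" for N
  proof
    assume "N \<in> ?T"
    then show "N \<in> X \<and> pole0 N = p \<and> pole1 N = q \<and> internal N = U"
      using internal_Network[OF _ U(3,4)] by (auto simp: net_graphs_def)
  next
    assume a: "N \<in> X \<and> pole0 N = p \<and> pole1 N = q \<and> internal N = U"
    then have n: "N = Network (net_graph N) p q" by (cases N) auto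
    have "verts (net_graph N) = insert p (insert q U)" using network_verts[OF net] a by auto
    then have "net_graph N \<in> {H\<in>net_graphs \<N> p q U. Network H p q \<in> X}" using a X(1) n by (auto simp: net_graphs_def)
    then show "N \<in> ?T" using n by blast
  qed
  have stab: "{\<pi>. \<pi> permutes U \<and> relabel_net \<pi> y = y} = aut_plus y" if "y \<in> ?T" for y
    using that aut_plus_eq[OF net] unfolding T by auto
  have "fact (card U) * coeff (class_sum network_isomorphic X ?f) m =
    (\<Sum>y\<in>?T. coeff (?f y) m * of_nat (card {\<pi>. \<pi> permutes U \<and> relabel_net \<pi> y = y}))"
  proof (rule coeff_class_sum[OF U(1)])
    show "?T \<subseteq> X" by auto
    show "finite ?T" using finite_net_graphs[OF \<N> U(1)] by simp
    show "relabel_net \<pi> x \<in> ?T" if "x \<in> ?T" "\<pi> permutes U" for x \<pi>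
      using that X(2)[OF _ permutes_bij[OF that(2)]] internal_relabel[OF permutes_inj[OF that(2)]] permutes_image[OF that(2)]
        permutes_not_in[OF that(2) U(3)] permutes_not_in[OF that(2) U(4)] unfolding T by simp
    show "\<exists>\<rho>. \<rho> permutes U \<and> relabel_net \<rho> x = relabel_net \<pi> x" if "x \<in> ?T" "bij \<pi>" "relabel_net \<pi> x \<in> ?T" for x \<pi>
    proof (intro exI conjI)
      have x: "x \<in> X" "pole0 x = p" "pole1 x = q" "internal x = U" and y: "\<pi> p = p" "\<pi> q = q" "\<pi> ` U = U"
        using that(1,3) internal_relabel[OF bij_is_inj[OF that(2)], of x] unfolding T by auto
      show "(\<lambda>x. if x \<in> U then \<pi> x else x) permutes U"
        by (rule restrict_permutes[OF bij_is_inj[OF that(2)] y(3)])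
      show "relabel_net (\<lambda>x. if x \<in> U then \<pi> x else x) x = relabel_net \<pi> x"
        by (rule relabel_net_cong[OF net[OF x(1)]]) (use network_verts[OF net[OF x(1)]] x y in auto)
    qed
    show "?f (relabel_net \<pi> x) = ?f x" if "x \<in> X" "bij \<pi>" for x \<pi>
    proof (rule average_bij_betw)
      show "bij_betw (conjugate \<pi>) (A x) (A (relabel_net \<pi> x))"
        by (rule conjugate_bij_betw[OF that(2)])
          (metis A_rel that, metis A_rel X(2) that bij_imp_bij_inv act_inv)
      show "?g (relabel_net \<pi> x) (conjugate \<pi> \<sigma>) = ?g x \<sigma>" if "\<sigma> \<in> A x" for \<sigma>
        using w \<open>x \<in> X\<close> \<open>bij \<pi>\<close> that by simp
    qed
    show "\<exists>\<pi>. bij \<pi> \<and> relabel_net \<pi> x \<in> ?T" if xX: "x \<in> X" and cx: "coeff (?f x) m \<noteq> 0" for x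
    proof -
      have "\<exists>\<sigma>\<in>A x. coeff (?g x \<sigma>) m \<noteq> 0" by (rule average_coeff_nonzero[OF cx])
      then obtain \<sigma> where s: "\<sigma> \<in> A x" "w x \<sigma> = m" unfolding coeff_monomial_series by (auto split: if_splits)
      have cd: "card (internal x) = card U" using d[OF xX s(1)] s(2) m by simp
      note n = net[OF xX]
      have nn: "pole0 x \<noteq> pole1 x" "finite (verts (net_graph x))" using n by (auto simp: is_network_def simple_graph_def)
      have fi: "finite (internal x)" using nn by (simp add: internal_def)
      obtain h where h: "bij_betw h (internal x) U" using finite_same_card_bij[OF fi U(1) cd] by blast
      \<comment> \<open>The poles are added to the bijection of internal vertices before it is
        extended to all labels, so that they land on \<open>p\<close> and \<open>q\<close>.\<close>
      define h' where "h' = h(pole0 x := p, pole1 x := q)"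
      have "bij_betw h' (internal x \<union> {pole0 x, pole1 x}) (U \<union> {p, q})"
      proof (rule bij_betw_combine)
        show "bij_betw h' (internal x) U"
          using h by (subst bij_betw_cong[of _ _ h]) (auto simp: h'_def internal_def)
        show "bij_betw h' {pole0 x, pole1 x} {p, q}"
          using nn(1) U(2) by (auto simp: h'_def bij_betw_def)
      qed (use U in auto)
      then have hv: "bij_betw h' (verts (net_graph x)) (U \<union> {p, q})" using network_verts[OF n] by simp
      have fU: "finite (U \<union> {p, q})" using U(1) by simp
      obtain \<pi> where p: "\<pi> permutes (verts (net_graph x) \<union> (U \<union> {p, q}))" "\<forall>y\<in>verts (net_graph x). \<pi> y = h' y"
        using extend_bij_betw[OF nn(2) fU hv] by blast
      have b: "bij \<pi>" using p(1) by (rule permutes_bij)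
      have pv: "\<pi> y = h' y" if "y \<in> insert (pole0 x) (insert (pole1 x) (internal x))" for y
        using p(2) that network_verts[OF n] by auto
      have "\<pi> y = h y" if "y \<in> internal x" for y
        using pv[of y] that by (simp add: h'_def internal_def)
      then have "\<pi> ` internal x = h ` internal x" by (rule image_cong[OF refl])
      then have "\<pi> ` internal x = U" using h by (simp add: bij_betw_def)
      moreover have "\<pi> (pole0 x) = p" "\<pi> (pole1 x) = q"
        using pv[of "pole0 x"] pv[of "pole1 x"] nn(1) by (simp_all add: h'_def)
      ultimately have "\<pi> ` internal x = U" "\<pi> (pole0 x) = p" "\<pi> (pole1 x) = q" by blast+
      then have "relabel_net \<pi> x \<in> ?T" unfolding T using X(2)[OF xX b] internal_relabel[OF bij_is_inj[OF b]] by simp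
      then show ?thesis using b by blast
    qed
  qed
  also have "\<dots> = (\<Sum>y\<in>?T. \<Sum>\<sigma>\<in>A y. coeff (?g y \<sigma>) m)"
  proof (rule sum.cong[OF refl])
    fix y assume y: "y \<in> ?T"
    then have yX: "y \<in> X" by auto
    show "coeff (?f y) m * of_nat (card {\<pi>. \<pi> permutes U \<and> relabel_net \<pi> y = y}) = (\<Sum>\<sigma>\<in>A y. coeff (?g y \<sigma>) m)"
      unfolding stab[OF y] A(1)[OF yX, symmetric] by (rule average_coeff[OF A(2)[OF yX]])
  qed
  also have "\<dots> = (\<Sum>H\<in>{H\<in>net_graphs \<N> p q U. Network H p q \<in> X}. \<Sum>\<sigma>\<in>A (Network H p q). coeff (?g (Network H p q) \<sigma>) m)"
    by (subst sum.reindex) (auto simp: inj_on_def)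
  finally show ?thesis .
qed

lemma finite_aut_plus: "is_network N \<Longrightarrow> finite (aut_plus N)"
proof -
  assume "is_network N"
  then have "finite (internal N)" by (simp add: is_network_def simple_graph_def internal_def)
  then show ?thesis unfolding aut_plus_def using finite_permutations[of "internal N"] by simp
qed

lemma finite_aut_minus: "is_network N \<Longrightarrow> finite (aut_minus N)"
proof -
  assume "is_network N"
  then have "finite (internal N)" by (simp add: is_network_def simple_graph_def internal_def)
  then show ?thesis unfolding aut_minus_def using finite_permutations[of "internal N"] by simp
qed

lemma coeff_walsh_plus:
  assumes \<N>: "network_species \<N>"
    and U: "finite U" "p \<noteq> q" "p \<notin> U" "q \<notin> U" and m: "mdeg vdeg m = card U"
  shows "fact (card U) * coeff (walsh_plus \<N>) m =
    (\<Sum>H\<in>net_graphs \<N> p q U. \<Sum>\<sigma>\<in>aut_plus (Network H p q).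
      coeff (monomial_series (vweight U \<sigma> + eweight (edges H) \<sigma>)) m)"
proof -
  note net = network_species_network[OF \<N>]
  let ?w = "\<lambda>N \<sigma>. walsh_weight (net_graph N) \<sigma> - Poly_Mapping.single (VA 1) 2"
  have w: "?w N \<sigma> = vweight (internal N) \<sigma> + eweight (edges (net_graph N)) \<sigma>" if "N \<in> \<N>" "\<sigma> \<in> aut_plus N" for N \<sigma>
    using network_weight_plus[OF net[OF that(1)] that(2)] by simp
  have *: "fact (card U) * coeff (walsh_plus \<N>) m =
    (\<Sum>H\<in>{H\<in>net_graphs \<N> p q U. Network H p q \<in> \<N>}. \<Sum>\<sigma>\<in>aut_plus (Network H p q). coeff (monomial_series (?w (Network H p q) \<sigma>)) m)"
    unfolding walsh_plus_def
  proof (rule coeff_network_class_sum[OF \<N> subset_refl _ U m])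
    show "relabel_net \<pi> N \<in> \<N>" if "N \<in> \<N>" "bij \<pi>" for N \<pi>
      by (rule network_species_relabel[OF \<N> that(1) bij_is_inj[OF that(2)]])
    fix N assume N: "N \<in> \<N>"
    show "finite (aut_plus N)" using finite_aut_plus[OF net[OF N]] .
    fix \<pi> :: "'a \<Rightarrow> 'a" assume b: "bij \<pi>"
    fix \<sigma> assume s: "\<sigma> \<in> aut_plus N"
    then have s': "\<sigma> permutes internal N" "relabel_net \<sigma> N = N" using aut_plus_eq[OF net[OF N]] by auto
    have "relabel_net (conjugate \<pi> \<sigma>) (relabel_net \<pi> N) = relabel_net \<pi> (relabel_net \<sigma> (relabel_net (inv \<pi>) (relabel_net \<pi> N)))"
      unfolding conjugate_def relabel_net_comp ..
    also have "relabel_net (inv \<pi>) (relabel_net \<pi> N) = N"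
      by (simp add: relabel_net_comp[symmetric] bij_is_inj[OF b] inv_o_cancel)
    finally show "conjugate \<pi> \<sigma> \<in> aut_plus (relabel_net \<pi> N)"
      using s' conjugate_permutes[OF b s'(1)]
      by (simp add: aut_plus_eq[OF is_network_relabel[OF bij_is_inj[OF b] net[OF N]]] internal_relabel[OF bij_is_inj[OF b]])
    have "relabel \<sigma> (net_graph N) = net_graph N" using s'(2) by (metis relabel_net_sel(1))
    then show "?w (relabel_net \<pi> N) (conjugate \<pi> \<sigma>) = ?w N \<sigma>"
      using walsh_weight_relabel[OF _ b permutes_inj[OF s'(1)]] net[OF N] by (simp add: is_network_def)
  next
    fix N \<sigma> assume N: "N \<in> \<N>" "\<sigma> \<in> aut_plus N"
    then have p: "\<sigma> permutes internal N" by (simp add: aut_plus_def)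
    have "finite (internal N)" using net[OF N(1)] by (simp add: is_network_def simple_graph_def internal_def)
    then show "mdeg vdeg (?w N \<sigma>) = card (internal N)"
      unfolding w[OF N] using mdeg_cyc_sum_vertices[OF permutes_inj[OF p], of "internal N"] permutes_image[OF p]
      by (simp add: vweight_def eweight_def mdeg_cyc_sum_edges)
  qed simp
  also have "{H\<in>net_graphs \<N> p q U. Network H p q \<in> \<N>} = net_graphs \<N> p q U" by (auto simp: net_graphs_def)
  also have "(\<Sum>H\<in>net_graphs \<N> p q U. \<Sum>\<sigma>\<in>aut_plus (Network H p q). coeff (monomial_series (?w (Network H p q) \<sigma>)) m) =
     (\<Sum>H\<in>net_graphs \<N> p q U. \<Sum>\<sigma>\<in>aut_plus (Network H p q). coeff (monomial_series (vweight U \<sigma> + eweight (edges H) \<sigma>)) m)"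
  proof (intro sum.cong refl)
    fix H \<sigma> assume "H \<in> net_graphs \<N> p q U" and s: "\<sigma> \<in> aut_plus (Network H p q)"
    then have H: "Network H p q \<in> \<N>" "internal (Network H p q) = U" using U by (auto simp: net_graphs_def internal_def)
    show "coeff (monomial_series (?w (Network H p q) \<sigma>)) m = coeff (monomial_series (vweight U \<sigma> + eweight (edges H) \<sigma>)) m"
      unfolding w[OF H(1) s] H(2) by simp
  qed
  finally show ?thesis .
qed

lemma conjugate_sigma_minus:
  assumes "bij \<pi>"
  shows "sigma_minus (relabel_net \<pi> N) (conjugate \<pi> \<sigma>) = conjugate \<pi> (sigma_minus N \<sigma>)"
proof (rule ext)
  fix x
  obtain y where x: "x = \<pi> y" using assms by (meson bij_pointE)
  have "inj \<pi>" using assms by (rule bij_is_inj)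
  then show "sigma_minus (relabel_net \<pi> N) (conjugate \<pi> \<sigma>) x = conjugate \<pi> (sigma_minus N \<sigma>) x"
    unfolding x conjugate_apply[OF assms] sigma_minus_def comp_apply
    by (auto simp: transpose_def inj_eq)
qed

lemma is_network_swap: "is_network N \<Longrightarrow> is_network (swap_poles N)"
  by (auto simp: is_network_def swap_poles_def join_poles_def insert_commute)

text \<open>An isomorphism from the swapped network to the network is an automorphism of the graph
  that exchanges the poles; its restriction to internal vertices is the required permutation. Hence
  restricting to \<open>pole_symmetric\<close> only drops networks with an empty sum over
  \<open>aut_minus\<close>.\<close>

lemma aut_minus_nonempty_iff:
  assumes "is_network N"
  shows "aut_minus N \<noteq> {} \<longleftrightarrow> network_isomorphic (swap_poles N) N"
proof
  assume "aut_minus N \<noteq> {}"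
  then obtain \<sigma> where s: "\<sigma> permutes internal N" "relabel (sigma_minus N \<sigma>) (net_graph N) = net_graph N"
    using aut_minus_eq[OF assms] by auto
  let ?s = "sigma_minus N \<sigma>"
  have "graph_iso ?s (net_graph N) (net_graph N)"
    using s(2) permutes_inj[OF sigma_minus_permutes[OF assms s(1)]] by (simp add: graph_iso_iff_relabel)
  then show "network_isomorphic (swap_poles N) N"
    unfolding network_isomorphic_def using sigma_minus_poles(1,2)[OF s(1)]
    by (intro exI[of _ ?s]) (simp add: swap_poles_def)
next
  assume "network_isomorphic (swap_poles N) N"
  then obtain \<pi> where p: "bij \<pi>" "relabel_net \<pi> (swap_poles N) = N"
    using network_iso_iff_relabel[OF is_network_swap[OF assms] assms] by blast
  have q: "\<pi> (pole1 N) = pole0 N" "\<pi> (pole0 N) = pole1 N" "relabel \<pi> (net_graph N) = net_graph N"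
    using p(2) by (cases N; simp add: swap_poles_def relabel_net_def)+
  have i: "inj \<pi>" using p(1) by (rule bij_is_inj)
  have "\<pi> ` verts (net_graph N) = verts (net_graph N)" using relabel_fixed(1)[OF q(3)] .
  moreover have "\<pi> ` {pole0 N, pole1 N} = {pole0 N, pole1 N}" using q by auto
  ultimately have ii: "\<pi> ` internal N = internal N"
    unfolding internal_def image_set_diff[OF i] by simp
  define \<sigma> where "\<sigma> x = (if x \<in> internal N then \<pi> x else x)" for x
  have s: "\<sigma> permutes internal N" unfolding \<sigma>_def by (rule restrict_permutes[OF i ii])
  have "relabel (sigma_minus N \<sigma>) (net_graph N) = relabel \<pi> (net_graph N)"
  proof (rule relabel_cong)
    fix x assume "x \<in> verts (net_graph N)"
    then consider "x = pole0 N" | "x = pole1 N" | "x \<in> internal N" by (auto simp: internal_def)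
    then show "sigma_minus N \<sigma> x = \<pi> x"
      by cases (use q sigma_minus_poles[OF s] in \<open>simp_all add: \<sigma>_def\<close>)
  qed (use assms in \<open>simp add: is_network_def\<close>)
  then show "aut_minus N \<noteq> {}" using s q(3) aut_minus_eq[OF assms] by auto
qed

text \<open>Composition with one fixed member of \<open>aut_minus\<close> maps
  \<open>aut_plus\<close> onto \<open>aut_minus\<close>, which is therefore a coset.\<close>

lemma card_aut_minus:
  assumes "is_network N" "aut_minus N \<noteq> {}"
  shows "card (aut_minus N) = card (aut_plus N)"
proof -
  obtain \<alpha> where a: "\<alpha> permutes internal N" "relabel (sigma_minus N \<alpha>) (net_graph N) = net_graph N"
    using assms aut_minus_eq[OF assms(1)] by auto
  let ?g = "net_graph N"
  have c: "sigma_minus N (\<alpha> \<circ> \<sigma>) = sigma_minus N \<alpha> \<circ> \<sigma>" for \<sigma> by (simp add: sigma_minus_def comp_assoc)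
  have plus: "\<sigma> \<in> aut_plus N \<longleftrightarrow> \<sigma> permutes internal N \<and> relabel \<sigma> ?g = ?g" for \<sigma>
    unfolding aut_plus_def graph_auts_eq using permutes_subset[of \<sigma> "internal N" "verts ?g"]
    by (auto simp: internal_def)
  have ia: "inv \<alpha> permutes internal N" by (rule permutes_inv[OF a(1)])
  have bm: "bij (sigma_minus N \<alpha>)" by (rule permutes_bij[OF sigma_minus_permutes[OF assms(1) a(1)]])
  have "bij_betw (\<lambda>\<sigma>. \<alpha> \<circ> \<sigma>) (aut_plus N) (aut_minus N)"
  proof (rule bij_betw_byWitness[where f' = "\<lambda>\<sigma>. inv \<alpha> \<circ> \<sigma>"])
    show "\<forall>\<sigma>\<in>aut_plus N. inv \<alpha> \<circ> (\<alpha> \<circ> \<sigma>) = \<sigma>"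
      using permutes_inv_o(2)[OF a(1)] by (simp add: comp_assoc[symmetric])
    show "\<forall>\<sigma>\<in>aut_minus N. \<alpha> \<circ> (inv \<alpha> \<circ> \<sigma>) = \<sigma>"
      using permutes_inv_o(1)[OF a(1)] by (simp add: comp_assoc[symmetric])
    show "(\<lambda>\<sigma>. \<alpha> \<circ> \<sigma>) ` aut_plus N \<subseteq> aut_minus N"
    proof (rule image_subsetI)
      fix \<sigma> assume "\<sigma> \<in> aut_plus N"
      then show "\<alpha> \<circ> \<sigma> \<in> aut_minus N"
        unfolding plus aut_minus_eq[OF assms(1)] mem_Collect_eq c relabel_comp
        using permutes_compose[OF _ a(1)] a(2) by simp
    qed
    show "(\<lambda>\<sigma>. inv \<alpha> \<circ> \<sigma>) ` aut_minus N \<subseteq> aut_plus N"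
    proof (rule image_subsetI)
      fix \<sigma> assume "\<sigma> \<in> aut_minus N"
      then have s: "\<sigma> permutes internal N" "relabel (sigma_minus N \<sigma>) ?g = ?g"
        unfolding aut_minus_eq[OF assms(1)] by auto
      have "sigma_minus N \<sigma> = sigma_minus N \<alpha> \<circ> (inv \<alpha> \<circ> \<sigma>)"
        unfolding c[symmetric] using permutes_inv_o(1)[OF a(1)] by (simp add: comp_assoc[symmetric])
      then have "relabel (sigma_minus N \<alpha>) (relabel (inv \<alpha> \<circ> \<sigma>) ?g) = relabel (sigma_minus N \<alpha>) ?g"
        using s(2) a(2) by (simp add: relabel_comp[symmetric])
      then have "relabel (inv \<alpha> \<circ> \<sigma>) ?g = ?g" using relabel_inv[OF bm] by metis
      then show "inv \<alpha> \<circ> \<sigma> \<in> aut_plus N" unfolding plus using permutes_compose[OF s(1) ia] by simp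
    qed
  qed
  from bij_betw_same_card[OF this] show ?thesis by (rule sym)
qed

lemma coeff_walsh_minus:
  assumes \<N>: "network_species \<N>"
    and U: "finite U" "p \<noteq> q" "p \<notin> U" "q \<notin> U" and m: "mdeg vdeg m = card U"
  shows "fact (card U) * coeff (walsh_minus \<N>) m =
    (\<Sum>H\<in>net_graphs \<N> p q U. \<Sum>\<sigma>\<in>aut_minus (Network H p q).
      coeff (monomial_series (vweight U \<sigma> + eweight (edges H) (transpose p q \<circ> \<sigma>))) m)"
proof -
  note net = network_species_network[OF \<N>]
  let ?X = "pole_symmetric \<N>"
  have X: "?X \<subseteq> \<N>" by (auto simp: pole_symmetric_def)
  have Xne: "N \<in> ?X \<longleftrightarrow> N \<in> \<N> \<and> aut_minus N \<noteq> {}" for N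
    using aut_minus_nonempty_iff[OF net, of N] by (auto simp: pole_symmetric_def)
  let ?w = "\<lambda>N \<sigma>. walsh_weight (net_graph N) (sigma_minus N \<sigma>) - Poly_Mapping.single (VA 2) 1"
  have w: "?w N \<sigma> = vweight (internal N) \<sigma> + eweight (edges (net_graph N)) (sigma_minus N \<sigma>)" if "N \<in> \<N>" "\<sigma> \<in> aut_minus N" for N \<sigma>
    using network_weight_minus[OF net[OF that(1)] that(2)] by simp
  have rel: "conjugate \<pi> \<sigma> \<in> aut_minus (relabel_net \<pi> N)" if "N \<in> \<N>" "bij \<pi>" "\<sigma> \<in> aut_minus N" for N \<pi> \<sigma>
  proof -
    have s: "\<sigma> permutes internal N" "relabel (sigma_minus N \<sigma>) (net_graph N) = net_graph N"
      using that(3) aut_minus_eq[OF net[OF that(1)]] by auto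
    show ?thesis
      unfolding aut_minus_eq[OF is_network_relabel[OF bij_is_inj[OF that(2)] net[OF that(1)]]]
        mem_Collect_eq conjugate_sigma_minus[OF that(2)]
      using s conjugate_permutes[OF that(2) s(1)] by (simp add: relabel_conjugate[OF that(2)] internal_relabel[OF bij_is_inj[OF that(2)]])
  qed
  have *: "fact (card U) * coeff (walsh_minus \<N>) m =
    (\<Sum>H\<in>{H\<in>net_graphs \<N> p q U. Network H p q \<in> ?X}. \<Sum>\<sigma>\<in>aut_minus (Network H p q). coeff (monomial_series (?w (Network H p q) \<sigma>)) m)"
    unfolding walsh_minus_def
  proof (rule coeff_network_class_sum[OF \<N> X _ U m])
    show "relabel_net \<pi> N \<in> ?X" if "N \<in> ?X" "bij \<pi>" for N \<pi>
      using network_species_relabel[OF \<N> _ bij_is_inj[OF that(2)]] rel that unfolding Xne by blast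
    fix N assume N: "N \<in> ?X"
    then have N': "N \<in> \<N>" "aut_minus N \<noteq> {}" unfolding Xne by auto
    show "card (aut_minus N) = card (aut_plus N)" by (rule card_aut_minus[OF net[OF N'(1)] N'(2)])
    show "finite (aut_minus N)" using finite_aut_minus[OF net[OF N'(1)]] .
    fix \<pi> :: "'a \<Rightarrow> 'a" assume b: "bij \<pi>"
    fix \<sigma> assume s: "\<sigma> \<in> aut_minus N"
    show "conjugate \<pi> \<sigma> \<in> aut_minus (relabel_net \<pi> N)" by (rule rel[OF N'(1) b s])
    have s': "\<sigma> permutes internal N" "relabel (sigma_minus N \<sigma>) (net_graph N) = net_graph N"
      using s aut_minus_eq[OF net[OF N'(1)]] by auto
    then show "?w (relabel_net \<pi> N) (conjugate \<pi> \<sigma>) = ?w N \<sigma>"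
      unfolding conjugate_sigma_minus[OF b]
      using walsh_weight_relabel[OF _ b permutes_inj[OF sigma_minus_permutes[OF net[OF N'(1)] s'(1)]]] net[OF N'(1)]
      by (simp add: is_network_def)
  next
    fix N \<sigma> assume "N \<in> ?X" "\<sigma> \<in> aut_minus N"
    then have N: "N \<in> \<N>" "\<sigma> \<in> aut_minus N" unfolding Xne by auto
    then have p: "\<sigma> permutes internal N" by (simp add: aut_minus_def)
    have "finite (internal N)" using net[OF N(1)] by (simp add: is_network_def simple_graph_def internal_def)
    then show "mdeg vdeg (?w N \<sigma>) = card (internal N)"
      unfolding w[OF N] using mdeg_cyc_sum_vertices[OF permutes_inj[OF p], of "internal N"] permutes_image[OF p]
      by (simp add: vweight_def eweight_def mdeg_cyc_sum_edges)
  qed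
  also have "\<dots> = (\<Sum>H\<in>net_graphs \<N> p q U. \<Sum>\<sigma>\<in>aut_minus (Network H p q). coeff (monomial_series (?w (Network H p q) \<sigma>)) m)"
    by (rule sum.mono_neutral_left[OF finite_net_graphs[OF \<N> U(1)]]) (auto simp: Xne net_graphs_def)
  also have "\<dots> = (\<Sum>H\<in>net_graphs \<N> p q U. \<Sum>\<sigma>\<in>aut_minus (Network H p q). coeff (monomial_series (vweight U \<sigma> + eweight (edges H) (transpose p q \<circ> \<sigma>))) m)"
  proof (intro sum.cong refl)
    fix H \<sigma> assume "H \<in> net_graphs \<N> p q U" and s: "\<sigma> \<in> aut_minus (Network H p q)"
    then have H: "Network H p q \<in> \<N>" "internal (Network H p q) = U" using U by (auto simp: net_graphs_def internal_def)
    show "coeff (monomial_series (?w (Network H p q) \<sigma>)) m = coeff (monomial_series (vweight U \<sigma> + eweight (edges H) (transpose p q \<circ> \<sigma>))) m"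
      unfolding w[OF H(1) s] H(2) by (simp add: sigma_minus_def)
  qed
  finally show ?thesis .
qed

section \<open>Families of networks over an automorphism of the core\<close>

text \<open>The order of the poles is hidden, so that a network can be attached to an unordered
  edge.\<close>

definition netgraph :: "'a network set \<Rightarrow> 'a set \<Rightarrow> 'a graph \<Rightarrow> bool" where
  "netgraph \<N> e H \<longleftrightarrow> (\<exists>p q. e = {p, q} \<and> Network H p q \<in> \<N>)"

text \<open>\<open>A\<close> is the vertex set of a core and \<tau> an automorphism of it. The set
  of substituted edges is kept as a separate parameter, so that it can be cut into cycles.\<close>

locale core_aut =
  fixes \<N> :: "'a network set" and A :: "'a set" and \<tau> :: "'a \<Rightarrow> 'a"
  assumes \<N>: "network_species \<N>" and sym: "symmetric_species \<N>"
    and finA: "finite A" and \<tau>: "\<tau> permutes A"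
begin

definition invariant :: "'a set set \<Rightarrow> bool" where
  "invariant Z \<longleftrightarrow> (\<forall>e\<in>Z. e \<subseteq> A \<and> card e = 2) \<and> (`) \<tau> ` Z = Z"

text \<open>A member is a choice of networks on \<open>Z\<close> with internal vertices exactly
  \<open>U\<close>, together with the action \<sigma> on these. The full automorphism is
  \<open>\<tau> \<circ> \<sigma>\<close>, whose factors have disjoint supports when \<open>U\<close>
  avoids \<open>A\<close>. Extensionality makes each choice a single function.\<close>

definition families :: "'a set set \<Rightarrow> 'a set \<Rightarrow> (('a set \<Rightarrow> 'a graph) \<times> ('a \<Rightarrow> 'a)) set" where
  "families Z U = {(H, \<sigma>). H \<in> extensional Z \<and>
     (\<forall>e\<in>Z. netgraph \<N> e (H e) \<and> (verts (H e) - e) \<inter> A = {}) \<and>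
     (\<forall>e\<in>Z. \<forall>e'\<in>Z. e \<noteq> e' \<longrightarrow> (verts (H e) - e) \<inter> (verts (H e') - e') = {}) \<and>
     (\<Union>e\<in>Z. verts (H e) - e) = U \<and> \<sigma> permutes U \<and>
     (\<forall>e\<in>Z. relabel (\<tau> \<circ> \<sigma>) (H e) = H (\<tau> ` e))}"

text \<open>What the networks add to the weight of the core: internal vertices and network
  edges.\<close>

definition family_weight :: "'a set set \<Rightarrow> 'a set \<Rightarrow> ('a set \<Rightarrow> 'a graph) \<times> ('a \<Rightarrow> 'a) \<Rightarrow> (walsh_var \<Rightarrow>\<^sub>0 nat)" where
  "family_weight Z U = (\<lambda>(H, \<sigma>). vweight U \<sigma> + eweight (\<Union>e\<in>Z. edges (H e)) (\<tau> \<circ> \<sigma>))"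

definition family_sum :: "'a set set \<Rightarrow> 'a set \<Rightarrow> walsh_var series" where
  "family_sum Z U = (\<Sum>x\<in>families Z U. monomial_series (family_weight Z U x))"

lemma netgraph_simple: "netgraph \<N> e H \<Longrightarrow> simple_graph H \<and> e \<subseteq> verts H"
  using network_species_network[OF \<N>] by (force simp: netgraph_def is_network_def)

text \<open>Symmetry of the species enters here: the order of the poles hidden in
  \<open>netgraph\<close> may be chosen at will.\<close>

lemma netgraph_iff:
  assumes "e = {p, q}"
  shows "netgraph \<N> e H \<longleftrightarrow> Network H p q \<in> \<N>"
proof
  assume "netgraph \<N> e H"
  then obtain r s where rs: "e = {r, s}" "Network H r s \<in> \<N>" by (auto simp: netgraph_def)
  have "swap_poles (Network H r s) \<in> \<N>" using sym rs(2) unfolding symmetric_species_def by blast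
  then have "Network H s r \<in> \<N>" by (simp add: swap_poles_def)
  moreover have "p = r \<and> q = s \<or> p = s \<and> q = r" using assms rs(1) by (metis doubleton_eq_iff)
  ultimately show "Network H p q \<in> \<N>" using rs(2) by auto
qed (use assms in \<open>auto simp: netgraph_def\<close>)

lemma netgraph_relabel:
  assumes "netgraph \<N> e H" "inj f"
  shows "netgraph \<N> (f ` e) (relabel f H)"
proof -
  obtain r s where rs: "e = {r, s}" "Network H r s \<in> \<N>" using assms(1) by (auto simp: netgraph_def)
  have "relabel_net f (Network H r s) \<in> \<N>" by (rule network_species_relabel[OF \<N> rs(2) assms(2)])
  then show ?thesis using rs(1) by (auto simp: netgraph_def relabel_net_def)
qed

context
  fixes Z U H \<sigma>
  assumes mem: "(H, \<sigma>) \<in> families Z U" and inv: "invariant Z" and UA: "U \<inter> A = {}"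
begin

lemma family_sigma: "\<sigma> permutes U" using mem by (simp add: families_def)

lemma family_simple: "e \<in> Z \<Longrightarrow> simple_graph (H e)" "e \<in> Z \<Longrightarrow> e \<subseteq> verts (H e)"
  using mem netgraph_simple by (auto simp: families_def)

lemma family_int: "e \<in> Z \<Longrightarrow> verts (H e) - e \<subseteq> U"
  using mem by (auto simp: families_def)

lemma family_int_disjoint:
  "e \<in> Z \<Longrightarrow> e' \<in> Z \<Longrightarrow> e \<noteq> e' \<Longrightarrow> (verts (H e) - e) \<inter> (verts (H e') - e') = {}"
  using mem unfolding families_def by blast

lemma family_union: "(\<Union>e\<in>Z. verts (H e) - e) = U"
  using mem by (simp add: families_def)

lemma family_relabel: "e \<in> Z \<Longrightarrow> relabel (\<tau> \<circ> \<sigma>) (H e) = H (\<tau> ` e)"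
  using mem by (simp add: families_def)

lemma invariant_edge: "e \<in> Z \<Longrightarrow> e \<subseteq> A" "e \<in> Z \<Longrightarrow> card e = 2" "e \<in> Z \<Longrightarrow> \<tau> ` e \<in> Z"
  using inv by (auto simp: invariant_def)

lemma total_inj: "inj (\<tau> \<circ> \<sigma>)"
  by (intro inj_compose permutes_inj[OF \<tau>] permutes_inj[OF family_sigma])

lemma total_A: "x \<in> A \<Longrightarrow> (\<tau> \<circ> \<sigma>) x = \<tau> x"
proof -
  assume "x \<in> A"
  then have "x \<notin> U" using UA by blast
  then show ?thesis using permutes_not_in[OF family_sigma] by simp
qed

lemma total_U: "x \<in> U \<Longrightarrow> (\<tau> \<circ> \<sigma>) x = \<sigma> x"
proof -
  assume "x \<in> U"
  then have "\<sigma> x \<in> U" using permutes_in_image[OF family_sigma] by simp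
  then have "\<sigma> x \<notin> A" using UA by blast
  then show ?thesis using permutes_not_in[OF \<tau>] by simp
qed

lemma total_image_A: "X \<subseteq> A \<Longrightarrow> (\<tau> \<circ> \<sigma>) ` X = \<tau> ` X"
  by (rule image_cong[OF refl]) (use total_A in blast)

lemma total_image_U: "X \<subseteq> U \<Longrightarrow> (\<tau> \<circ> \<sigma>) ` X = \<sigma> ` X"
  by (rule image_cong[OF refl]) (use total_U in blast)

lemma family_sigma_int: "e \<in> Z \<Longrightarrow> \<sigma> ` (verts (H e) - e) = verts (H (\<tau> ` e)) - \<tau> ` e"
proof -
  assume e: "e \<in> Z"
  have "\<sigma> ` (verts (H e) - e) = (\<tau> \<circ> \<sigma>) ` (verts (H e) - e)"
    by (rule total_image_U[OF family_int[OF e], symmetric])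
  also have "\<dots> = (\<tau> \<circ> \<sigma>) ` verts (H e) - (\<tau> \<circ> \<sigma>) ` e" by (rule image_set_diff[OF total_inj])
  also have "(\<tau> \<circ> \<sigma>) ` e = \<tau> ` e" by (rule total_image_A[OF invariant_edge(1)[OF e]])
  also have "(\<tau> \<circ> \<sigma>) ` verts (H e) = verts (H (\<tau> ` e))" using family_relabel[OF e] by (metis verts_relabel)
  finally show ?thesis .
qed

text \<open>Networks at distinct edges meet only in common ends of those edges. A shared edge would
  thus lie in \<open>e\<close> and in \<open>e'\<close>, and having two elements it would equal
  both.\<close>

lemma family_edges_disjoint:
  assumes "e \<in> Z" "e' \<in> Z" "e \<noteq> e'"
  shows "edges (H e) \<inter> edges (H e') = {}"
proof (rule ccontr)
  assume "\<not> ?thesis"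
  then obtain d where d: "d \<in> edges (H e)" "d \<in> edges (H e')" by blast
  have "d \<subseteq> verts (H e)" "d \<subseteq> verts (H e')" "card d = 2"
    using edge_subset[OF family_simple(1)[OF assms(1)] d(1)] edge_subset[OF family_simple(1)[OF assms(2)] d(2)]
      edge_card[OF family_simple(1)[OF assms(1)] d(1)] by auto
  moreover have "verts (H e) \<inter> verts (H e') \<subseteq> e \<inter> e'"
    using family_int_disjoint[OF assms] family_int[OF assms(1)] family_int[OF assms(2)]
      invariant_edge(1)[OF assms(1)] invariant_edge(1)[OF assms(2)] UA by blast
  ultimately have de: "d \<subseteq> e" "d \<subseteq> e'" "card d = 2" by auto
  have fin: "finite e" "finite e'" using invariant_edge(1) assms finA finite_subset by blast+
  have "d = e" "d = e'"
    using card_subset_eq[OF fin(1) de(1)] card_subset_eq[OF fin(2) de(2)] de(3) invariant_edge(2) assms by simp_all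
  then show False using assms(3) by simp
qed

lemma finite_Z: "finite Z"
  by (rule finite_subset[of _ "Pow A"]) (use invariant_edge(1) finA in auto)

lemma family_edges_invariant:
  assumes "Y \<subseteq> Z" "(`) \<tau> ` Y = Y"
  shows "(`) (\<tau> \<circ> \<sigma>) ` (\<Union>e\<in>Y. edges (H e)) = (\<Union>e\<in>Y. edges (H e))"
proof -
  have "(`) (\<tau> \<circ> \<sigma>) ` edges (H e) = edges (H (\<tau> ` e))" if "e \<in> Y" for e
    using family_relabel[of e] assms(1) that by (metis edges_relabel subsetD)
  then have "(`) (\<tau> \<circ> \<sigma>) ` (\<Union>e\<in>Y. edges (H e)) = (\<Union>e\<in>Y. edges (H (\<tau> ` e)))"
    unfolding image_UN by simp
  also have "\<dots> = (\<Union>e\<in>(`) \<tau> ` Y. edges (H e))" by simp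
  finally show ?thesis unfolding assms(2) .
qed

lemma family_sigma_union:
  assumes "Y \<subseteq> Z" "(`) \<tau> ` Y = Y"
  shows "\<sigma> ` (\<Union>e\<in>Y. verts (H e) - e) = (\<Union>e\<in>Y. verts (H e) - e)"
proof -
  have "\<sigma> ` (\<Union>e\<in>Y. verts (H e) - e) = (\<Union>e\<in>Y. verts (H (\<tau> ` e)) - \<tau> ` e)"
    unfolding image_UN using family_sigma_int assms(1) by (intro SUP_cong) auto
  also have "\<dots> = (\<Union>e\<in>(`) \<tau> ` Y. verts (H e) - e)" by simp
  finally show ?thesis unfolding assms(2) .
qed

text \<open>\<sigma> permutes the internal vertices owned by an invariant part of the edges, so the
  networks and \<sigma> can be cut down to that part.\<close>

lemma families_restrict:
  assumes "Y \<subseteq> Z" "(`) \<tau> ` Y = Y" "X = (\<Union>e\<in>Y. verts (H e) - e)"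
  shows "(restrict H Y, \<lambda>x. if x \<in> X then \<sigma> x else x) \<in> families Y X"
proof -
  let ?s = "\<lambda>x. if x \<in> X then \<sigma> x else x"
  have XU: "X \<subseteq> U" unfolding assms(3) using family_int assms(1) by blast
  have s: "?s permutes X"
    by (rule restrict_permutes[OF permutes_inj[OF family_sigma]]) (simp only: assms(3) family_sigma_union[OF assms(1,2)])
  have r: "relabel (\<tau> \<circ> ?s) (H e) = H (\<tau> ` e)" if e: "e \<in> Y" for e
  proof -
    have eZ: "e \<in> Z" using e assms(1) by blast
    have "relabel (\<tau> \<circ> ?s) (H e) = relabel (\<tau> \<circ> \<sigma>) (H e)"
    proof (rule relabel_cong[OF family_simple(1)[OF eZ]])
      fix x assume "x \<in> verts (H e)"
      then consider "x \<in> e" | "x \<in> X" using assms(3) e by blast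
      then show "(\<tau> \<circ> ?s) x = (\<tau> \<circ> \<sigma>) x"
      proof cases
        case 1
        then have "x \<in> A" using invariant_edge(1)[OF eZ] by blast
        then have "x \<notin> U" using UA by blast
        then show ?thesis using XU permutes_not_in[OF family_sigma] by auto
      qed simp
    qed
    then show ?thesis using family_relabel[OF eZ] by simp
  qed
  have tY: "\<tau> ` e \<in> Y" if "e \<in> Y" for e using that assms(2) by blast
  have H: "\<forall>e\<in>Y. netgraph \<N> e (H e) \<and> (verts (H e) - e) \<inter> A = {}"
     "\<forall>e\<in>Y. \<forall>e'\<in>Y. e \<noteq> e' \<longrightarrow> (verts (H e) - e) \<inter> (verts (H e') - e') = {}"
    using mem assms(1) unfolding families_def by blast+
  then show ?thesis unfolding families_def using s r tY assms(3) by simp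
qed

end

text \<open>The inverse of restricting: the supports are disjoint, so the two permutations can be
  composed without disturbing each other.\<close>

lemma families_join:
  assumes Z1: "invariant Z1" and Z2: "invariant Z2" and Z: "Z1 \<inter> Z2 = {}" and UA: "U \<inter> A = {}" and X: "X \<subseteq> U"
    and 1: "(H1, \<sigma>1) \<in> families Z1 X" and 2: "(H2, \<sigma>2) \<in> families Z2 (U - X)"
  shows "(\<lambda>e. if e \<in> Z1 then H1 e else H2 e, \<sigma>1 \<circ> \<sigma>2) \<in> families (Z1 \<union> Z2) U"
proof -
  let ?H = "\<lambda>e. if e \<in> Z1 then H1 e else H2 e" and ?s = "\<sigma>1 \<circ> \<sigma>2"
  have XA: "X \<inter> A = {}" "(U - X) \<inter> A = {}" using X UA by auto
  note f1 = family_int[OF 1 Z1 XA(1)] and f2 = family_int[OF 2 Z2 XA(2)]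
  note s1 = family_sigma[OF 1 Z1 XA(1)] and s2 = family_sigma[OF 2 Z2 XA(2)]
  have H2: "?H e = H2 e" if "e \<in> Z2" for e using that Z by auto
  have sX: "?s x = \<sigma>1 x" if "x \<in> X" for x using permutes_not_in[OF s2, of x] that by auto
  have sUX: "?s x = \<sigma>2 x" if "x \<in> U - X" for x
    using permutes_in_image[OF s2, of x] permutes_not_in[OF s1, of "\<sigma>2 x"] that by auto
  have sA: "?s x = x" if "x \<in> A" for x
  proof -
    have "x \<notin> X" "x \<notin> U - X" using that XA by blast+
    then show ?thesis using permutes_not_in[OF s2, of x] permutes_not_in[OF s1, of x] by simp
  qed
  have perm: "?s permutes U"
    by (rule permutes_compose[OF permutes_subset[OF s2] permutes_subset[OF s1]]) (use X in auto)
  have r1: "relabel (\<tau> \<circ> ?s) (H1 e) = H1 (\<tau> ` e)" if e: "e \<in> Z1" for e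
  proof -
    have "relabel (\<tau> \<circ> ?s) (H1 e) = relabel (\<tau> \<circ> \<sigma>1) (H1 e)"
    proof (rule relabel_cong[OF family_simple(1)[OF 1 Z1 XA(1) e]])
      fix x assume "x \<in> verts (H1 e)"
      then consider "x \<in> e" | "x \<in> X" using f1[OF e] by blast
      then show "(\<tau> \<circ> ?s) x = (\<tau> \<circ> \<sigma>1) x"
      proof cases
        case 1
        then have "x \<in> A" using invariant_edge(1)[OF \<open>(H1, \<sigma>1) \<in> _\<close> Z1 XA(1) e] by blast
        moreover from this have "x \<notin> X" using XA by blast
        ultimately show ?thesis using sA[of x] permutes_not_in[OF s1, of x] by simp
      qed (use sX in simp)
    qed
    then show ?thesis using family_relabel[OF 1 Z1 XA(1) e] by simp
  qed
  have r2: "relabel (\<tau> \<circ> ?s) (H2 e) = H2 (\<tau> ` e)" if e: "e \<in> Z2" for e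
  proof -
    have "relabel (\<tau> \<circ> ?s) (H2 e) = relabel (\<tau> \<circ> \<sigma>2) (H2 e)"
    proof (rule relabel_cong[OF family_simple(1)[OF 2 Z2 XA(2) e]])
      fix x assume "x \<in> verts (H2 e)"
      then consider "x \<in> e" | "x \<in> U - X" using f2[OF e] by blast
      then show "(\<tau> \<circ> ?s) x = (\<tau> \<circ> \<sigma>2) x"
      proof cases
        case 1
        then have "x \<in> A" using invariant_edge(1)[OF \<open>(H2, \<sigma>2) \<in> _\<close> Z2 XA(2) e] by blast
        moreover from this have "x \<notin> U - X" using XA by blast
        ultimately show ?thesis using sA[of x] permutes_not_in[OF s2, of x] by simp
      qed (use sUX in simp)
    qed
    then show ?thesis using family_relabel[OF 2 Z2 XA(2) e] by simp
  qed
  have t1: "\<tau> ` e \<in> Z1" if "e \<in> Z1" for e using invariant_edge(3)[OF 1 Z1 XA(1) that] .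
  have t2: "\<tau> ` e \<in> Z2" if "e \<in> Z2" for e using invariant_edge(3)[OF 2 Z2 XA(2) that] .
  have ext: "?H \<in> extensional (Z1 \<union> Z2)" using 2 by (auto simp: families_def extensional_def)
  have n: "\<forall>e\<in>Z1 \<union> Z2. netgraph \<N> e (?H e) \<and> (verts (?H e) - e) \<inter> A = {}"
    using 1 2 by (auto simp: families_def)
  have d: "(verts (?H e) - e) \<inter> (verts (?H e') - e') = {}" if ee: "e \<in> Z1 \<union> Z2" "e' \<in> Z1 \<union> Z2" and ne: "e \<noteq> e'" for e e'
  proof -
    consider "e \<in> Z1" "e' \<in> Z1" | "e \<in> Z1" "e' \<in> Z2" | "e \<in> Z2" "e' \<in> Z1" | "e \<in> Z2" "e' \<in> Z2"
      using ee by blast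
    then show ?thesis
    proof cases
      assume "e \<in> Z1" "e' \<in> Z1"
      then show ?thesis using family_int_disjoint[OF 1 Z1 XA(1) _ _ ne] by simp
    next
      assume a: "e \<in> Z1" "e' \<in> Z2"
      then show ?thesis using f1[OF a(1)] f2[OF a(2)] H2[OF a(2)] by auto
    next
      assume a: "e \<in> Z2" "e' \<in> Z1"
      then show ?thesis using f1[OF a(2)] f2[OF a(1)] H2[OF a(1)] by auto
    next
      assume a: "e \<in> Z2" "e' \<in> Z2"
      then show ?thesis using family_int_disjoint[OF 2 Z2 XA(2) a ne] H2[OF a(1)] H2[OF a(2)] by simp
    qed
  qed
  have "(\<Union>e\<in>Z1 \<union> Z2. verts (?H e) - e) = (\<Union>e\<in>Z1. verts (H1 e) - e) \<union> (\<Union>e\<in>Z2. verts (H2 e) - e)"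
    unfolding UN_Un by (intro arg_cong2[where f="(\<union>)"] SUP_cong refl) (use H2 in auto)
  also have "\<dots> = U" unfolding family_union[OF 1 Z1 XA(1)] family_union[OF 2 Z2 XA(2)] using X by blast
  finally have u: "(\<Union>e\<in>Z1 \<union> Z2. verts (?H e) - e) = U" .
  have r: "\<forall>e\<in>Z1 \<union> Z2. relabel (\<tau> \<circ> ?s) (?H e) = ?H (\<tau> ` e)"
  proof
    fix e assume "e \<in> Z1 \<union> Z2"
    then consider "e \<in> Z1" | "e \<in> Z2" by blast
    then show "relabel (\<tau> \<circ> ?s) (?H e) = ?H (\<tau> ` e)"
      by cases (simp_all only: r1 t1 if_True H2 r2 t2)
  qed
  show ?thesis unfolding families_def using ext n d u perm r by blast
qed

text \<open>The internal vertices of the two parts are disjoint invariant sets, and so are their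
  network edges; hence cycles add up. Cutting \<sigma> off does not change it on the part in
  question.\<close>

lemma family_weight_split:
  assumes Z1: "invariant Z1" and Z2: "invariant Z2" and Z: "Z1 \<inter> Z2 = {}" and UA: "U \<inter> A = {}" and fU: "finite U"
    and mem: "(H, \<sigma>) \<in> families (Z1 \<union> Z2) U" and X: "X = (\<Union>e\<in>Z1. verts (H e) - e)"
  shows "family_weight (Z1 \<union> Z2) U (H, \<sigma>) = family_weight Z1 X (restrict H Z1, \<lambda>x. if x \<in> X then \<sigma> x else x) +
    family_weight Z2 (U - X) (restrict H Z2, \<lambda>x. if x \<in> U - X then \<sigma> x else x)"
    and "U - X = (\<Union>e\<in>Z2. verts (H e) - e)" "X \<subseteq> U"
proof -
  have inv: "invariant (Z1 \<union> Z2)" using Z1 Z2 by (auto simp: invariant_def image_Un)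
  have t: "(`) \<tau> ` Z1 = Z1" "(`) \<tau> ` Z2 = Z2" using Z1 Z2 by (auto simp: invariant_def)
  note F = mem inv UA
  note int = family_int[OF F] and s = family_sigma[OF F]
  have u: "X \<union> (\<Union>e\<in>Z2. verts (H e) - e) = U" using family_union[OF F] X by blast
  moreover have "X \<inter> (\<Union>e\<in>Z2. verts (H e) - e) = {}"
    unfolding X using family_int_disjoint[OF F] Z by fastforce
  ultimately show UX: "U - X = (\<Union>e\<in>Z2. verts (H e) - e)" and XU: "X \<subseteq> U" by blast+
  have sX: "\<sigma> ` X = X" unfolding X by (rule family_sigma_union[OF F _ t(1)]) simp
  have sUX: "\<sigma> ` (U - X) = U - X" unfolding UX by (rule family_sigma_union[OF F _ t(2)]) simp
  let ?E = "\<lambda>Y. \<Union>e\<in>Y. edges (H e)"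
  have Einv: "(`) (\<tau> \<circ> \<sigma>) ` ?E Z1 = ?E Z1" "(`) (\<tau> \<circ> \<sigma>) ` ?E Z2 = ?E Z2"
    using family_edges_invariant[OF F _ t(1)] family_edges_invariant[OF F _ t(2)] by auto
  have Efin: "finite (?E Z1)" "finite (?E Z2)"
    using finite_Z[OF F] simple_graph_finite_edges[OF family_simple(1)[OF F]] by auto
  have Ed: "?E Z1 \<inter> ?E Z2 = {}" using family_edges_disjoint[OF F] Z by fastforce
  have v: "vweight U \<sigma> = vweight X \<sigma> + vweight (U - X) \<sigma>"
    unfolding vweight_def
    by (subst cyc_sum_Un[symmetric]) (use XU fU sX sUX finite_subset in \<open>auto simp: Un_absorb1\<close>)
  have e: "eweight (?E (Z1 \<union> Z2)) (\<tau> \<circ> \<sigma>) = eweight (?E Z1) (\<tau> \<circ> \<sigma>) + eweight (?E Z2) (\<tau> \<circ> \<sigma>)"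
    unfolding eweight_def UN_Un by (rule cyc_sum_Un) (use Efin Einv Ed in auto)
  let ?s1 = "\<lambda>x. if x \<in> X then \<sigma> x else x" and ?s2 = "\<lambda>x. if x \<in> U - X then \<sigma> x else x"
  have v1: "vweight X ?s1 = vweight X \<sigma>" by (rule vweight_cong) (use sX in auto)
  have v2: "vweight (U - X) ?s2 = vweight (U - X) \<sigma>" by (rule vweight_cong) (use sUX in auto)
  have vE: "x \<in> A \<union> (\<Union>e\<in>Y. verts (H e) - e)" if "x \<in> \<Union>(?E Y)" "Y \<subseteq> Z1 \<union> Z2" for x Y
  proof -
    obtain e d where "e \<in> Y" "d \<in> edges (H e)" "x \<in> d" using \<open>x \<in> _\<close> by blast
    then have "x \<in> verts (H e)" "e \<subseteq> A"
      using edge_subset[OF family_simple(1)[OF F]] invariant_edge(1)[OF F] \<open>Y \<subseteq> _\<close> by blast+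
    then show ?thesis using \<open>e \<in> Y\<close> by blast
  qed
  have \<sigma>A: "\<sigma> x = x" if "x \<in> A" for x using permutes_not_in[OF s, of x] that UA by blast
  have e1: "eweight (?E Z1) (\<tau> \<circ> ?s1) = eweight (?E Z1) (\<tau> \<circ> \<sigma>)"
  proof (rule eweight_cong)
    fix x assume "x \<in> \<Union>(?E Z1)"
    then have "x \<in> A \<union> X" using vE[of x Z1] X by blast
    then show "(\<tau> \<circ> ?s1) x = (\<tau> \<circ> \<sigma>) x" using \<sigma>A by auto
  qed (simp only: Einv(1))
  have e2: "eweight (?E Z2) (\<tau> \<circ> ?s2) = eweight (?E Z2) (\<tau> \<circ> \<sigma>)"
  proof (rule eweight_cong)
    fix x assume "x \<in> \<Union>(?E Z2)"
    then have "x \<in> A \<union> (U - X)" using vE[of x Z2] UX by blast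
    then show "(\<tau> \<circ> ?s2) x = (\<tau> \<circ> \<sigma>) x" using \<sigma>A by auto
  qed (simp only: Einv(2))
  have c: "(\<Union>e\<in>Z1. edges (restrict H Z1 e)) = ?E Z1" "(\<Union>e\<in>Z2. edges (restrict H Z2 e)) = ?E Z2" by auto
  show "family_weight (Z1 \<union> Z2) U (H, \<sigma>) = family_weight Z1 X (restrict H Z1, ?s1) + family_weight Z2 (U - X) (restrict H Z2, ?s2)"
    unfolding family_weight_def case_prod_conv v e v1 v2 c e1 e2 by (simp add: ac_simps)
qed

lemma finite_families:
  assumes "finite U" "invariant Z" "U \<inter> A = {}"
  shows "finite (families Z U)"
proof (rule finite_subset)
  have fZ: "finite Z" by (rule finite_subset[of _ "Pow A"]) (use assms(2) finA in \<open>auto simp: invariant_def\<close>)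
  show "finite (PiE Z (\<lambda>_. {G. simple_graph G \<and> verts G \<subseteq> A \<union> U}) \<times> {\<sigma>. \<sigma> permutes U})"
    using finite_simple_graphs[of "A \<union> U"] finA assms(1) finite_permutations[OF assms(1)]
    by (intro finite_cartesian_product finite_PiE[OF fZ]) simp_all
  show "families Z U \<subseteq> PiE Z (\<lambda>_. {G. simple_graph G \<and> verts G \<subseteq> A \<union> U}) \<times> {\<sigma>. \<sigma> permutes U}"
  proof
    fix x assume x: "x \<in> families Z U"
    obtain H \<sigma> where Hs: "x = (H, \<sigma>)" by (cases x)
    note F = x[unfolded Hs] assms(2,3)
    have "H \<in> extensional Z" using F(1) by (simp add: families_def)
    moreover have "verts (H e) \<subseteq> A \<union> U" if "e \<in> Z" for e
      using family_int[OF F that] invariant_edge(1)[OF F that] by blast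
    ultimately show "x \<in> PiE Z (\<lambda>_. {G. simple_graph G \<and> verts G \<subseteq> A \<union> U}) \<times> {\<sigma>. \<sigma> permutes U}"
      using family_simple(1)[OF F] family_sigma[OF F] unfolding Hs by (auto simp: PiE_def)
  qed
qed

text \<open>The product rule: a family on two disjoint invariant edge sets amounts to a set
  \<open>X\<close> of labels for the first one and independent families on either side.\<close>

lemma family_sum_Un:
  assumes Z1: "invariant Z1" and Z2: "invariant Z2" and Z: "Z1 \<inter> Z2 = {}" and UA: "U \<inter> A = {}" and fU: "finite U"
  shows "family_sum (Z1 \<union> Z2) U = (\<Sum>X\<in>Pow U. family_sum Z1 X * family_sum Z2 (U - X))"
proof -
  have inv: "invariant (Z1 \<union> Z2)" using Z1 Z2 by (auto simp: invariant_def image_Un)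
  have t: "(`) \<tau> ` Z1 = Z1" "(`) \<tau> ` Z2 = Z2" using Z1 Z2 by (auto simp: invariant_def)
  let ?B = "SIGMA X:Pow U. families Z1 X \<times> families Z2 (U - X)"
  let ?W = "\<lambda>(X, a, b). monomial_series (family_weight Z1 X a) * monomial_series (family_weight Z2 (U - X) b)"
  define R where "R X \<sigma> = (\<lambda>x::'a. if x \<in> X then \<sigma> x else x)" for X and \<sigma> :: "'a \<Rightarrow> 'a"
  define IX where "IX H = (\<Union>e\<in>Z1. verts (H e) - e)" for H :: "'a set \<Rightarrow> 'a graph"
  define j where "j = (\<lambda>(H, \<sigma>). (IX H, (restrict H Z1, R (IX H) \<sigma>), (restrict H Z2, R (U - IX H) \<sigma>)))"
  define i where "i = (\<lambda>(X :: 'a set, (H1 :: 'a set \<Rightarrow> 'a graph, \<sigma>1 :: 'a \<Rightarrow> 'a), (H2 :: 'a set \<Rightarrow> 'a graph, \<sigma>2 :: 'a \<Rightarrow> 'a)).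
     (\<lambda>e. if e \<in> Z1 then H1 e else H2 e, \<sigma>1 \<circ> \<sigma>2))"
  have "family_sum (Z1 \<union> Z2) U = (\<Sum>x\<in>?B. ?W x)"
    unfolding family_sum_def
  proof (rule sum.reindex_bij_witness[where i = i and j = j])
    fix x assume "x \<in> families (Z1 \<union> Z2) U"
    then obtain H \<sigma> where x: "x = (H, \<sigma>)" and mem: "(H, \<sigma>) \<in> families (Z1 \<union> Z2) U" by (cases x) auto
    note F = mem inv UA
    note sp = family_weight_split[OF Z1 Z2 Z UA fU mem IX_def[of H]]
    have s: "\<sigma> permutes U" by (rule family_sigma[OF F])
    have "H \<in> extensional (Z1 \<union> Z2)" using mem by (simp add: families_def)
    then have "(\<lambda>e. if e \<in> Z1 then restrict H Z1 e else restrict H Z2 e) = H"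
      by (auto simp: fun_eq_iff extensional_def)
    \<comment> \<open>Points of one part are not moved into the other; this lets \<sigma> factor
      into its two restrictions.\<close>
    moreover have "\<sigma> y \<notin> IX H" if "y \<in> U - IX H" for y
    proof -
      have "\<sigma> ` (U - IX H) = U - IX H" unfolding sp(2) by (rule family_sigma_union[OF F _ t(2)]) simp
      then show ?thesis using that by blast
    qed
    then have "R (IX H) \<sigma> \<circ> R (U - IX H) \<sigma> = \<sigma>"
      using permutes_not_in[OF s] sp(3) by (auto simp: fun_eq_iff R_def)
    ultimately show "i (j x) = x" unfolding x i_def j_def by simp
    have "(restrict H Z1, R (IX H) \<sigma>) \<in> families Z1 (IX H)"
      unfolding R_def by (rule families_restrict[OF F _ t(1) IX_def]) simp
    moreover have "(restrict H Z2, R (U - IX H) \<sigma>) \<in> families Z2 (U - IX H)"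
      unfolding R_def by (rule families_restrict[OF F _ t(2) sp(2)]) simp
    ultimately show "j x \<in> ?B" unfolding x j_def using sp(3) by simp
    show "?W (j x) = monomial_series (family_weight (Z1 \<union> Z2) U x)"
      unfolding x j_def case_prod_conv R_def sp(1) by (rule monomial_series_mult)
  next
    fix y assume y: "y \<in> ?B"
    obtain X H1 \<sigma>1 H2 \<sigma>2 where yy: "y = (X, (H1, \<sigma>1), (H2, \<sigma>2))" by (cases y) auto
    have X: "X \<subseteq> U" and 1: "(H1, \<sigma>1) \<in> families Z1 X" and 2: "(H2, \<sigma>2) \<in> families Z2 (U - X)" using y yy by auto
    show "i y \<in> families (Z1 \<union> Z2) U" unfolding yy i_def case_prod_conv
      by (rule families_join[OF Z1 Z2 Z UA X 1 2])
    have XA: "X \<inter> A = {}" "(U - X) \<inter> A = {}" using X UA by auto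
    note s1 = family_sigma[OF 1 Z1 XA(1)] and s2 = family_sigma[OF 2 Z2 XA(2)]
    have H1: "restrict (\<lambda>e. if e \<in> Z1 then H1 e else H2 e) Z1 = H1"
      using 1 by (auto simp: fun_eq_iff families_def extensional_def)
    have H2: "restrict (\<lambda>e. if e \<in> Z1 then H1 e else H2 e) Z2 = H2"
      using 2 Z by (auto simp: fun_eq_iff families_def extensional_def)
    have IX: "IX (\<lambda>e. if e \<in> Z1 then H1 e else H2 e) = X"
      using family_union[OF 1 Z1 XA(1)] unfolding IX_def by auto
    have R1: "R X (\<sigma>1 \<circ> \<sigma>2) = \<sigma>1"
      using permutes_not_in[OF s1] permutes_not_in[OF s2] by (auto simp: fun_eq_iff R_def)
    have R2: "R (U - X) (\<sigma>1 \<circ> \<sigma>2) = \<sigma>2"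
    proof
      fix x
      show "R (U - X) (\<sigma>1 \<circ> \<sigma>2) x = \<sigma>2 x"
        using permutes_not_in[OF s1, of "\<sigma>2 x"] permutes_not_in[OF s2, of x] permutes_in_image[OF s2, of x]
        by (auto simp: R_def)
    qed
    show "j (i y) = y" unfolding yy i_def j_def case_prod_conv H1 H2 IX R1 R2 ..
  qed
  also have "\<dots> = (\<Sum>X\<in>Pow U. \<Sum>(a, b)\<in>families Z1 X \<times> families Z2 (U - X).
      monomial_series (family_weight Z1 X a) * monomial_series (family_weight Z2 (U - X) b))"
  proof (subst sum.Sigma)
    show "\<forall>X\<in>Pow U. finite (families Z1 X \<times> families Z2 (U - X))"
    proof
      fix X assume "X \<in> Pow U"
      then have "finite X" "X \<inter> A = {}" "finite (U - X)" "(U - X) \<inter> A = {}" using fU UA finite_subset by auto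
      then show "finite (families Z1 X \<times> families Z2 (U - X))"
        using finite_families[OF _ Z1] finite_families[OF _ Z2] by simp
    qed
  qed (use fU in \<open>auto intro!: sum.cong\<close>)
  also have "\<dots> = (\<Sum>X\<in>Pow U. family_sum Z1 X * family_sum Z2 (U - X))"
    unfolding family_sum_def sum_product sum.cartesian_product by simp
  finally show ?thesis .
qed

end

section \<open>Permutations of given return map\<close>

text \<open>Permutations of \<open>U\<close> for which \<open>U0\<close> is a cross-section of
  height \<open>k\<close> with return map \<alpha>. They describe the action on internal vertices
  along one cycle of networks.\<close>

definition block_perms :: "nat \<Rightarrow> 'x set \<Rightarrow> 'x set \<Rightarrow> ('x \<Rightarrow> 'x) \<Rightarrow> ('x \<Rightarrow> 'x) set" where
  "block_perms k U U0 \<alpha> = {\<sigma>. \<sigma> permutes U \<and> (\<forall>x\<in>U0. (\<sigma> ^^ k) x = \<alpha> x) \<and>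
     (\<forall>i. 0 < i \<longrightarrow> i < k \<longrightarrow> (\<sigma> ^^ i) ` U0 \<inter> U0 = {}) \<and> spread k \<sigma> U0 = U}"

text \<open>Each point of \<open>U\<close> is reached from a unique point of the cross-section after
  a unique number of steps below \<open>k\<close>. These coordinates serve to compare two such
  permutations.\<close>

lemma block_perms_bij:
  assumes "\<sigma> \<in> block_perms k U U0 \<alpha>"
  shows "bij_betw (\<lambda>(i, x). (\<sigma> ^^ i) x) ({..<k} \<times> U0) U"
  unfolding bij_betw_def
proof
  have s: "\<sigma> permutes U" "spread k \<sigma> U0 = U" and d: "\<And>i. 0 < i \<Longrightarrow> i < k \<Longrightarrow> (\<sigma> ^^ i) ` U0 \<inter> U0 = {}"
    using assms by (auto simp: block_perms_def)
  have inj: "inj \<sigma>" using s(1) by (rule permutes_inj)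
  have *: False if "(\<sigma> ^^ i) x = (\<sigma> ^^ j) y" "i < j" "j < k" "x \<in> U0" "y \<in> U0" for i j x y
  proof -
    have "(\<sigma> ^^ j) y = (\<sigma> ^^ i) ((\<sigma> ^^ (j - i)) y)" using that(2)
      by (metis add_diff_inverse_nat comp_apply funpow_add less_imp_not_less)
    then have "x = (\<sigma> ^^ (j - i)) y" using inj_fn[OF inj, of i] that(1) by (metis injD)
    then have "x \<in> (\<sigma> ^^ (j - i)) ` U0 \<inter> U0" using that by blast
    moreover have "(\<sigma> ^^ (j - i)) ` U0 \<inter> U0 = {}" by (rule d) (use that in auto)
    ultimately show False by simp
  qed
  show "inj_on (\<lambda>(i, x). (\<sigma> ^^ i) x) ({..<k} \<times> U0)"
  proof (rule inj_onI, clarify)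
    fix i x j y assume a: "i < k" "j < k" "x \<in> U0" "y \<in> U0" "(\<sigma> ^^ i) x = (\<sigma> ^^ j) y"
    have "i = j" using *[of i x j y] *[of j y i x] a by (metis linorder_neqE_nat)
    then show "i = j \<and> x = y" using a(5) inj_fn[OF inj, of i] by (auto simp: inj_eq)
  qed
  have "(\<lambda>(i, x). (\<sigma> ^^ i) x) ` ({..<k} \<times> U0) = spread k \<sigma> U0" by (force simp: spread_def)
  then show "(\<lambda>(i, x). (\<sigma> ^^ i) x) ` ({..<k} \<times> U0) = U" using s(2) by simp
qed

text \<open>Built as a tower of height \<open>k\<close> over \<open>U0\<close> whose top is glued to
  the base by \<alpha>; the equation between the cardinalities leaves just enough points for the
  upper levels.\<close>

lemma block_perms_nonempty:
  assumes "finite U" "U0 \<subseteq> U" "0 < k" "k * card U0 = card U" "\<alpha> permutes U0"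
  shows "block_perms k U U0 \<alpha> \<noteq> {}"
proof -
  let ?D = "{..<k} \<times> U0"
  have fU0: "finite U0" using assms(1,2) finite_subset by blast
  have "card ({1..<k} \<times> U0) = (k - 1) * card U0" by (simp add: card_cartesian_product)
  also have "\<dots> = card (U - U0)" using assms(4) by (simp add: card_Diff_subset[OF fU0 assms(2)] diff_mult_distrib)
  finally obtain b' where b': "bij_betw b' ({1..<k} \<times> U0) (U - U0)"
    using finite_same_card_bij[of "{1..<k} \<times> U0" "U - U0"] fU0 assms(1) by auto
  \<comment> \<open>Coordinates of the tower: level 0 is \<open>U0\<close> itself, the other levels
    are filled arbitrarily.\<close>
  define b where "b = (\<lambda>(i, x). if i = 0 then x else b' (i, x))"
  have "bij_betw b ({0} \<times> U0 \<union> {1..<k} \<times> U0) (U0 \<union> (U - U0))"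
  proof (rule bij_betw_combine)
    show "bij_betw b ({0} \<times> U0) U0" by (auto simp: b_def bij_betw_def inj_on_def image_iff)
    show "bij_betw b ({1..<k} \<times> U0) (U - U0)" using b' by (subst bij_betw_cong[of _ _ b']) (auto simp: b_def)
  qed auto
  moreover have "{0} \<times> U0 \<union> {1..<k} \<times> U0 = ?D" using assms(3) by auto
  ultimately have b: "bij_betw b ?D U" using assms(2) by (simp add: Un_absorb1)
  \<comment> \<open>Climb one level; from the top level return to the base through \<alpha>.\<close>
  define s where "s = (\<lambda>(i, x). if Suc i < k then (Suc i, x) else (0, \<alpha> x))"
  have sD: "s y \<in> ?D" if "y \<in> ?D" for y
    using that assms(3) permutes_in_image[OF assms(5)] by (auto simp: s_def split: prod.splits)
  have "inj_on s ?D"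
    using injD[OF permutes_inj[OF assms(5)]] by (auto simp: inj_on_def s_def split: if_splits)
  then have s: "bij_betw s ?D ?D"
    unfolding bij_betw_def using sD endo_inj_surj[of ?D s] fU0 by auto
  define \<sigma> where "\<sigma> y = (if y \<in> U then b (s (inv_into ?D b y)) else y)" for y
  have \<sigma>b: "\<sigma> (b z) = b (s z)" if "z \<in> ?D" for z
    using that b bij_betwE[OF b] by (auto simp: \<sigma>_def bij_betw_def inv_into_f_f)
  have "bij_betw (b \<circ> (s \<circ> inv_into ?D b)) U U"
    by (rule bij_betw_trans[OF bij_betw_trans[OF bij_betw_inv_into[OF b] s] b])
  then have "bij_betw \<sigma> U U" by (subst bij_betw_cong[of _ _ "b \<circ> (s \<circ> inv_into ?D b)"]) (auto simp: \<sigma>_def)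
  then have perm: "\<sigma> permutes U" by (rule bij_imp_permutes) (simp add: \<sigma>_def)
  have pow: "(\<sigma> ^^ i) x = b (i, x)" if "x \<in> U0" "i < k" for x i
    using that(2)
  proof (induction i)
    case (Suc i)
    then have "(\<sigma> ^^ Suc i) x = \<sigma> (b (i, x))" by simp
    also have "\<dots> = b (Suc i, x)" using Suc.prems that(1) by (subst \<sigma>b) (auto simp: s_def)
    finally show ?case .
  qed (simp add: b_def)
  have "(\<sigma> ^^ k) x = \<alpha> x" if "x \<in> U0" for x
  proof -
    obtain j where k: "k = Suc j" using assms(3) by (cases k) auto
    have "(\<sigma> ^^ k) x = \<sigma> (b (j, x))" using pow[OF that, of j] k by simp
    also have "\<dots> = b (0, \<alpha> x)" using k that by (subst \<sigma>b) (auto simp: s_def)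
    finally show ?thesis by (simp add: b_def)
  qed
  moreover have "(\<sigma> ^^ i) ` U0 \<inter> U0 = {}" if "0 < i" "i < k" for i
  proof -
    have "(\<sigma> ^^ i) ` U0 = b' ` ({i} \<times> U0)" using pow that by (force simp: b_def)
    also have "\<dots> \<subseteq> U - U0" using bij_betwE[OF b'] that by force
    finally show ?thesis by blast
  qed
  moreover have "spread k \<sigma> U0 = U"
  proof -
    have "spread k \<sigma> U0 = b ` ?D" using pow by (force simp: spread_def)
    then show ?thesis using b by (simp add: bij_betw_def)
  qed
  ultimately have "\<sigma> \<in> block_perms k U U0 \<alpha>" using perm by (simp add: block_perms_def)
  then show ?thesis by blast
qed

text \<open>The permutations of \<open>U - U0\<close> act on \<open>block_perms\<close> by
  conjugation, and this action is simply transitive.\<close>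

lemma card_block_perms:
  assumes "finite U" "U0 \<subseteq> U" "0 < k" "k * card U0 = card U" "\<alpha> permutes U0"
  shows "card (block_perms k U U0 \<alpha>) = fact (card U - card U0)"
proof -
  obtain \<sigma>0 where s0: "\<sigma>0 \<in> block_perms k U U0 \<alpha>" using block_perms_nonempty[OF assms] by blast
  have p0: "\<sigma>0 permutes U" and a0: "\<And>x. x \<in> U0 \<Longrightarrow> (\<sigma>0 ^^ k) x = \<alpha> x"
    and d0: "\<And>i. 0 < i \<Longrightarrow> i < k \<Longrightarrow> (\<sigma>0 ^^ i) ` U0 \<inter> U0 = {}" and c0: "spread k \<sigma>0 U0 = U"
    using s0 by (auto simp: block_perms_def)
  have fU0: "finite U0" using assms(1,2) finite_subset by blast
  have aU0: "\<alpha> x \<in> U0" if "x \<in> U0" for x using permutes_in_image[OF assms(5)] that by simp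
  let ?Q = "{\<pi>. \<pi> permutes (U - U0)}"
  let ?c = "\<lambda>\<pi>. conjugate \<pi> \<sigma>0"
  have fix0: "\<pi> x = x" if "\<pi> \<in> ?Q" "x \<in> U0" for \<pi> x using that permutes_not_in[of \<pi> "U - U0" x] by auto
  have pU: "\<pi> permutes U" if "\<pi> \<in> ?Q" for \<pi> using that permutes_subset[of \<pi> "U - U0" U] by auto
  have pow: "(?c \<pi> ^^ i) (\<pi> x) = \<pi> ((\<sigma>0 ^^ i) x)" if "\<pi> \<in> ?Q" for \<pi> i x
    by (induction i) (use conjugate_apply[OF permutes_bij[OF pU[OF that]]] in auto)
  have pow0: "(?c \<pi> ^^ i) x = \<pi> ((\<sigma>0 ^^ i) x)" if "\<pi> \<in> ?Q" "x \<in> U0" for \<pi> i x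
    using pow[OF that(1), of i x] fix0[OF that] by simp
  have powim: "(?c \<pi> ^^ i) ` U0 = \<pi> ` (\<sigma>0 ^^ i) ` U0" if "\<pi> \<in> ?Q" for \<pi> i
    using pow0[OF that] by (auto simp: image_iff)
  have "bij_betw ?c ?Q (block_perms k U U0 \<alpha>)"
    unfolding bij_betw_def
  proof
    \<comment> \<open>A conjugator is the identity on \<open>U0\<close>, and the conjugated
      permutation dictates its values on all translates of \<open>U0\<close>.\<close>
    show "inj_on ?c ?Q"
    proof (rule inj_onI)
      fix \<pi> \<pi>' assume p: "\<pi> \<in> ?Q" "\<pi>' \<in> ?Q" and eq: "?c \<pi> = ?c \<pi>'"
      show "\<pi> = \<pi>'"
      proof
        fix y
        show "\<pi> y = \<pi>' y"
        proof (cases "y \<in> U")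
          case True
          then obtain i x where "x \<in> U0" "y = (\<sigma>0 ^^ i) x" using c0 by (auto simp: spread_def)
          then show ?thesis using pow0[OF p(1), of x i] pow0[OF p(2), of x i] eq by simp
        next
          case False
          then show ?thesis using permutes_not_in[OF pU[OF p(1)]] permutes_not_in[OF pU[OF p(2)]] by simp
        qed
      qed
    qed
    show "?c ` ?Q = block_perms k U U0 \<alpha>"
    proof
      show "?c ` ?Q \<subseteq> block_perms k U U0 \<alpha>"
      proof (rule image_subsetI)
        fix \<pi> assume p: "\<pi> \<in> ?Q"
        have "?c \<pi> permutes \<pi> ` U" by (rule conjugate_permutes[OF permutes_bij[OF pU[OF p]] p0])
        then have "?c \<pi> permutes U" using permutes_image[OF pU[OF p]] by simp
        moreover have "(?c \<pi> ^^ k) x = \<alpha> x" if "x \<in> U0" for x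
          using pow0[OF p that] a0[OF that] fix0[OF p aU0[OF that]] by simp
        moreover have "(?c \<pi> ^^ i) ` U0 \<inter> U0 = {}" if "0 < i" "i < k" for i
        proof -
          have "\<pi> ` U0 = U0" using fix0[OF p] by simp
          then have "(?c \<pi> ^^ i) ` U0 \<inter> U0 = \<pi> ` ((\<sigma>0 ^^ i) ` U0 \<inter> U0)"
            unfolding powim[OF p] image_Int[OF permutes_inj[OF pU[OF p]]] by simp
          then show ?thesis using d0[OF that] by simp
        qed
        moreover have "spread k (?c \<pi>) U0 = \<pi> ` spread k \<sigma>0 U0"
          unfolding spread_def image_UN powim[OF p] ..
        then have "spread k (?c \<pi>) U0 = U" using c0 permutes_image[OF pU[OF p]] by simp
        ultimately show "?c \<pi> \<in> block_perms k U U0 \<alpha>" by (simp add: block_perms_def)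
      qed
      show "block_perms k U U0 \<alpha> \<subseteq> ?c ` ?Q"
      proof
        fix \<sigma> assume s: "\<sigma> \<in> block_perms k U U0 \<alpha>"
        have p: "\<sigma> permutes U" and a: "\<And>x. x \<in> U0 \<Longrightarrow> (\<sigma> ^^ k) x = \<alpha> x" and c: "spread k \<sigma> U0 = U"
          using s by (auto simp: block_perms_def)
        let ?D = "{..<k} \<times> U0" and ?h = "\<lambda>(i, x). (\<sigma>0 ^^ i) x" and ?g = "\<lambda>(i, x). (\<sigma> ^^ i) x"
        note b0 = block_perms_bij[OF s0] and b = block_perms_bij[OF s]
        \<comment> \<open>The conjugator matches the tower coordinates of \<open>\<sigma>0\<close>
          with those of \<sigma>.\<close>
        define \<pi> where "\<pi> y = (if y \<in> U then ?g (inv_into ?D ?h y) else y)" for y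
        have pi: "\<pi> ((\<sigma>0 ^^ i) x) = (\<sigma> ^^ i) x" if "i < k" "x \<in> U0" for i x
        proof -
          have "inv_into ?D ?h (?h (i, x)) = (i, x)" by (rule inv_into_f_f[OF bij_betw_imp_inj_on[OF b0]]) (use that in simp)
          moreover have "(\<sigma>0 ^^ i) x \<in> U" using bij_betwE[OF b0] that by force
          ultimately show ?thesis by (simp add: \<pi>_def)
        qed
        have "bij_betw (?g \<circ> inv_into ?D ?h) U U" by (rule bij_betw_trans[OF bij_betw_inv_into[OF b0] b])
        then have "bij_betw \<pi> U U" by (subst bij_betw_cong[of _ _ "?g \<circ> inv_into ?D ?h"]) (auto simp: \<pi>_def)
        then have pU': "\<pi> permutes U" by (rule bij_imp_permutes) (simp add: \<pi>_def)
        have pifix: "\<pi> x = x" if "x \<in> U0" for x using pi[of 0 x] assms(3) that by simp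
        have "\<pi> permutes (U - U0)" by (rule permutes_superset[OF pU']) (use pifix in auto)
        then have Q: "\<pi> \<in> ?Q" by simp
        have "?c \<pi> y = \<sigma> y" for y
        proof (cases "y \<in> U")
          case True
          then obtain i x where x: "x \<in> U0" "i < k" "y = (\<sigma> ^^ i) x" using c by (auto simp: spread_def)
          have "?c \<pi> y = \<pi> ((\<sigma>0 ^^ Suc i) x)"
            unfolding x(3) pi[OF x(2,1), symmetric] conjugate_apply[OF permutes_bij[OF pU']] by simp
          also have "\<dots> = (\<sigma> ^^ Suc i) x"
          proof (cases "Suc i < k")
            case True
            then show ?thesis using pi x(1) by blast
          next
            case False
            \<comment> \<open>At the top level both permutations return through \<alpha> to
              \<open>U0\<close>, where the conjugator is the identity.\<close>
            then have "k = Suc i" using x(2) by simp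
            then show ?thesis using a0[OF x(1)] a[OF x(1)] pifix[OF aU0[OF x(1)]] by metis
          qed
          finally show ?thesis using x(3) by simp
        next
          case False
          have "?c \<pi> permutes \<pi> ` U" by (rule conjugate_permutes[OF permutes_bij[OF pU'] p0])
          then have "?c \<pi> permutes U" using permutes_image[OF pU'] by simp
          then show ?thesis using permutes_not_in[OF _ False] p by metis
        qed
        then have "?c \<pi> = \<sigma>" by blast
        then show "\<sigma> \<in> ?c ` ?Q" using Q by blast
      qed
    qed
  qed
  then have "card (block_perms k U U0 \<alpha>) = card ?Q" by (rule bij_betw_same_card[symmetric])
  also have "\<dots> = fact (card (U - U0))" using card_permutations[OF refl, of "U - U0"] assms(1) by simp
  finally show ?thesis by (simp add: card_Diff_subset[OF fU0 assms(2)])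
qed

section \<open>Substitution and exponential generating functions\<close>

definition monomial_subst :: "('v \<Rightarrow> 'w series) \<Rightarrow> ('v \<Rightarrow>\<^sub>0 nat) \<Rightarrow> 'w series" where
  "monomial_subst s n = (\<Prod>v\<in>Poly_Mapping.keys n. s v ^ Poly_Mapping.lookup n v)"

lemma monomial_subst_superset:
  "finite K \<Longrightarrow> Poly_Mapping.keys n \<subseteq> K \<Longrightarrow> monomial_subst s n = (\<Prod>v\<in>K. s v ^ Poly_Mapping.lookup n v)"
  unfolding monomial_subst_def by (rule prod.mono_neutral_left) (auto simp: in_keys_iff)

lemma monomial_subst_add: "monomial_subst s (m + n) = monomial_subst s m * monomial_subst s n"
proof -
  let ?K = "Poly_Mapping.keys m \<union> Poly_Mapping.keys n"
  have "monomial_subst s (m + n) = (\<Prod>v\<in>?K. s v ^ Poly_Mapping.lookup (m + n) v)"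
    by (rule monomial_subst_superset) (use Poly_Mapping.keys_add[of m n] in auto)
  then show ?thesis
    by (simp add: monomial_subst_superset[of ?K] lookup_add power_add prod.distrib)
qed

lemma monomial_subst_zero [simp]: "monomial_subst s 0 = 1" by (simp add: monomial_subst_def)

lemma monomial_subst_single [simp]: "monomial_subst s (Poly_Mapping.single v j) = s v ^ j"
  by (cases "j = 0") (simp_all add: monomial_subst_def)

lemma monomial_subst_sum: "monomial_subst s (\<Sum>i\<in>I. f i) = (\<Prod>i\<in>I. monomial_subst s (f i))"
  by (induction I rule: infinite_finite_induct) (auto simp: monomial_subst_add)

lemma coeff_substitute:
  assumes "finite T" "\<And>n. coeff F n \<noteq> 0 \<Longrightarrow> coeff (monomial_subst s n) m \<noteq> 0 \<Longrightarrow> n \<in> T"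
  shows "coeff (substitute s F) m = (\<Sum>n\<in>T. coeff F n * coeff (monomial_subst s n) m)"
proof -
  have "coeff (substitute s F) m = (\<Sum>n\<in>{n. coeff F n * coeff (monomial_subst s n) m \<noteq> 0}. coeff F n * coeff (monomial_subst s n) m)"
    by (simp add: substitute_def series_sum_def monomial_subst_def)
  also have "\<dots> = (\<Sum>n\<in>T. coeff F n * coeff (monomial_subst s n) m)"
    by (rule sum.mono_neutral_left) (use assms in auto)
  finally show ?thesis .
qed

lemma var_power: "var v ^ j = monomial_series (Poly_Mapping.single v j)"
  by (induction j) (simp_all add: monomial_series_zero var_def monomial_series_mult single_add[symmetric])

lemma prod_monomial_series: "(\<Prod>i\<in>I. monomial_series (f i)) = monomial_series (\<Sum>i\<in>I. f i)"
  by (induction I rule: infinite_finite_induct) (simp_all add: monomial_series_zero monomial_series_mult)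

text \<open>Dilation sends monomials to monomials injectively, so at most one exponent vector
  contributes to each coefficient.\<close>

lemma coeff_dilate:
  assumes "0 < k"
  shows "coeff (dilate k W) (dilate_mon k n) = coeff W n"
    and "m \<notin> range (dilate_mon k) \<Longrightarrow> coeff (dilate k W) m = 0"
proof -
  have *: "monomial_subst (\<lambda>v. var (dilate_var k v)) n = monomial_series (dilate_mon k n)" for n
    by (simp add: monomial_subst_def var_power prod_monomial_series dilate_mon_def)
  show "coeff (dilate k W) (dilate_mon k n) = coeff W n"
    unfolding dilate_def
    by (subst coeff_substitute[of "{n}"])
      (use inj_dilate_mon[OF assms] in \<open>auto simp: * coeff_monomial_series inj_eq split: if_splits\<close>)
  show "m \<notin> range (dilate_mon k) \<Longrightarrow> coeff (dilate k W) m = 0"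
    unfolding dilate_def
    by (subst coeff_substitute[of "{}"]) (auto simp: * coeff_monomial_series split: if_splits)
qed

text \<open>\<open>F U\<close> is a labelled enumeration over \<open>U\<close> and \<open>W\<close>
  its exponential generating function, the degree of a monomial playing the role of the exponent.
  Labels already taken by the core \<open>A\<close> are excluded.\<close>

definition egf_on :: "'a set \<Rightarrow> ('a set \<Rightarrow> walsh_var series) \<Rightarrow> walsh_var series \<Rightarrow> bool" where
  "egf_on A F W \<longleftrightarrow> (\<forall>U m. finite U \<longrightarrow> U \<inter> A = {} \<longrightarrow>
     coeff (F U) m = (if mdeg vdeg m = card U then fact (card U) * coeff W m else 0))"

text \<open>For a fixed splitting of the monomial, the degree of the first factor prescribes the
  size of \<open>X\<close>. The number of such \<open>X\<close> is the binomial coefficient, which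
  together with the two factorials gives |U|!.\<close>

lemma egf_on_mult:
  assumes F: "egf_on A F W1" and G: "egf_on A G W2"
  shows "egf_on A (\<lambda>U. \<Sum>X\<in>Pow U. F X * G (U - X)) (W1 * W2)"
  unfolding egf_on_def
proof (intro allI impI)
  fix U :: "'a set" and m assume U: "finite U" "U \<inter> A = {}"
  let ?d = "mdeg vdeg"
  have cf: "coeff (F X) p * coeff (G (U - X)) q =
      (if ?d p = card X \<and> ?d q = card U - card X then fact (card X) * fact (card U - card X) * (coeff W1 p * coeff W2 q) else 0)"
    if "X \<in> Pow U" for X p q
  proof -
    have X: "finite X" "X \<inter> A = {}" "finite (U - X)" "(U - X) \<inter> A = {}" "card (U - X) = card U - card X"
      using that U finite_subset[of X U] by (auto simp: card_Diff_subset)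
    have "coeff (F X) p = (if ?d p = card X then fact (card X) * coeff W1 p else 0)"
      using F X unfolding egf_on_def by blast
    moreover have "coeff (G (U - X)) q = (if ?d q = card U - card X then fact (card U - card X) * coeff W2 q else 0)"
      using G X(3,4) unfolding egf_on_def X(5)[symmetric] by blast
    ultimately show ?thesis by simp
  qed
  have "coeff (\<Sum>X\<in>Pow U. F X * G (U - X)) m = (\<Sum>X\<in>Pow U. \<Sum>(p, q)\<in>splits m.
      if ?d p = card X \<and> ?d q = card U - card X then fact (card X) * fact (card U - card X) * (coeff W1 p * coeff W2 q) else 0)"
    unfolding coeff_sum coeff_mult using cf by (intro sum.cong) auto
  also have "\<dots> = (\<Sum>(p, q)\<in>splits m. \<Sum>X\<in>Pow U.
      if ?d p = card X \<and> ?d q = card U - card X then fact (card X) * fact (card U - card X) * (coeff W1 p * coeff W2 q) else 0)"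
    unfolding case_prod_unfold by (rule sum.swap)
  also have "\<dots> = (\<Sum>(p, q)\<in>splits m. if ?d m = card U then fact (card U) * (coeff W1 p * coeff W2 q) else 0)"
  proof (rule sum.cong[OF refl], clarify)
    fix p q assume "(p, q) \<in> splits m"
    then have pq: "?d m = ?d p + ?d q" by (auto simp: splits_def)
    show "(\<Sum>X\<in>Pow U. if ?d p = card X \<and> ?d q = card U - card X then fact (card X) * fact (card U - card X) * (coeff W1 p * coeff W2 q) else 0) =
      (if ?d m = card U then fact (card U) * (coeff W1 p * coeff W2 q) else 0)"
    proof (cases "?d m = card U")
      case False
      have nx: "\<not> (?d p = card X \<and> ?d q = card U - card X)" if "X \<in> Pow U" for X
        using False pq card_mono[OF U(1), of X] that by auto
      show ?thesis unfolding if_not_P[OF False] by (rule sum.neutral, rule ballI, rule if_not_P, rule nx)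
    next
      case True
      let ?c = "fact (?d p) * fact (card U - ?d p) * (coeff W1 p * coeff W2 q)"
      have "(\<Sum>X\<in>Pow U. if ?d p = card X \<and> ?d q = card U - card X then fact (card X) * fact (card U - card X) * (coeff W1 p * coeff W2 q) else 0) =
        (\<Sum>X\<in>Pow U. if card X = ?d p then ?c else 0)"
        by (rule sum.cong[OF refl]) (use True pq in auto)
      also have "\<dots> = (\<Sum>X\<in>{X. X \<subseteq> U \<and> card X = ?d p}. ?c)"
        by (rule sum.mono_neutral_cong_right) (use U in auto)
      also have "\<dots> = of_nat (card U choose ?d p) * ?c"
        by (simp add: n_subsets[OF U(1)])
      also have "\<dots> = of_nat (fact (?d p) * fact (card U - ?d p) * (card U choose ?d p)) * (coeff W1 p * coeff W2 q)"
        by (simp add: mult.commute mult.left_commute)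
      also have "fact (?d p) * fact (card U - ?d p) * (card U choose ?d p) = fact (card U)"
        by (rule binomial_fact_lemma) (use True pq in simp)
      finally show ?thesis using True by simp
    qed
  qed
  also have "\<dots> = (if ?d m = card U then fact (card U) * coeff (W1 * W2) m else 0)"
    by (simp add: coeff_mult sum_distrib_left case_prod_unfold)
  finally show "coeff (\<Sum>X\<in>Pow U. F X * G (U - X)) m = (if ?d m = card U then fact (card U) * coeff (W1 * W2) m else 0)" .
qed

lemma egf_on_cong:
  "egf_on A F W \<Longrightarrow> (\<And>U. finite U \<Longrightarrow> U \<inter> A = {} \<Longrightarrow> F' U = F U) \<Longrightarrow> egf_on A F' W"
  by (simp add: egf_on_def)

context core_aut
begin

text \<open>Without edges there are no internal vertices, hence one family when \<open>U\<close> is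
  empty and none otherwise.\<close>

lemma egf_family_sum_empty: "egf_on A (family_sum {}) 1"
  unfolding egf_on_def
proof (intro allI impI)
  fix U :: "'a set" and m assume U: "finite U" "U \<inter> A = {}"
  have "families {} U = (if U = {} then {(\<lambda>_. undefined, id)} else {})"
    by (auto simp: families_def permutes_empty)
  then have "family_sum {} U = (if U = {} then 1 else 0)"
    by (simp add: family_sum_def family_weight_def vweight_def eweight_def monomial_series_zero)
  moreover have "mdeg vdeg m = 0" if "m = 0" using that by simp
  ultimately show "coeff (family_sum {} U) m = (if mdeg vdeg m = card U then fact (card U) * coeff 1 m else 0)"
    using U(1) by (auto simp: coeff_one)
qed

text \<open>Induction over the parts with the product rule; the union of the remaining parts has to
  be recognised as invariant first.\<close>

lemma egf_family_sum_Union: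
  assumes "finite \<C>" "\<And>c. c \<in> \<C> \<Longrightarrow> invariant c" "\<And>c d. c \<in> \<C> \<Longrightarrow> d \<in> \<C> \<Longrightarrow> c \<noteq> d \<Longrightarrow> c \<inter> d = {}"
    "\<And>c. c \<in> \<C> \<Longrightarrow> egf_on A (family_sum c) (W c)"
  shows "egf_on A (family_sum (\<Union>\<C>)) (\<Prod>c\<in>\<C>. W c)"
  using assms
proof (induction \<C> rule: finite_induct)
  case empty
  then show ?case using egf_family_sum_empty by simp
next
  case (insert c \<C>)
  have i: "(\<forall>e\<in>d. e \<subseteq> A \<and> card e = 2) \<and> (`) \<tau> ` d = d" if "d \<in> \<C>" for d
  proof -
    have "invariant d" by (rule insert.prems(1)) (use that in simp)
    then show ?thesis unfolding invariant_def .
  qed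
  have "(`) \<tau> ` \<Union>\<C> = \<Union>\<C>" 
  proof
    show "(`) \<tau> ` \<Union>\<C> \<subseteq> \<Union>\<C>"
    proof (rule image_subsetI)
      fix e assume "e \<in> \<Union>\<C>"
      then obtain d where d: "d \<in> \<C>" "e \<in> d" by blast
      then have "\<tau> ` e \<in> (`) \<tau> ` d" by simp
      then have "\<tau> ` e \<in> d" using i[OF d(1)] by simp
      then show "\<tau> ` e \<in> \<Union>\<C>" using d(1) by blast
    qed
    show "\<Union>\<C> \<subseteq> (`) \<tau> ` \<Union>\<C>"
    proof
      fix e assume "e \<in> \<Union>\<C>"
      then obtain d where d: "d \<in> \<C>" "e \<in> d" by blast
      then have "e \<in> (`) \<tau> ` d" using i[OF d(1)] by simp
      then show "e \<in> (`) \<tau> ` \<Union>\<C>" using d(1) by blast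
    qed
  qed
  moreover have "\<forall>e\<in>\<Union>\<C>. e \<subseteq> A \<and> card e = 2"
  proof
    fix e assume "e \<in> \<Union>\<C>"
    then obtain d where d: "d \<in> \<C>" "e \<in> d" by blast
    show "e \<subseteq> A \<and> card e = 2" using conjunct1[OF i[OF d(1)]] d(2) by (rule bspec)
  qed
  ultimately have inv: "invariant (\<Union>\<C>)" unfolding invariant_def by simp
  have d: "c \<inter> \<Union>\<C> = {}"
  proof -
    have "c \<inter> d = {}" if "d \<in> \<C>" for d
      by (rule insert.prems(2)) (use that insert.hyps in auto)
    then show ?thesis by blast
  qed
  have IH: "egf_on A (family_sum (\<Union>\<C>)) (\<Prod>c\<in>\<C>. W c)"
    by (rule insert.IH) (simp_all add: insert.prems)
  have "egf_on A (family_sum (c \<union> \<Union>\<C>)) (W c * (\<Prod>c\<in>\<C>. W c))"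
  proof (rule egf_on_cong[OF egf_on_mult[OF _ IH]])
    show "egf_on A (family_sum c) (W c)" using insert.prems(3) by simp
    show "family_sum (c \<union> \<Union>\<C>) U = (\<Sum>X\<in>Pow U. family_sum c X * family_sum (\<Union>\<C>) (U - X))"
      if "finite U" "U \<inter> A = {}" for U
      by (rule family_sum_Un[OF _ inv d that(2,1)]) (simp add: insert.prems(1))
  qed
  then show ?case using insert.hyps by simp
qed

end

section \<open>A single cycle of substituted edges\<close>

lemma bij_betw_orbit:
  assumes "x \<in> orbit f x"
  shows "bij_betw (\<lambda>i. (f ^^ i) x) {..<card (orbit f x)} (orbit f x)"
proof -
  let ?n = "funpow_dist1 f x x"
  have inj: "inj_on (\<lambda>n. (f ^^ n) x) {0..<?n}" using inj_on_funpow_dist1[OF assms] .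
  have im: "orbit f x = (\<lambda>n. (f ^^ n) x) ` {0..<?n}" using orbit_conv_funpow_dist1[OF assms] .
  have "card (orbit f x) = ?n" by (subst im, subst card_image[OF inj]) simp
  then show ?thesis using inj im by (simp add: bij_betw_def lessThan_atLeast0)
qed

text \<open>With disjoint supports each point is moved by one factor only, so powers of the
  composition act as powers of that factor.\<close>

lemma funpow_comp_disjoint:
  assumes "\<tau> permutes A" "\<sigma> permutes U" "U \<inter> A = {}"
  shows "x \<in> U \<Longrightarrow> ((\<tau> \<circ> \<sigma>) ^^ i) x = (\<sigma> ^^ i) x" "x \<notin> U \<Longrightarrow> ((\<tau> \<circ> \<sigma>) ^^ i) x = (\<tau> ^^ i) x"
proof -
  have U: "\<tau> (\<sigma> y) = \<sigma> y" if "y \<in> U" for y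
  proof -
    have "\<sigma> y \<in> U" using permutes_in_image[OF assms(2)] that by simp
    then have "\<sigma> y \<notin> A" using assms(3) by blast
    then show ?thesis by (rule permutes_not_in[OF assms(1)])
  qed
  have \<sigma>U: "\<sigma> ` U \<subseteq> U" using permutes_image[OF assms(2)] by simp
  have \<tau>U: "\<tau> ` (- U) \<subseteq> - U"
  proof (rule image_subsetI)
    fix y assume "y \<in> - U"
    then show "\<tau> y \<in> - U"
      using permutes_in_image[OF assms(1), of y] permutes_not_in[OF assms(1), of y] assms(3) by (cases "y \<in> A") auto
  qed
  show "x \<in> U \<Longrightarrow> ((\<tau> \<circ> \<sigma>) ^^ i) x = (\<sigma> ^^ i) x"
    by (induction i) (simp_all add: U funpow_closed[OF \<sigma>U])
  show "((\<tau> \<circ> \<sigma>) ^^ i) x = (\<tau> ^^ i) x" if "x \<notin> U"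
  proof (induction i)
    case (Suc i)
    have "(\<tau> ^^ i) x \<in> - U" by (rule funpow_closed[OF \<tau>U]) (use that in simp)
    then show ?case using Suc permutes_not_in[OF assms(2)] by simp
  qed simp
qed

lemma permutes_funpow: "f permutes X \<Longrightarrow> (f ^^ n) permutes X"
  by (induction n) (simp_all add: permutes_id[unfolded id_def] permutes_compose[unfolded comp_def] o_def id_def)

context core_aut
begin

text \<open>What a family shows at a single edge \<open>e\<close> of a cycle of length
  \<open>k\<close>: the network and the return map on its internal vertices. On the ends of
  \<open>e\<close> the return map is \<open>\<tau> ^^ k\<close>, which may fix or exchange
  them.\<close>

definition blocks :: "'a set \<Rightarrow> nat \<Rightarrow> 'a set \<Rightarrow> ('a graph \<times> ('a \<Rightarrow> 'a)) set" where
  "blocks e k U0 = {(H, \<alpha>). netgraph \<N> e H \<and> verts H = e \<union> U0 \<and> \<alpha> permutes U0 \<and> relabel (\<tau> ^^ k \<circ> \<alpha>) H = H}"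

definition block_weight :: "nat \<Rightarrow> 'a set \<Rightarrow> 'a graph \<times> ('a \<Rightarrow> 'a) \<Rightarrow> (walsh_var \<Rightarrow>\<^sub>0 nat)" where
  "block_weight k U0 = (\<lambda>(H, \<alpha>). vweight U0 \<alpha> + eweight (edges H) (\<tau> ^^ k \<circ> \<alpha>))"

context
  fixes c e0 k
  assumes c: "invariant c" and k: "0 < k" and b: "bij_betw (\<lambda>i. (\<tau> ^^ i) ` e0) {..<k} c" and pk: "(\<tau> ^^ k) ` e0 = e0"
begin

lemma cycle_edge: "e \<in> c \<Longrightarrow> \<exists>i<k. e = (\<tau> ^^ i) ` e0" "i < k \<Longrightarrow> (\<tau> ^^ i) ` e0 \<in> c"
  using b unfolding bij_betw_def by auto

lemma cycle_e0: "e0 \<in> c" using cycle_edge(2)[OF k] by simp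

lemma cycle_e0_A: "e0 \<subseteq> A" "card e0 = 2" using cycle_e0 c by (auto simp: invariant_def)

lemma tau_pow_A: "(\<tau> ^^ i) ` e0 \<subseteq> A"
  using cycle_e0_A(1) permutes_image[OF permutes_funpow[OF \<tau>, of i]] by blast

context
  fixes H \<sigma> U
  assumes mem: "(H, \<sigma>) \<in> families c U" and fU: "finite U" and UA: "U \<inter> A = {}"
begin

lemmas cycle_F = mem c UA

abbreviation "tot \<equiv> \<tau> \<circ> \<sigma>"
abbreviation "inner \<equiv> verts (H e0) - e0"
text \<open>Cut off outside the internal vertices, so that it is a permutation of them in the strict
  sense of \<open>permutes\<close>.\<close>

abbreviation "ret \<equiv> \<lambda>x. if x \<in> inner then (\<sigma> ^^ k) x else x"

lemma cycle_U0: "inner \<subseteq> U" "finite inner" "inner \<inter> A = {}"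
  using family_int[OF cycle_F cycle_e0] fU finite_subset UA by blast+

text \<open>Iterating the compatibility of the family with the total permutation: the network at
  \<open>e0\<close> determines the networks along the whole cycle.\<close>

lemma cycle_relabel: "relabel (tot ^^ i) (H e0) = H ((\<tau> ^^ i) ` e0)" "i < k \<Longrightarrow> (\<sigma> ^^ i) ` inner = verts (H ((\<tau> ^^ i) ` e0)) - (\<tau> ^^ i) ` e0"
proof -
  have ic: "(\<tau> ^^ i) ` e0 \<in> c" for i
  proof (induction i)
    case (Suc i)
    have "(\<tau> ^^ Suc i) ` e0 = \<tau> ` (\<tau> ^^ i) ` e0" by (simp add: image_comp)
    then show ?case using invariant_edge(3)[OF cycle_F Suc] by simp
  qed (simp add: cycle_e0)
  show r: "relabel (tot ^^ i) (H e0) = H ((\<tau> ^^ i) ` e0)" for i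
  proof (induction i)
    case 0
    show ?case using relabel_id[of "H e0"] by (simp add: id_def)
  next
    case (Suc i)
    have "relabel (tot ^^ Suc i) (H e0) = relabel tot (relabel (tot ^^ i) (H e0))"
      by (simp only: funpow.simps relabel_comp)
    also have "\<dots> = H (\<tau> ` (\<tau> ^^ i) ` e0)" unfolding Suc by (rule family_relabel[OF cycle_F ic])
    also have "\<tau> ` (\<tau> ^^ i) ` e0 = (\<tau> ^^ Suc i) ` e0" by (simp add: image_comp)
    finally show ?case .
  qed
  have "(\<sigma> ^^ i) ` inner = (tot ^^ i) ` inner"
    by (rule image_cong[OF refl]) (use funpow_comp_disjoint(1)[OF \<tau> family_sigma[OF cycle_F] UA] cycle_U0(1) in auto)
  also have "\<dots> = (tot ^^ i) ` verts (H e0) - (tot ^^ i) ` e0"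
    by (rule image_set_diff[OF inj_fn[OF total_inj[OF cycle_F]]])
  also have "(tot ^^ i) ` e0 = (\<tau> ^^ i) ` e0"
    by (rule image_cong[OF refl]) (use funpow_comp_disjoint(2)[OF \<tau> family_sigma[OF cycle_F] UA] cycle_e0_A(1) UA in auto)
  also have "(tot ^^ i) ` verts (H e0) = verts (H ((\<tau> ^^ i) ` e0))" using r[of i] by (metis verts_relabel)
  finally show "(\<sigma> ^^ i) ` inner = verts (H ((\<tau> ^^ i) ` e0)) - (\<tau> ^^ i) ` e0" .
qed

lemma cycle_ne: "0 < i \<Longrightarrow> i < k \<Longrightarrow> (\<tau> ^^ i) ` e0 \<noteq> e0"
  using inj_onD[OF bij_betw_imp_inj_on[OF b], of i 0] k by auto

text \<open>After \<open>k\<close> steps the cycle of edges closes, so the internal vertices at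
  \<open>e0\<close> are mapped onto themselves. \<open>cycle_relabel\<close> describes translates
  below \<open>k\<close>, hence the last step is treated separately.\<close>

lemma cycle_sigma_k: "(\<sigma> ^^ k) ` inner = inner"
proof -
  obtain j where j: "k = Suc j" using k by (cases k) auto
  have "(\<sigma> ^^ k) ` inner = \<sigma> ` (\<sigma> ^^ j) ` inner" unfolding j by (simp add: image_comp)
  also have "\<dots> = \<sigma> ` (verts (H ((\<tau> ^^ j) ` e0)) - (\<tau> ^^ j) ` e0)" using cycle_relabel(2)[of j] j by simp
  also have "\<dots> = verts (H (\<tau> ` (\<tau> ^^ j) ` e0)) - \<tau> ` (\<tau> ^^ j) ` e0"
    by (rule family_sigma_int[OF cycle_F]) (use cycle_edge(2)[of j] j in simp)
  also have "\<tau> ` (\<tau> ^^ j) ` e0 = e0" using pk unfolding j by (simp add: image_comp)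
  finally show ?thesis .
qed

lemma cycle_disjoint: "0 < i \<Longrightarrow> i < k \<Longrightarrow> (\<sigma> ^^ i) ` inner \<inter> inner = {}"
  unfolding cycle_relabel(2)
  by (rule family_int_disjoint[OF cycle_F cycle_edge(2) cycle_e0 cycle_ne])

lemma cycle_spread: "spread k \<sigma> inner = U"
proof -
  have "spread k \<sigma> inner = (\<Union>i<k. verts (H ((\<tau> ^^ i) ` e0)) - (\<tau> ^^ i) ` e0)"
    unfolding spread_def using cycle_relabel(2) by simp
  also have "\<dots> = (\<Union>e\<in>(\<lambda>i. (\<tau> ^^ i) ` e0) ` {..<k}. verts (H e) - e)" by simp
  also have "\<dots> = U" using b family_union[OF cycle_F] by (simp add: bij_betw_def)
  finally show ?thesis .
qed

lemma cycle_card: "k * card inner = card U"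
  using card_spread[OF permutes_inj[OF family_sigma[OF cycle_F]] cycle_U0(2) k subset_refl cycle_disjoint] cycle_spread by simp

lemma cycle_alpha: "ret permutes inner"
  by (rule restrict_permutes[OF inj_fn[OF permutes_inj[OF family_sigma[OF cycle_F]]] cycle_sigma_k])

text \<open>The total permutation moves the two ends of \<open>e0\<close> by \<tau> and the internal
  vertices by \<sigma>, so its k-th power splits accordingly on this network.\<close>

lemma cycle_agree: "x \<in> verts (H e0) \<Longrightarrow> (\<tau> ^^ k \<circ> ret) x = (tot ^^ k) x"
proof (cases "x \<in> inner")
  case True
  then have "x \<in> U" using cycle_U0 by blast
  moreover have "(\<sigma> ^^ k) x \<in> inner" using cycle_sigma_k True by blast
  then have "(\<sigma> ^^ k) x \<notin> A" using cycle_U0(3) by blast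
  ultimately show ?thesis
    using True funpow_comp_disjoint(1)[OF \<tau> family_sigma[OF cycle_F] UA] permutes_not_in[OF permutes_funpow[OF \<tau>]] by simp
next
  case False
  assume "x \<in> verts (H e0)"
  then have "x \<in> A" using False cycle_e0_A by blast
  then have xU: "x \<notin> U" using UA by blast
  have "ret x = x" by (rule if_not_P[OF False])
  then show ?thesis unfolding comp_apply[of "\<tau> ^^ k"] funpow_comp_disjoint(2)[OF \<tau> family_sigma[OF cycle_F] UA xU] by (rule arg_cong)
qed

lemma cycle_fixed: "relabel (tot ^^ k) (H e0) = H e0"
  using cycle_relabel(1)[of k] pk by simp

lemma cycle_block: "(H e0, ret) \<in> blocks e0 k inner"
proof -
  have "relabel (\<tau> ^^ k \<circ> ret) (H e0) = H e0"
    by (rule trans[OF relabel_cong[OF family_simple(1)[OF cycle_F cycle_e0] cycle_agree] cycle_fixed])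
  moreover have "netgraph \<N> e0 (H e0)" using mem cycle_e0 by (simp add: families_def)
  moreover have "verts (H e0) = e0 \<union> inner" using family_simple(2)[OF cycle_F cycle_e0] by blast
  ultimately show ?thesis using cycle_alpha by (simp add: blocks_def)
qed

lemma cycle_perm: "\<sigma> \<in> block_perms k U inner ret"
  using family_sigma[OF cycle_F] cycle_disjoint cycle_spread by (simp add: block_perms_def)

text \<open>Internal vertices and network edges of the cycle are towers of height \<open>k\<close>
  over those at \<open>e0\<close>, so both parts of the weight are dilated by
  \<open>k\<close>.\<close>

lemma cycle_weight: "family_weight c U (H, \<sigma>) = dilate_mon k (block_weight k inner (H e0, ret))"
proof -
  note sg = family_simple(1)[OF cycle_F cycle_e0]
  have "vweight U \<sigma> = dilate_mon k (vweight inner (\<sigma> ^^ k))"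
    using vweight_spread[OF permutes_inj[OF family_sigma[OF cycle_F]] cycle_U0(2) cycle_sigma_k k cycle_disjoint] cycle_spread by simp
  also have "vweight inner (\<sigma> ^^ k) = vweight inner ret"
    by (rule vweight_cong[symmetric]) (use cycle_sigma_k in auto)
  finally have v: "vweight U \<sigma> = dilate_mon k (vweight inner ret)" .
  have im: "(`) (tot ^^ i) ` edges (H e0) = edges (H ((\<tau> ^^ i) ` e0))" for i
    using cycle_relabel(1)[of i] by (metis edges_relabel)
  have fx: "(`) (tot ^^ k) ` edges (H e0) = edges (H e0)" using im[of k] pk by simp
  have "(\<Union>e\<in>c. edges (H e)) = (\<Union>e\<in>(\<lambda>i. (\<tau> ^^ i) ` e0) ` {..<k}. edges (H e))"
    using b by (simp add: bij_betw_def)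
  also have "\<dots> = (\<Union>i<k. (`) (tot ^^ i) ` edges (H e0))" using im by simp
  also have "\<dots> = spread k ((`) tot) (edges (H e0))"
  proof -
    have "(`) tot ^^ i = (`) (tot ^^ i)" for i by (rule ext) (rule funpow_image)
    then show ?thesis by (simp add: spread_def)
  qed
  finally have "eweight (\<Union>e\<in>c. edges (H e)) tot = eweight (spread k ((`) tot) (edges (H e0))) tot" by simp
  also have "\<dots> = dilate_mon k (eweight (edges (H e0)) (tot ^^ k))"
    by (rule eweight_spread[OF total_inj[OF cycle_F] simple_graph_finite_edges[OF sg] fx k])
      (unfold im, rule family_edges_disjoint[OF cycle_F cycle_edge(2) cycle_e0 cycle_ne])
  also have "eweight (edges (H e0)) (tot ^^ k) = eweight (edges (H e0)) (\<tau> ^^ k \<circ> ret)"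
  proof (rule eweight_cong[symmetric])
    fix x assume "x \<in> \<Union> (edges (H e0))"
    then have "x \<in> verts (H e0)" using edge_subset[OF sg] by blast
    then show "(\<tau> ^^ k \<circ> ret) x = (tot ^^ k) x" by (rule cycle_agree)
  qed (simp only: fx)
  finally show ?thesis unfolding family_weight_def block_weight_def case_prod_conv v dilate_mon_add
    by (rule arg_cong)
qed

text \<open>The family is recovered from its network at \<open>e0\<close> and \<sigma>; the inverse
  function yields the unique exponent below \<open>k\<close> leading from \<open>e0\<close> to a
  given edge.\<close>

lemma cycle_family: "H = restrict (\<lambda>e. relabel (tot ^^ inv_into {..<k} (\<lambda>i. (\<tau> ^^ i) ` e0) e) (H e0)) c"
proof (rule extensionalityI[of _ c])
  show "H \<in> extensional c" using mem by (simp add: families_def)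
  fix e assume e: "e \<in> c"
  let ?i = "inv_into {..<k} (\<lambda>i. (\<tau> ^^ i) ` e0) e"
  have "(\<tau> ^^ ?i) ` e0 = e" using bij_betw_inv_into_right[OF b e] .
  then show "H e = restrict (\<lambda>e. relabel (tot ^^ inv_into {..<k} (\<lambda>i. (\<tau> ^^ i) ` e0) e) (H e0)) c e"
    using e cycle_relabel(1)[of ?i] by simp
qed simp

end

context
  fixes U V0 H0 \<beta> \<sigma>
  assumes V0: "V0 \<subseteq> U" and UA: "U \<inter> A = {}" and blk: "(H0, \<beta>) \<in> blocks e0 k V0" and perm: "\<sigma> \<in> block_perms k U V0 \<beta>"
begin

text \<open>The converse construction: place the block at \<open>e0\<close> and move it along the
  cycle by powers of the total permutation.\<close>

abbreviation "family_of \<equiv> restrict (\<lambda>e. relabel ((\<tau> \<circ> \<sigma>) ^^ inv_into {..<k} (\<lambda>i. (\<tau> ^^ i) ` e0) e) H0) c"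

lemma family_of_eq: "i < k \<Longrightarrow> family_of ((\<tau> ^^ i) ` e0) = relabel ((\<tau> \<circ> \<sigma>) ^^ i) H0"
  using bij_betw_inv_into_left[OF b, of i] cycle_edge(2)[of i] by simp

lemma block_facts: "netgraph \<N> e0 H0" "verts H0 = e0 \<union> V0" "\<beta> permutes V0" "relabel (\<tau> ^^ k \<circ> \<beta>) H0 = H0"
  "\<sigma> permutes U" "\<And>x. x \<in> V0 \<Longrightarrow> (\<sigma> ^^ k) x = \<beta> x" "spread k \<sigma> V0 = U"
  using blk perm by (auto simp: blocks_def block_perms_def)

lemma family_of_verts: "i < k \<Longrightarrow> verts (family_of ((\<tau> ^^ i) ` e0)) - (\<tau> ^^ i) ` e0 = (\<sigma> ^^ i) ` V0"
proof -
  assume i: "i < k"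
  have 1: "((\<tau> \<circ> \<sigma>) ^^ i) ` e0 = (\<tau> ^^ i) ` e0"
    by (rule image_cong[OF refl]) (use funpow_comp_disjoint(2)[OF \<tau> block_facts(5) UA] cycle_e0_A(1) UA in auto)
  have 2: "((\<tau> \<circ> \<sigma>) ^^ i) ` V0 = (\<sigma> ^^ i) ` V0"
    by (rule image_cong[OF refl]) (use funpow_comp_disjoint(1)[OF \<tau> block_facts(5) UA] V0 in auto)
  have "(\<sigma> ^^ i) ` V0 \<subseteq> U" using permutes_image[OF permutes_funpow[OF block_facts(5), of i]] V0 by blast
  then show ?thesis unfolding family_of_eq[OF i] verts_relabel block_facts(2) image_Un 1 2
    using tau_pow_A[of i] UA by blast
qed

lemma block_agree: "x \<in> verts H0 \<Longrightarrow> ((\<tau> \<circ> \<sigma>) ^^ k) x = (\<tau> ^^ k \<circ> \<beta>) x"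
proof (cases "x \<in> V0")
  case True
  then have "\<beta> x \<in> V0" using permutes_in_image[OF block_facts(3)] by simp
  then have "\<beta> x \<notin> A" using V0 UA by blast
  moreover have "x \<in> U" using True V0 by blast
  ultimately show ?thesis
    using True funpow_comp_disjoint(1)[OF \<tau> block_facts(5) UA] permutes_not_in[OF permutes_funpow[OF \<tau>]] block_facts(6) by simp
next
  case False
  assume "x \<in> verts H0"
  then have "x \<in> A" using False cycle_e0_A block_facts(2) by blast
  then have "x \<notin> U" using UA by blast
  then show ?thesis
    using funpow_comp_disjoint(2)[OF \<tau> block_facts(5) UA] permutes_not_in[OF block_facts(3) False] by simp
qed

lemma family_of_mem: "(family_of, \<sigma>) \<in> families c U"
proof -
  have inj: "inj (\<tau> \<circ> \<sigma>)" by (intro inj_compose permutes_inj[OF \<tau>] permutes_inj[OF block_facts(5)])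
  \<comment> \<open>Uniqueness of tower coordinates keeps the internal vertices at different edges
    apart.\<close>
  have bb: "inj_on (\<lambda>(i, x). (\<sigma> ^^ i) x) ({..<k} \<times> V0)"
    using block_perms_bij[OF perm] by (rule bij_betw_imp_inj_on)
  have sU: "(\<sigma> ^^ i) ` V0 \<subseteq> U" for i using permutes_image[OF permutes_funpow[OF block_facts(5), of i]] V0 by blast
  have net: "netgraph \<N> e (family_of e) \<and> (verts (family_of e) - e) \<inter> A = {}" if e: "e \<in> c" for e
  proof -
    obtain i where i: "i < k" "e = (\<tau> ^^ i) ` e0" using cycle_edge(1)[OF e] by blast
    have "((\<tau> \<circ> \<sigma>) ^^ i) ` e0 = (\<tau> ^^ i) ` e0"
      by (rule image_cong[OF refl]) (use funpow_comp_disjoint(2)[OF \<tau> block_facts(5) UA] cycle_e0_A(1) UA in auto)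
    then have "netgraph \<N> e (family_of e)"
      using netgraph_relabel[OF block_facts(1) inj_fn[OF inj, of i]] unfolding i(2) family_of_eq[OF i(1)] by simp
    then show ?thesis unfolding i(2) family_of_verts[OF i(1)] using sU[of i] UA by blast
  qed
  have dis: "(verts (family_of e) - e) \<inter> (verts (family_of e') - e') = {}" if e: "e \<in> c" "e' \<in> c" "e \<noteq> e'" for e e'
  proof -
    obtain i where i: "i < k" "e = (\<tau> ^^ i) ` e0" using cycle_edge(1)[OF e(1)] by blast
    obtain j where j: "j < k" "e' = (\<tau> ^^ j) ` e0" using cycle_edge(1)[OF e(2)] by blast
    have "i \<noteq> j" using e(3) i j by blast
    then show ?thesis unfolding i(2) family_of_verts[OF i(1)] j(2) family_of_verts[OF j(1)]
      using inj_onD[OF bb] i(1) j(1) by fastforce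
  qed
  have un: "(\<Union>e\<in>c. verts (family_of e) - e) = U"
  proof -
    have "(\<Union>e\<in>(\<lambda>i. (\<tau> ^^ i) ` e0) ` {..<k}. verts (family_of e) - e) = (\<Union>i\<in>{..<k}. (\<sigma> ^^ i) ` V0)"
      unfolding image_image by (rule SUP_cong[OF refl]) (use family_of_verts in auto)
    then show ?thesis using b block_facts(7) by (simp only: bij_betw_def spread_def)
  qed
  have rel: "relabel (\<tau> \<circ> \<sigma>) (family_of e) = family_of (\<tau> ` e)" if e: "e \<in> c" for e
  proof -
    obtain i where i: "i < k" "e = (\<tau> ^^ i) ` e0" using cycle_edge(1)[OF e] by blast
    have te: "\<tau> ` e = (\<tau> ^^ Suc i) ` e0" unfolding i(2) by (simp add: image_comp)
    have "relabel (\<tau> \<circ> \<sigma>) (family_of e) = relabel ((\<tau> \<circ> \<sigma>) ^^ Suc i) H0"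
      unfolding i(2) family_of_eq[OF i(1)] by (simp only: funpow.simps relabel_comp)
    also have "\<dots> = family_of (\<tau> ` e)"
    proof (cases "Suc i < k")
      case True
      then show ?thesis unfolding te by (rule family_of_eq[symmetric])
    next
      case False
      \<comment> \<open>The step from the last edge back to \<open>e0\<close>: the family closes up
        because the return map is an automorphism of the block.\<close>
      then have ki: "Suc i = k" using i(1) by simp
      have "relabel ((\<tau> \<circ> \<sigma>) ^^ k) H0 = relabel (\<tau> ^^ k \<circ> \<beta>) H0"
        by (rule relabel_cong[OF _ block_agree]) (use netgraph_simple[OF block_facts(1)] in auto)
      also have "\<dots> = H0" by (rule block_facts(4))
      also have "H0 = family_of ((\<tau> ^^ 0) ` e0)" unfolding family_of_eq[OF k] using relabel_id[of H0] by (simp add: id_def)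
      finally show ?thesis unfolding te ki pk by simp
    qed
    finally show ?thesis .
  qed
  have "family_of \<in> extensional c" by simp
  then show ?thesis unfolding families_def using net dis un rel block_facts(5) by blast
qed

lemma family_of_e0: "family_of e0 = H0" "verts (family_of e0) - e0 = V0"
  "(\<lambda>x. if x \<in> V0 then (\<sigma> ^^ k) x else x) = \<beta>"
proof -
  show "family_of e0 = H0" using family_of_eq[OF k] relabel_id[of H0] by (simp add: id_def)
  show "verts (family_of e0) - e0 = V0" using family_of_verts[OF k] by simp
  show "(\<lambda>x. if x \<in> V0 then (\<sigma> ^^ k) x else x) = \<beta>"
    using block_facts(6) permutes_not_in[OF block_facts(3)] by auto
qed

end

end

end

section \<open>Generating function of one cycle of networks\<close>

context core_aut
begin

definition block_sum :: "'a set \<Rightarrow> nat \<Rightarrow> 'a set \<Rightarrow> walsh_var series" where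
  "block_sum e k V0 = (\<Sum>y\<in>blocks e k V0. monomial_series (block_weight k V0 y))"

lemma finite_blocks:
  assumes "finite V0" "finite e"
  shows "finite (blocks e k V0)"
proof (rule finite_subset)
  show "finite ({G. simple_graph G \<and> verts G \<subseteq> e \<union> V0} \<times> {\<alpha>. \<alpha> permutes V0})"
    using finite_simple_graphs[of "e \<union> V0"] finite_permutations[OF assms(1)] assms by simp
  show "blocks e k V0 \<subseteq> {G. simple_graph G \<and> verts G \<subseteq> e \<union> V0} \<times> {\<alpha>. \<alpha> permutes V0}"
    using netgraph_simple by (auto simp: blocks_def)
qed

text \<open>\<open>\<tau> ^^ k\<close> may move core vertices away from \<open>e\<close>, but a
  network at \<open>e\<close> sees only its effect on the two ends. So it is replaced by
  \<open>s\<close>, in practice the identity or the transposition of the ends, which turns blocks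
  into the pairs counted with \<open>aut_plus\<close> or \<open>aut_minus\<close>.\<close>

lemma block_sum_eq:
  assumes e: "e = {p, q}" and pq: "p \<noteq> q" "p \<notin> V0" "q \<notin> V0" and V0: "finite V0" "V0 \<inter> A = {}"
    and s: "\<And>x. x \<in> e \<Longrightarrow> (\<tau> ^^ k) x = s x" "\<And>x. x \<notin> e \<Longrightarrow> s x = x"
    and X: "\<And>H. H \<in> net_graphs \<N> p q V0 \<Longrightarrow> X H = {\<alpha>. \<alpha> permutes V0 \<and> relabel (s \<circ> \<alpha>) H = H}"
  shows "coeff (block_sum e k V0) n = (\<Sum>H\<in>net_graphs \<N> p q V0. \<Sum>\<alpha>\<in>X H.
      coeff (monomial_series (vweight V0 \<alpha> + eweight (edges H) (s \<circ> \<alpha>))) n)"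
    and "y \<in> blocks e k V0 \<Longrightarrow> mdeg vdeg (block_weight k V0 y) = card V0"
proof -
  have agree: "(\<tau> ^^ k \<circ> \<alpha>) x = (s \<circ> \<alpha>) x" if "\<alpha> permutes V0" "x \<in> e \<union> V0" for \<alpha> x
  proof (cases "x \<in> V0")
    case True
    then have a: "\<alpha> x \<in> V0" using permutes_in_image[OF that(1)] by simp
    then have "\<alpha> x \<notin> A" "\<alpha> x \<notin> e" using V0(2) e pq by auto
    then show ?thesis using s(2) permutes_not_in[OF permutes_funpow[OF \<tau>]] by simp
  next
    case False
    then have "\<alpha> x = x" "x \<in> e" using permutes_not_in[OF that(1)] that(2) by auto
    then show ?thesis using s(1) by simp
  qed
  have nv: "verts H = e \<union> V0" "simple_graph H" "netgraph \<N> e H" if "H \<in> net_graphs \<N> p q V0" for H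
    using that network_species_network[OF \<N>, of "Network H p q"] netgraph_iff[OF e]
    by (auto simp: net_graphs_def e is_network_def)
  have rel: "relabel (\<tau> ^^ k \<circ> \<alpha>) H = relabel (s \<circ> \<alpha>) H" if "H \<in> net_graphs \<N> p q V0" "\<alpha> permutes V0" for H \<alpha>
    by (rule relabel_cong[OF nv(2)[OF that(1)]]) (use agree[OF that(2)] nv(1)[OF that(1)] in auto)
  have bl: "blocks e k V0 = (SIGMA H:net_graphs \<N> p q V0. X H)"
  proof (rule set_eqI, clarify)
    fix H \<alpha>
    have "(H, \<alpha>) \<in> blocks e k V0 \<longleftrightarrow> H \<in> net_graphs \<N> p q V0 \<and> \<alpha> permutes V0 \<and> relabel (\<tau> ^^ k \<circ> \<alpha>) H = H"
      using netgraph_iff[OF e, of H] by (auto simp: blocks_def net_graphs_def e)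
    then show "(H, \<alpha>) \<in> blocks e k V0 \<longleftrightarrow> (H, \<alpha>) \<in> (SIGMA H:net_graphs \<N> p q V0. X H)"
    proof (cases "H \<in> net_graphs \<N> p q V0")
      case True
      then show ?thesis using rel[OF True, of \<alpha>] unfolding \<open>(H, \<alpha>) \<in> blocks e k V0 \<longleftrightarrow> _\<close> mem_Sigma_iff X[OF True] by auto
    qed simp
  qed
  have ew: "eweight (edges H) (\<tau> ^^ k \<circ> \<alpha>) = eweight (edges H) (s \<circ> \<alpha>)" if "H \<in> net_graphs \<N> p q V0" "\<alpha> \<in> X H" for H \<alpha>
  proof (rule eweight_cong)
    have a: "\<alpha> permutes V0" "relabel (s \<circ> \<alpha>) H = H" using that(2) unfolding X[OF that(1)] by blast+
    show "(`) (s \<circ> \<alpha>) ` edges H \<subseteq> edges H" by (rule equalityD1[OF relabel_fixed(2)[OF a(2)]])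
    fix x assume "x \<in> \<Union> (edges H)"
    then have "x \<in> e \<union> V0" using edge_subset[OF nv(2)[OF that(1)]] nv(1)[OF that(1)] by blast
    then show "(\<tau> ^^ k \<circ> \<alpha>) x = (s \<circ> \<alpha>) x" by (rule agree[OF a(1)])
  qed
  have fX: "finite (X H)" if "H \<in> net_graphs \<N> p q V0" for H
    unfolding X[OF that] using finite_permutations[OF V0(1)] by simp
  have "coeff (block_sum e k V0) n = (\<Sum>(H, \<alpha>)\<in>(SIGMA H:net_graphs \<N> p q V0. X H). coeff (monomial_series (block_weight k V0 (H, \<alpha>))) n)"
    by (simp add: block_sum_def bl case_prod_unfold)
  also have "\<dots> = (\<Sum>H\<in>net_graphs \<N> p q V0. \<Sum>\<alpha>\<in>X H. coeff (monomial_series (block_weight k V0 (H, \<alpha>))) n)"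
    by (rule sum.Sigma[symmetric]) (use finite_net_graphs[OF \<N> V0(1)] fX in auto)
  also have "\<dots> = (\<Sum>H\<in>net_graphs \<N> p q V0. \<Sum>\<alpha>\<in>X H. coeff (monomial_series (vweight V0 \<alpha> + eweight (edges H) (s \<circ> \<alpha>))) n)"
    by (intro sum.cong refl) (simp add: block_weight_def ew)
  finally show "coeff (block_sum e k V0) n = (\<Sum>H\<in>net_graphs \<N> p q V0. \<Sum>\<alpha>\<in>X H.
      coeff (monomial_series (vweight V0 \<alpha> + eweight (edges H) (s \<circ> \<alpha>))) n)" .
  assume "y \<in> blocks e k V0"
  then obtain H \<alpha> where y: "y = (H, \<alpha>)" and a: "\<alpha> permutes V0" by (auto simp: blocks_def)
  have "mdeg vdeg (vweight V0 \<alpha>) = card V0" unfolding vweight_def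
    by (rule mdeg_cyc_sum_vertices[OF permutes_inj[OF a] V0(1)]) (simp only: permutes_image[OF a] subset_refl)
  then show "mdeg vdeg (block_weight k V0 y) = card V0"
    unfolding y block_weight_def by (simp add: eweight_def mdeg_cyc_sum_edges)
qed

context
  fixes c e0 k
  assumes c: "invariant c" and k: "0 < k" and b: "bij_betw (\<lambda>i. (\<tau> ^^ i) ` e0) {..<k} c" and pk: "(\<tau> ^^ k) ` e0 = e0"
begin

definition "cycle_series = (if cylindrical \<tau> c then walsh_plus \<N> else walsh_minus \<N>)"

text \<open>\<open>\<tau> ^^ k\<close> preserves \<open>e0\<close>, so it fixes its ends or
  exchanges them. The first case is the cylindrical one and leads to \<open>walsh_plus\<close>, the
  second to \<open>walsh_minus\<close>.\<close>

lemma egf_block_sum: "egf_on A (block_sum e0 k) cycle_series"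
  unfolding egf_on_def
proof (intro allI impI)
  fix V0 :: "'a set" and n assume V0: "finite V0" "V0 \<inter> A = {}"
  note e0A = cycle_e0_A[OF c k b pk]
  obtain p q where pq: "e0 = {p, q}" "p \<noteq> q" using e0A(2) by (meson card_2_iff)
  have pV: "p \<notin> V0" "q \<notin> V0" using e0A(1) pq V0 by auto
  have ck: "card c = k" using bij_betw_same_card[OF b] by simp
  have int: "internal (Network H p q) = V0" "is_network (Network H p q)" if "H \<in> net_graphs \<N> p q V0" for H
    using that pV network_species_network[OF \<N>] by (auto simp: net_graphs_def internal_def)
  have ni: "inj (\<tau> ^^ k)" by (rule inj_fn[OF permutes_inj[OF \<tau>]])
  have "(\<tau> ^^ k) p \<in> {p, q}" "(\<tau> ^^ k) q \<in> {p, q}" using pk pq(1) by blast+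
  moreover have "(\<tau> ^^ k) p \<noteq> (\<tau> ^^ k) q" using pq(2) ni by (simp add: inj_eq)
  ultimately consider (fx) "(\<tau> ^^ k) p = p" "(\<tau> ^^ k) q = q" | (swap) "(\<tau> ^^ k) p = q" "(\<tau> ^^ k) q = p" by auto
  then show "coeff (block_sum e0 k V0) n = (if mdeg vdeg n = card V0 then fact (card V0) * coeff cycle_series n else 0)"
  proof cases
    case fx
    have "cylindrical \<tau> c" unfolding cylindrical_def ck
    proof (intro ballI)
      fix e x assume "e \<in> c" "x \<in> e"
      then obtain i y where "x = (\<tau> ^^ i) y" "y = p \<or> y = q" using cycle_edge(1)[OF c k b pk] pq(1) by blast
      moreover have "(\<tau> ^^ k) ((\<tau> ^^ i) y) = (\<tau> ^^ i) ((\<tau> ^^ k) y)" by (metis add.commute comp_apply funpow_add)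
      ultimately show "(\<tau> ^^ k) x = x" using fx by auto
    qed
    then have W: "cycle_series = walsh_plus \<N>" by (simp add: cycle_series_def)
    have X: "aut_plus (Network H p q) = {\<alpha>. \<alpha> permutes V0 \<and> relabel (id \<circ> \<alpha>) H = H}" if "H \<in> net_graphs \<N> p q V0" for H
    proof -
      have "\<alpha> permutes verts H" if "\<alpha> permutes V0" for \<alpha>
        by (rule permutes_subset[OF that]) (use \<open>H \<in> _\<close> in \<open>auto simp: net_graphs_def\<close>)
      then show ?thesis unfolding aut_plus_def int(1)[OF that] graph_auts_eq by auto
    qed
    have s: "(\<tau> ^^ k) x = id x" if "x \<in> e0" for x using that fx unfolding pq(1) by auto
    note bs = block_sum_eq[OF pq(1,2) pV V0 s _ X]
    show ?thesis
    proof (cases "mdeg vdeg n = card V0")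
      case True
      then show ?thesis using bs(1) coeff_walsh_plus[OF \<N> V0(1) pq(2) pV True] W by simp
    next
      case False
      \<comment> \<open>Every block on \<open>V0\<close> has a weight of degree |V0|, so nothing
        contributes.\<close>
      then have "coeff (block_sum e0 k V0) n = 0"
        unfolding block_sum_def coeff_sum using bs(2) by (intro sum.neutral) (auto simp: coeff_monomial_series)
      then show ?thesis using False by simp
    qed
  next
    case swap
    have "\<not> cylindrical \<tau> c"
    proof
      assume "cylindrical \<tau> c"
      moreover have "p \<in> e0" using pq(1) by simp
      ultimately have "(\<tau> ^^ k) p = p" using cycle_e0[OF c k b pk] unfolding cylindrical_def ck by blast
      then show False using swap(1) pq(2) by simp
    qed
    then have W: "cycle_series = walsh_minus \<N>" by (simp add: cycle_series_def)
    have X: "aut_minus (Network H p q) = {\<alpha>. \<alpha> permutes V0 \<and> relabel (transpose p q \<circ> \<alpha>) H = H}" if "H \<in> net_graphs \<N> p q V0" for H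
      unfolding aut_minus_eq[OF int(2)[OF that]] int(1)[OF that] by (simp add: sigma_minus_def)
    have s: "(\<tau> ^^ k) x = transpose p q x" if "x \<in> e0" for x using that swap unfolding pq(1) by auto
    have s': "transpose p q x = x" if "x \<notin> e0" for x using that unfolding pq(1) by (auto simp: transpose_def)
    note bs = block_sum_eq[OF pq(1,2) pV V0 s s' X]
    show ?thesis
    proof (cases "mdeg vdeg n = card V0")
      case True
      then show ?thesis using bs(1) coeff_walsh_minus[OF \<N> V0(1) pq(2) pV True] W by simp
    next
      case False
      then have "coeff (block_sum e0 k V0) n = 0"
        unfolding block_sum_def coeff_sum using bs(2) by (intro sum.neutral) (auto simp: coeff_monomial_series)
      then show ?thesis using False by simp
    qed
  qed
qed

text \<open>\<open>V0\<close> is the set of internal vertices at \<open>e0\<close>. A family on the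
  cycle is the same as a block there together with a permutation of all internal vertices having the
  prescribed return map.\<close>

lemma family_sum_cycle:
  assumes fU: "finite U" and UA: "U \<inter> A = {}"
  shows "family_sum c U = (\<Sum>V0\<in>{V0. V0 \<subseteq> U \<and> k * card V0 = card U}. \<Sum>y\<in>blocks e0 k V0. \<Sum>\<sigma>\<in>block_perms k U V0 (snd y).
     monomial_series (dilate_mon k (block_weight k V0 y)))"
proof -
  note C = c k b pk
  let ?T = "{V0. V0 \<subseteq> U \<and> k * card V0 = card U}"
  let ?B = "SIGMA V0:?T. SIGMA y:blocks e0 k V0. block_perms k U V0 (snd y)"
  let ?W = "\<lambda>(V0, y, \<sigma> :: 'a \<Rightarrow> 'a). monomial_series (dilate_mon k (block_weight k V0 y))"
  define iv where "iv H = verts (H e0) - e0" for H :: "'a set \<Rightarrow> 'a graph"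
  define al where "al V \<sigma> = (\<lambda>x. if x \<in> V then (\<sigma> ^^ k) x else x)" for V and \<sigma> :: "'a \<Rightarrow> 'a"
  define fam where "fam H0 \<sigma> = restrict (\<lambda>e. relabel ((\<tau> \<circ> \<sigma>) ^^ inv_into {..<k} (\<lambda>i. (\<tau> ^^ i) ` e0) e) H0) c" for H0 :: "'a graph" and \<sigma>
  define j where "j = (\<lambda>(H, \<sigma>). (iv H, (H e0, al (iv H) \<sigma>), \<sigma>))"
  define i where "i = (\<lambda>(V0 :: 'a set, (H0 :: 'a graph, \<alpha> :: 'a \<Rightarrow> 'a), \<sigma>). (fam H0 \<sigma>, \<sigma>))"
  have fT: "finite ?T" using fU by simp
  have fB: "finite (blocks e0 k V0)" "finite (block_perms k U V0 (snd y))" if "V0 \<in> ?T" for V0 y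
  proof -
    have "finite e0" using finite_subset[OF cycle_e0_A(1)[OF C] finA] .
    then show "finite (blocks e0 k V0)" using finite_blocks finite_subset[of V0 U] that fU by blast
    show "finite (block_perms k U V0 (snd y))"
      by (rule finite_subset[OF _ finite_permutations[OF fU]]) (auto simp: block_perms_def)
  qed
  have "family_sum c U = (\<Sum>x\<in>?B. ?W x)"
    unfolding family_sum_def
  proof (rule sum.reindex_bij_witness[where i = i and j = j])
    fix x assume "x \<in> families c U"
    then obtain H \<sigma> where x: "x = (H, \<sigma>)" and mem: "(H, \<sigma>) \<in> families c U" by (cases x) auto
    note D = C mem fU UA
    show "i (j x) = x" unfolding x i_def j_def case_prod_conv fam_def using cycle_family[OF D] by simp
    have "iv H \<in> ?T" unfolding iv_def using cycle_U0(1)[OF D] cycle_card[OF D] by simp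
    moreover have "(H e0, al (iv H) \<sigma>) \<in> blocks e0 k (iv H)" unfolding iv_def al_def by (rule cycle_block[OF D])
    moreover have "\<sigma> \<in> block_perms k U (iv H) (al (iv H) \<sigma>)" unfolding iv_def al_def by (rule cycle_perm[OF D])
    ultimately show "j x \<in> ?B" unfolding x j_def by simp
    show "?W (j x) = monomial_series (family_weight c U x)"
      unfolding x j_def case_prod_conv iv_def al_def cycle_weight[OF D] ..
  next
    fix y assume y: "y \<in> ?B"
    obtain V0 H0 \<alpha> \<sigma> where yy: "y = (V0, (H0, \<alpha>), \<sigma>)" by (cases y) auto
    have V0: "V0 \<subseteq> U" and blk: "(H0, \<alpha>) \<in> blocks e0 k V0" and perm: "\<sigma> \<in> block_perms k U V0 \<alpha>" using y yy by auto
    note D = C V0 UA blk perm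
    show "i y \<in> families c U" unfolding yy i_def case_prod_conv fam_def by (rule family_of_mem[OF D])
    have e: "fam H0 \<sigma> e0 = H0" "iv (fam H0 \<sigma>) = V0" "al V0 \<sigma> = \<alpha>"
      using family_of_e0[OF D] unfolding fam_def iv_def al_def by auto
    show "j (i y) = y" unfolding yy i_def j_def case_prod_conv e ..
  qed
  also have "\<dots> = (\<Sum>V0\<in>?T. \<Sum>(y, \<sigma>)\<in>(SIGMA y:blocks e0 k V0. block_perms k U V0 (snd y)).
      monomial_series (dilate_mon k (block_weight k V0 y)))"
    by (subst sum.Sigma[OF fT]) (use fB in \<open>auto intro!: sum.cong\<close>)
  also have "\<dots> = (\<Sum>V0\<in>?T. \<Sum>y\<in>blocks e0 k V0. \<Sum>\<sigma>\<in>block_perms k U V0 (snd y).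
     monomial_series (dilate_mon k (block_weight k V0 y)))"
    by (rule sum.cong[OF refl], rule sum.Sigma[symmetric]) (use fB in auto)
  finally show ?thesis .
qed

text \<open>Let l be the degree before dilation, so that |U| = k l. There are binom(|U|, l) sets
  \<open>V0\<close>, the block sum contributes l!, and (|U| - l)! permutations have a given return
  map. The product is |U|!, so the cycle yields its dilated series with no further factor.\<close>

lemma egf_family_sum_cycle: "egf_on A (family_sum c) (dilate k cycle_series)"
  unfolding egf_on_def
proof (intro allI impI)
  fix U :: "'a set" and m assume fU: "finite U" and UA: "U \<inter> A = {}"
  let ?T = "{V0. V0 \<subseteq> U \<and> k * card V0 = card U}"
  have "coeff (family_sum c U) m = (\<Sum>V0\<in>?T. \<Sum>y\<in>blocks e0 k V0.
      of_nat (card (block_perms k U V0 (snd y))) * coeff (monomial_series (dilate_mon k (block_weight k V0 y))) m)"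
    unfolding family_sum_cycle[OF fU UA] coeff_sum unfolding sum_constant ..
  also have "\<dots> = (\<Sum>V0\<in>?T. \<Sum>y\<in>blocks e0 k V0.
      fact (card U - card V0) * coeff (monomial_series (dilate_mon k (block_weight k V0 y))) m)"
  proof (intro sum.cong refl)
    fix V0 y assume V0: "V0 \<in> ?T" and "y \<in> blocks e0 k V0"
    then have "snd y permutes V0" by (auto simp: blocks_def)
    then have "card (block_perms k U V0 (snd y)) = fact (card U - card V0)"
      by (intro card_block_perms) (use V0 fU k in auto)
    then show "of_nat (card (block_perms k U V0 (snd y))) * coeff (monomial_series (dilate_mon k (block_weight k V0 y))) m =
      fact (card U - card V0) * coeff (monomial_series (dilate_mon k (block_weight k V0 y))) m" by simp
  qed
  finally have *: "coeff (family_sum c U) m = (\<Sum>V0\<in>?T. fact (card U - card V0) *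
      (\<Sum>y\<in>blocks e0 k V0. coeff (monomial_series (dilate_mon k (block_weight k V0 y))) m))"
    by (simp add: sum_distrib_left)
  show "coeff (family_sum c U) m = (if mdeg vdeg m = card U then fact (card U) * coeff (dilate k cycle_series) m else 0)"
  proof (cases "m \<in> range (dilate_mon k)")
    case False
    then have "coeff (monomial_series (dilate_mon k w)) m = 0" for w by (auto simp: coeff_monomial_series)
    then show ?thesis unfolding * using coeff_dilate(2)[OF k False] by simp
  next
    case True
    then obtain n where m: "m = dilate_mon k n" by blast
    have "coeff (monomial_series (dilate_mon k w)) m = coeff (monomial_series w) n" for w
      unfolding m coeff_monomial_series using inj_eq[OF inj_dilate_mon[OF k]] by simp
    then have "coeff (family_sum c U) m = (\<Sum>V0\<in>?T. fact (card U - card V0) * coeff (block_sum e0 k V0) n)"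
      unfolding * block_sum_def by simp
    also have "\<dots> = (\<Sum>V0\<in>?T. if mdeg vdeg n = card V0 then fact (card U - card V0) * (fact (card V0) * coeff cycle_series n) else 0)"
    proof (rule sum.cong[OF refl])
      fix V0 assume "V0 \<in> ?T"
      then have "finite V0" "V0 \<inter> A = {}" using fU UA finite_subset[of V0 U] by auto
      then have "coeff (block_sum e0 k V0) n = (if mdeg vdeg n = card V0 then fact (card V0) * coeff cycle_series n else 0)"
        using egf_block_sum unfolding egf_on_def by blast
      then show "fact (card U - card V0) * coeff (block_sum e0 k V0) n =
        (if mdeg vdeg n = card V0 then fact (card U - card V0) * (fact (card V0) * coeff cycle_series n) else 0)" by simp
    qed
    also have "\<dots> = (if mdeg vdeg m = card U then fact (card U) * coeff cycle_series n else 0)"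
    proof (cases "mdeg vdeg m = card U")
      case False
      then have "mdeg vdeg n \<noteq> card V0" if "V0 \<in> ?T" for V0 using that m mdeg_dilate_mon by auto
      then show ?thesis using False by simp
    next
      case True
      let ?l = "mdeg vdeg n"
      have kl: "k * ?l = card U" using True m mdeg_dilate_mon by simp
      then have le: "?l \<le> card U" using k by (metis One_nat_def Suc_leI mult.commute mult_le_mono2 nat_mult_1_right)
      have T: "V0 \<in> ?T \<longleftrightarrow> V0 \<subseteq> U \<and> card V0 = ?l" for V0 unfolding mem_Collect_eq kl[symmetric] using k by simp
      have "(\<Sum>V0\<in>?T. if ?l = card V0 then fact (card U - card V0) * (fact (card V0) * coeff cycle_series n) else 0) =
        (\<Sum>V0\<in>{V0. V0 \<subseteq> U \<and> card V0 = ?l}. fact (card U - ?l) * (fact ?l * coeff cycle_series n))"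
        by (rule sum.cong) (use T in auto)
      also have "\<dots> = of_nat (card U choose ?l) * (fact (card U - ?l) * (fact ?l * coeff cycle_series n))"
        by (simp add: n_subsets[OF fU])
      also have "\<dots> = of_nat (fact ?l * fact (card U - ?l) * (card U choose ?l)) * coeff cycle_series n"
        by (simp add: mult.commute mult.left_commute)
      also have "fact ?l * fact (card U - ?l) * (card U choose ?l) = fact (card U)"
        by (rule binomial_fact_lemma[OF le])
      finally show ?thesis using True by simp
    qed
    finally show ?thesis using coeff_dilate(1)[OF k] m by simp
  qed
qed

end

end

section \<open>Uniqueness of the decomposition\<close>

context core_aut
begin

text \<open>The part of \<open>families\<close> that does not mention a permutation. This is what
  has to be unique for a given graph and core.\<close>

definition decomposition :: "'a set set \<Rightarrow> 'a set \<Rightarrow> ('a set \<Rightarrow> 'a graph) \<Rightarrow> bool" where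
  "decomposition Z U H \<longleftrightarrow> H \<in> extensional Z \<and>
     (\<forall>e\<in>Z. netgraph \<N> e (H e) \<and> (verts (H e) - e) \<inter> A = {}) \<and>
     (\<forall>e\<in>Z. \<forall>e'\<in>Z. e \<noteq> e' \<longrightarrow> (verts (H e) - e) \<inter> (verts (H e') - e') = {}) \<and>
     (\<Union>e\<in>Z. verts (H e) - e) = U"

lemma families_iff:
  "(H, \<sigma>) \<in> families Z U \<longleftrightarrow> decomposition Z U H \<and> \<sigma> permutes U \<and> (\<forall>e\<in>Z. relabel (\<tau> \<circ> \<sigma>) (H e) = H (\<tau> ` e))"
  by (auto simp: families_def decomposition_def)

context
  fixes Z U \<mu>
  assumes Z: "\<And>e. e \<in> Z \<Longrightarrow> e \<subseteq> A \<and> card e = 2" and UA: "U \<inter> A = {}"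
    and \<mu>: "\<And>e. e \<in> \<mu> \<Longrightarrow> e \<subseteq> A \<and> card e = 2" and \<mu>Z: "\<mu> \<inter> Z = {}"
begin

lemma decomposition_facts:
  assumes "decomposition Z U H" "e \<in> Z"
  shows "netgraph \<N> e (H e)" "simple_graph (H e)" "e \<subseteq> verts (H e)" "(verts (H e) - e) \<inter> A = {}" "verts (H e) - e \<subseteq> U" "verts (H e) \<inter> A = e"
proof -
  show n: "netgraph \<N> e (H e)" and d: "(verts (H e) - e) \<inter> A = {}" and "verts (H e) - e \<subseteq> U"
    using assms by (auto simp: decomposition_def)
  show "simple_graph (H e)" and v: "e \<subseteq> verts (H e)" using netgraph_simple[OF n] by auto
  show "verts (H e) \<inter> A = e" using v d Z[OF assms(2)] by blast
qed

lemma decomposition_owner: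
  assumes "decomposition Z U H" "e \<in> Z" "e' \<in> Z" "x \<in> verts (H e) - e" "x \<in> verts (H e')"
  shows "e' = e"
proof (rule ccontr)
  assume ne: "e' \<noteq> e"
  have "x \<notin> e'" using decomposition_facts(4)[OF assms(1,2)] assms(4) Z[OF assms(3)] by blast
  then have "x \<in> (verts (H e) - e) \<inter> (verts (H e') - e')" using assms(4,5) by blast
  moreover have "(verts (H e) - e) \<inter> (verts (H e') - e') = {}"
    using assms(1-3) ne unfolding decomposition_def by blast
  ultimately show False by blast
qed

text \<open>Matching edges join core vertices, and an internal vertex lies in its own network only;
  so all edges at that vertex belong to this network.\<close>

lemma decomposition_edge_at:
  assumes "decomposition Z U H" "e \<in> Z" "x \<in> verts (H e) - e" "x \<in> d" "d \<in> \<mu> \<union> (\<Union>e\<in>Z. edges (H e))"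
  shows "d \<in> edges (H e)"
proof -
  have "d \<notin> \<mu>" using \<mu> assms(3,4) decomposition_facts(4)[OF assms(1,2)] by blast
  then obtain e' where e': "e' \<in> Z" "d \<in> edges (H e')" using assms(5) by blast
  then have "x \<in> verts (H e')" using edge_subset[OF decomposition_facts(2)[OF assms(1)]] assms(4) by blast
  then have "e' = e" by (rule decomposition_owner[OF assms(1,2) e'(1) assms(3)])
  then show ?thesis using e'(2) by simp
qed

text \<open>Every internal vertex of a network is joined to either pole by a path avoiding the other
  pole, so the two poles can be read off from the component of an internal vertex.\<close>

lemma decomposition_poles:
  assumes H: "decomposition Z U H" and H': "decomposition Z U H'"
    and eq: "\<mu> \<union> (\<Union>e\<in>Z. edges (H e)) = \<mu> \<union> (\<Union>e\<in>Z. edges (H' e))"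
    and e: "e \<in> Z" "e' \<in> Z" and x: "x \<in> verts (H e) - e" "x \<in> verts (H' e') - e'"
    and e_eq: "e = {p, q}"
  shows "p \<in> e'"
proof -
  note f = decomposition_facts[OF H e(1)] and f' = decomposition_facts[OF H' e(2)]
  let ?J = "delete_vertex (join_poles (Network (H e) p q)) q"
  let ?r = "{(x, y). {x, y} \<in> edges ?J}"
  have "Network (H e) p q \<in> \<N>" using f(1) netgraph_iff[OF e_eq] by simp
  then have net: "is_network (Network (H e) p q)" by (rule network_species_network[OF \<N>])
  then have "graph_connected ?J" "p \<noteq> q" unfolding is_network_def two_connected_def by (auto simp: join_poles_def)
  moreover have "x \<in> verts ?J" "p \<in> verts ?J" using x e_eq \<open>p \<noteq> q\<close> f(3) by (auto simp: delete_vertex_def join_poles_def)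
  ultimately have path: "(x, p) \<in> ?r\<^sup>*" unfolding graph_connected_def by blast
  \<comment> \<open>Walk from \<open>x\<close> in the network at \<open>e\<close> with
    \<open>q\<close> deleted. Until a pole is met the walk stays internal to both networks, since
    all edges at an internal vertex belong to its network. The pole met is \<open>p\<close>; being a
    core vertex of the other network, it is a pole there too.\<close>
  have "p \<in> e' \<or> y \<in> (verts (H e) - e) \<inter> (verts (H' e') - e')" if "(x, y) \<in> ?r\<^sup>*" for y
    using that
  proof (induction rule: rtrancl_induct)
    case base
    then show ?case using x by blast
  next
    case (step y z)
    show ?case
    proof (cases "p \<in> e'")
      case False
      then have y: "y \<in> verts (H e) - e" "y \<in> verts (H' e') - e'" using step.IH by auto
      have yz: "{y, z} \<in> edges (H e)" "z \<noteq> q"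
        using step.hyps(2) by (auto simp: delete_vertex_def join_poles_def)
      then have "{y, z} \<in> \<mu> \<union> (\<Union>e\<in>Z. edges (H' e))" using eq e(1) by blast
      then have yz': "{y, z} \<in> edges (H' e')"
        by (intro decomposition_edge_at[OF H' e(2) y(2), of "{y, z}"]) simp_all
      have zv: "z \<in> verts (H e)" "z \<in> verts (H' e')"
        using edge_subset[OF f(2) yz(1)] edge_subset[OF f'(2) yz'] by auto
      show ?thesis
      proof (cases "z \<in> e")
        case True
        then have "z = p" using yz(2) e_eq by blast
        moreover have "z \<in> e'" using zv(2) True Z[OF e(1)] f'(6) by blast
        ultimately show ?thesis by simp
      next
        case False
        then have "z \<in> U" using zv(1) f(5) by blast
        then have "z \<notin> e'" using UA Z[OF e(2)] by blast
        then show ?thesis using zv False by blast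
      qed
    qed simp
  qed
  from this[OF path] show ?thesis using e_eq by blast
qed

text \<open>An internal vertex of the network at \<open>e\<close> is internal to the second family's
  network at some \<open>e'\<close>. Both ends of \<open>e\<close> then lie in \<open>e'\<close>, so
  the two edges coincide.\<close>

lemma decomposition_int_subset:
  assumes H: "decomposition Z U H" and H': "decomposition Z U H'"
    and eq: "\<mu> \<union> (\<Union>e\<in>Z. edges (H e)) = \<mu> \<union> (\<Union>e\<in>Z. edges (H' e))" and e: "e \<in> Z"
  shows "verts (H e) - e \<subseteq> verts (H' e) - e"
proof
  fix x assume x: "x \<in> verts (H e) - e"
  then have "x \<in> U" using decomposition_facts(5)[OF H e] by blast
  then obtain e' where e': "e' \<in> Z" "x \<in> verts (H' e') - e'" using H' unfolding decomposition_def by blast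
  obtain p q where pq: "e = {p, q}" using Z[OF e] by (meson card_2_iff)
  have "p \<in> e'" by (rule decomposition_poles[OF H H' eq e e'(1) x e'(2) pq])
  moreover have "q \<in> e'" by (rule decomposition_poles[OF H H' eq e e'(1) x e'(2), of q p]) (use pq in auto)
  ultimately have "e \<subseteq> e'" using pq by simp
  moreover have "card e = 2" "card e' = 2" using Z e e'(1) by auto
  ultimately have "e = e'" by (metis card.infinite card_subset_eq zero_neq_numeral)
  then show "x \<in> verts (H' e) - e" using e'(2) by simp
qed

text \<open>An edge with an internal end is settled by \<open>decomposition_edge_at\<close>.
  Otherwise the edge is \<open>e\<close> itself; not being a matching edge it belongs to some
  network, and the only core vertices of a network are its own poles.\<close>

lemma decomposition_edges_subset:
  assumes H: "decomposition Z U H" and H': "decomposition Z U H'"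
    and eq: "\<mu> \<union> (\<Union>e\<in>Z. edges (H e)) = \<mu> \<union> (\<Union>e\<in>Z. edges (H' e))" and e: "e \<in> Z"
  shows "edges (H e) \<subseteq> edges (H' e)"
proof
  fix d assume d: "d \<in> edges (H e)"
  have dG: "d \<in> \<mu> \<union> (\<Union>e\<in>Z. edges (H' e))" using d e eq by blast
  have dv: "d \<subseteq> verts (H e)" "card d = 2"
    using edge_subset[OF decomposition_facts(2)[OF H e] d] edge_card[OF decomposition_facts(2)[OF H e] d] by auto
  show "d \<in> edges (H' e)"
  proof (cases "d \<subseteq> e")
    case False
    then obtain x where x: "x \<in> d" "x \<in> verts (H e) - e" using dv by blast
    then have "x \<in> verts (H' e) - e" using decomposition_int_subset[OF H H' eq e] by blast
    then show ?thesis using decomposition_edge_at[OF H' e _ x(1) dG] by blast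
  next
    case True
    have subset_eq: "d = c" if "d \<subseteq> c" "card c = 2" for c
      using that dv(2) by (metis card.infinite card_subset_eq zero_neq_numeral)
    have de: "d = e" using subset_eq[OF True] Z[OF e] by simp
    then have "d \<notin> \<mu>" using e \<mu>Z by blast
    then obtain e'' where e'': "e'' \<in> Z" "d \<in> edges (H' e'')" using dG by blast
    have "d \<subseteq> verts (H' e'') \<inter> A"
      using edge_subset[OF decomposition_facts(2)[OF H' e''(1)] e''(2)] de Z[OF e] by blast
    then have "d \<subseteq> e''" using decomposition_facts(6)[OF H' e''(1)] by simp
    then have "d = e''" using subset_eq Z[OF e''(1)] by blast
    then show ?thesis using e''(2) de by simp
  qed
qed

lemma decomposition_unique:
  assumes H: "decomposition Z U H" and H': "decomposition Z U H'"
    and eq: "\<mu> \<union> (\<Union>e\<in>Z. edges (H e)) = \<mu> \<union> (\<Union>e\<in>Z. edges (H' e))"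
  shows "H = H'"
proof (rule extensionalityI[of _ Z])
  show "H \<in> extensional Z" "H' \<in> extensional Z" using H H' by (auto simp: decomposition_def)
  fix e assume e: "e \<in> Z"
  have "verts (H e) - e = verts (H' e) - e"
    using decomposition_int_subset[OF H H' eq e] decomposition_int_subset[OF H' H eq[symmetric] e] by (rule subset_antisym)
  then have "verts (H e) = verts (H' e)"
    using decomposition_facts(3)[OF H e] decomposition_facts(3)[OF H' e] by blast
  moreover have "edges (H e) = edges (H' e)"
    using decomposition_edges_subset[OF H H' eq e] decomposition_edges_subset[OF H' H eq[symmetric] e] by (rule subset_antisym)
  ultimately show "H e = H' e" by (rule graph_eqI)
qed

text \<open>A matching edge inside a network would have core vertices as ends, hence would be the
  substituted edge, which is unmatched.\<close>

lemma decomposition_edge_not_matching: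
  assumes "decomposition Z U H" "e \<in> Z" "d \<in> edges (H e)"
  shows "d \<notin> \<mu>"
proof
  assume d: "d \<in> \<mu>"
  have "d \<subseteq> verts (H e) \<inter> A"
    using edge_subset[OF decomposition_facts(2)[OF assms(1,2)] assms(3)] \<mu>[OF d] by blast
  then have "d \<subseteq> e" using decomposition_facts(6)[OF assms(1,2)] by simp
  moreover have "card d = 2" "card e = 2" using \<mu>[OF d] Z[OF assms(2)] by auto
  ultimately have "d = e" by (metis card.infinite card_subset_eq zero_neq_numeral)
  then show False using d assms(2) \<mu>Z by blast
qed

end

text \<open>Meant for an automorphism of the whole graph: the transported family is again a
  decomposition and can be compared with the original by uniqueness.\<close>

lemma decomposition_relabel:
  assumes H: "decomposition Z U H" and "bij \<pi>" and "\<pi> ` A = A" "\<pi> ` U = U" "(`) \<pi> ` Z = Z"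
  shows "decomposition Z U (restrict (\<lambda>e. relabel \<pi> (H (inv \<pi> ` e))) Z)"
proof -
  have i: "inj \<pi>" using assms(2) by (rule bij_is_inj)
  let ?K = "restrict (\<lambda>e. relabel \<pi> (H (inv \<pi> ` e))) Z"
  have ex: "\<exists>d\<in>Z. e = \<pi> ` d" if "e \<in> Z" for e using that assms(5) by blast
  have im: "\<pi> ` d \<in> Z" if "d \<in> Z" for d using that assms(5) by blast
  have K: "?K (\<pi> ` d) = relabel \<pi> (H d)" if "d \<in> Z" for d
    using im[OF that] by (simp add: image_inv_f_f[OF i])
  have Kv: "verts (?K (\<pi> ` d)) - \<pi> ` d = \<pi> ` (verts (H d) - d)" if "d \<in> Z" for d
    unfolding K[OF that] verts_relabel by (rule image_set_diff[OF i, symmetric])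
  have 1: "netgraph \<N> e (?K e) \<and> (verts (?K e) - e) \<inter> A = {}" if e: "e \<in> Z" for e
  proof -
    obtain d where d: "d \<in> Z" "e = \<pi> ` d" using ex[OF e] by blast
    have "netgraph \<N> d (H d)" "(verts (H d) - d) \<inter> A = {}" using H d(1) by (auto simp: decomposition_def)
    then have "netgraph \<N> e (?K e)" "\<pi> ` ((verts (H d) - d) \<inter> A) = {}"
      using netgraph_relabel[OF _ i, of d "H d"] K[OF d(1)] d(2) by auto
    moreover have "\<pi> ` ((verts (H d) - d) \<inter> A) = (verts (?K e) - e) \<inter> A"
      unfolding image_Int[OF i] d(2) Kv[OF d(1)] assms(3) ..
    ultimately show ?thesis by simp
  qed
  have 2: "(verts (?K e) - e) \<inter> (verts (?K e') - e') = {}" if e: "e \<in> Z" "e' \<in> Z" "e \<noteq> e'" for e e'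
  proof -
    obtain d where d: "d \<in> Z" "e = \<pi> ` d" using ex[OF e(1)] by blast
    obtain d' where d': "d' \<in> Z" "e' = \<pi> ` d'" using ex[OF e(2)] by blast
    have "d \<noteq> d'" using d(2) d'(2) e(3) by blast
    then have "(verts (H d) - d) \<inter> (verts (H d') - d') = {}" using H d(1) d'(1) unfolding decomposition_def by blast
    then show ?thesis unfolding d(2) d'(2) Kv[OF d(1)] Kv[OF d'(1)] image_Int[OF i, symmetric] by simp
  qed
  have "(\<Union>e\<in>Z. verts (?K e) - e) = (\<Union>e\<in>(`) \<pi> ` Z. verts (?K e) - e)" unfolding assms(5) ..
  also have "\<dots> = (\<Union>d\<in>Z. \<pi> ` (verts (H d) - d))"
    unfolding image_image by (rule SUP_cong[OF refl]) (rule Kv)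
  also have "\<dots> = \<pi> ` U" using H unfolding decomposition_def by (metis image_UN)
  finally have 3: "(\<Union>e\<in>Z. verts (?K e) - e) = U" using assms(4) by simp
  have "?K \<in> extensional Z" by simp
  then show ?thesis unfolding decomposition_def using 1 2 3 by blast
qed

end

section \<open>Assembling a graph from a core and a family of networks\<close>

context core_aut
begin

text \<open>Networks with ordered poles against graphs at unordered edges: in one direction the
  order is forgotten, in the other an admissible order is chosen for each edge.\<close>

lemma edge_substitution_iff_decomposition:
  assumes G0: "simple_graph G\<^sub>0" "verts G\<^sub>0 = A" "is_matching G\<^sub>0 \<mu>"
  shows "(\<exists>N. substitution_family \<N> G\<^sub>0 \<mu> G N) \<longleftrightarrow> A \<subseteq> verts G \<and>
    (\<exists>H. decomposition (edges G\<^sub>0 - \<mu>) (verts G - A) H \<and> edges G = \<mu> \<union> (\<Union>e\<in>edges G\<^sub>0 - \<mu>. edges (H e)))"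
proof
  let ?Z = "edges G\<^sub>0 - \<mu>"
  assume "\<exists>N. substitution_family \<N> G\<^sub>0 \<mu> G N"
  then obtain N where N: "substitution_family \<N> G\<^sub>0 \<mu> G N" by blast
  have Ne: "N e \<in> \<N>" "{pole0 (N e), pole1 (N e)} = e" "internal (N e) \<inter> A = {}" if "e \<in> ?Z" for e
    using N that G0(2) by (auto simp: substitution_family_def)
  have dis: "internal (N e) \<inter> internal (N e') = {}" if "e \<in> ?Z" "e' \<in> ?Z" "e \<noteq> e'" for e e'
    using N that unfolding substitution_family_def by blast
  have v: "verts G = A \<union> (\<Union>e\<in>?Z. internal (N e))" and ed: "edges G = \<mu> \<union> (\<Union>e\<in>?Z. edges (net_graph (N e)))"
    using N G0(2) by (auto simp: substitution_family_def)
  define H where "H = restrict (\<lambda>e. net_graph (N e)) ?Z"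
  have He: "H e = net_graph (N e)" if "e \<in> ?Z" for e using that by (simp add: H_def)
  have Hi: "verts (H e) - e = internal (N e)" if "e \<in> ?Z" for e
    unfolding He[OF that] internal_def Ne(2)[OF that] ..
  have "netgraph \<N> e (H e)" if "e \<in> ?Z" for e
    unfolding netgraph_def He[OF that]
    by (intro exI[of _ "pole0 (N e)"] exI[of _ "pole1 (N e)"]) (use Ne[OF that] in simp)
  moreover have "(\<Union>e\<in>?Z. verts (H e) - e) = verts G - A"
  proof -
    have "(\<Union>e\<in>?Z. verts (H e) - e) = (\<Union>e\<in>?Z. internal (N e))" by (rule SUP_cong[OF refl Hi])
    also have "\<dots> = verts G - A" unfolding v using Ne(3) by blast
    finally show ?thesis .
  qed
  moreover have "H \<in> extensional ?Z" by (simp add: H_def)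
  ultimately have "decomposition ?Z (verts G - A) H"
    unfolding decomposition_def using Hi Ne(3) dis by simp
  moreover have "edges G = \<mu> \<union> (\<Union>e\<in>?Z. edges (H e))" unfolding ed using He by simp
  ultimately show "A \<subseteq> verts G \<and> (\<exists>H. decomposition ?Z (verts G - A) H \<and> edges G = \<mu> \<union> (\<Union>e\<in>?Z. edges (H e)))"
    using v by blast
next
  let ?Z = "edges G\<^sub>0 - \<mu>"
  assume "A \<subseteq> verts G \<and> (\<exists>H. decomposition ?Z (verts G - A) H \<and> edges G = \<mu> \<union> (\<Union>e\<in>?Z. edges (H e)))"
  then obtain H where AG: "A \<subseteq> verts G" and H: "decomposition ?Z (verts G - A) H" and ed: "edges G = \<mu> \<union> (\<Union>e\<in>?Z. edges (H e))" by blast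
  have "\<forall>e\<in>?Z. \<exists>N. N \<in> \<N> \<and> net_graph N = H e \<and> {pole0 N, pole1 N} = e"
  proof
    fix e assume "e \<in> ?Z"
    then have "netgraph \<N> e (H e)" using H by (auto simp: decomposition_def)
    then obtain p q where "e = {p, q}" "Network (H e) p q \<in> \<N>" by (auto simp: netgraph_def)
    then show "\<exists>N. N \<in> \<N> \<and> net_graph N = H e \<and> {pole0 N, pole1 N} = e" by (intro exI[of _ "Network (H e) p q"]) simp
  qed
  then obtain N where N: "\<And>e. e \<in> ?Z \<Longrightarrow> N e \<in> \<N> \<and> net_graph (N e) = H e \<and> {pole0 (N e), pole1 (N e)} = e"
    using bchoice[of ?Z "\<lambda>e N. N \<in> \<N> \<and> net_graph N = H e \<and> {pole0 N, pole1 N} = e"] by blast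
  have Ni: "internal (N e) = verts (H e) - e" if "e \<in> ?Z" for e
    unfolding internal_def using N[OF that] by simp
  have u: "(\<Union>e\<in>?Z. internal (N e)) = verts G - A"
  proof -
    have "(\<Union>e\<in>?Z. internal (N e)) = (\<Union>e\<in>?Z. verts (H e) - e)" by (rule SUP_cong[OF refl Ni])
    then show ?thesis using H unfolding decomposition_def by simp
  qed
  have dis: "internal (N e) \<inter> internal (N e') = {}" if "e \<in> ?Z" "e' \<in> ?Z" "e \<noteq> e'" for e e'
    unfolding Ni[OF that(1)] Ni[OF that(2)] using H that unfolding decomposition_def by blast
  have ia: "internal (N e) \<inter> A = {}" if "e \<in> ?Z" for e
    unfolding Ni[OF that] using H that unfolding decomposition_def by blast
  have "edges G = \<mu> \<union> (\<Union>e\<in>?Z. edges (net_graph (N e)))" unfolding ed using N by simp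
  moreover have "verts G = A \<union> (\<Union>e\<in>?Z. internal (N e))" unfolding u using AG by blast
  ultimately have "substitution_family \<N> G\<^sub>0 \<mu> G N"
    unfolding substitution_family_def G0(2) by (intro conjI ballI impI dis ia) (simp_all add: N)
  then show "\<exists>N. substitution_family \<N> G\<^sub>0 \<mu> G N" by blast
qed

context
  fixes G\<^sub>0 \<mu> V
  assumes G0: "simple_graph G\<^sub>0" "verts G\<^sub>0 = A" and \<tau>aut: "\<tau> \<in> graph_auts G\<^sub>0" and \<mu>: "\<mu> \<in> fixed_matchings G\<^sub>0 \<tau>"
    and V: "finite V" "A \<subseteq> V"
begin

lemma core_pairs: "e \<in> edges G\<^sub>0 - \<mu> \<Longrightarrow> e \<subseteq> A \<and> card e = 2" "e \<in> \<mu> \<Longrightarrow> e \<subseteq> A \<and> card e = 2"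
  using edge_subset[OF G0(1)] edge_card[OF G0(1)] G0(2) matching_invariant(3)[OF \<tau>aut \<mu>] by blast+

lemma core_invariant: "invariant (edges G\<^sub>0 - \<mu>)"
  unfolding invariant_def using core_pairs(1) matching_invariant(2)[OF \<tau>aut \<mu>] by blast

lemma core_UA: "(V - A) \<inter> A = {}" by blast

lemma core_\<mu>Z: "\<mu> \<inter> (edges G\<^sub>0 - \<mu>) = {}" by blast

lemma core_matching: "is_matching G\<^sub>0 \<mu>" using \<mu> by (simp add: fixed_matchings_def)

definition "assembled H = Graph V (\<mu> \<union> (\<Union>e\<in>edges G\<^sub>0 - \<mu>. edges (H e)))" for H :: "'a set \<Rightarrow> 'a graph"

context
  fixes H \<sigma>
  assumes mem: "(H, \<sigma>) \<in> families (edges G\<^sub>0 - \<mu>) (V - A)"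
begin

lemmas assembled_F = mem core_invariant core_UA

lemma assembled_decomposition: "decomposition (edges G\<^sub>0 - \<mu>) (V - A) H"
  using mem by (simp add: families_iff)

lemma assembled_total: "(\<tau> \<circ> \<sigma>) permutes V"
  by (rule permutes_compose[OF permutes_subset[OF family_sigma[OF assembled_F]] permutes_subset[OF \<tau>]]) (use V in auto)

lemma assembled_image_matching: "(`) (\<tau> \<circ> \<sigma>) ` \<mu> = \<mu>"
proof -
  have "(\<tau> \<circ> \<sigma>) ` e = \<tau> ` e" if "e \<in> \<mu>" for e
    by (rule total_image_A[OF assembled_F]) (use core_pairs(2)[OF that] in blast)
  then have "(`) (\<tau> \<circ> \<sigma>) ` \<mu> = (`) \<tau> ` \<mu>" by (rule image_cong[OF refl])
  then show ?thesis using matching_invariant(1)[OF \<tau>aut \<mu>] by simp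
qed

lemma assembled_image_edges:
  "(`) (\<tau> \<circ> \<sigma>) ` (\<Union>e\<in>edges G\<^sub>0 - \<mu>. edges (H e)) = (\<Union>e\<in>edges G\<^sub>0 - \<mu>. edges (H e))"
  by (rule family_edges_invariant[OF assembled_F subset_refl matching_invariant(2)[OF \<tau>aut \<mu>]])

lemma assembled_aut: "\<tau> \<circ> \<sigma> \<in> cored_auts (assembled H, G\<^sub>0, \<mu>)"
proof -
  have "relabel (\<tau> \<circ> \<sigma>) (assembled H) = assembled H"
    by (rule graph_eqI)
      (simp_all only: assembled_def verts_relabel edges_relabel graph.sel permutes_image[OF assembled_total]
        image_Un assembled_image_matching assembled_image_edges)
  moreover have "relabel (\<tau> \<circ> \<sigma>) G\<^sub>0 = relabel \<tau> G\<^sub>0"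
    by (rule relabel_cong[OF G0(1)]) (use total_A[OF assembled_F] G0(2) in simp)
  then have "relabel (\<tau> \<circ> \<sigma>) G\<^sub>0 = G\<^sub>0" using \<tau>aut by (simp add: graph_auts_eq)
  ultimately show ?thesis
    using assembled_total assembled_image_matching by (simp add: cored_auts_eq) (simp add: assembled_def)
qed

lemma assembled_substitution: "\<exists>N. substitution_family \<N> G\<^sub>0 \<mu> (assembled H) N"
  unfolding edge_substitution_iff_decomposition[OF G0 core_matching]
  using V(2) assembled_decomposition by (auto simp: assembled_def)

text \<open>Vertices split into core and internal ones, edges into matching and network edges, and
  all these sets are invariant. The total permutation is \<tau> on the core and \<sigma> on internal
  vertices.\<close>

lemma assembled_weight:
  assumes sg: "simple_graph (assembled H)"
  shows "walsh_weight (assembled H) (\<tau> \<circ> \<sigma>) =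
    vweight A \<tau> + eweight \<mu> \<tau> + family_weight (edges G\<^sub>0 - \<mu>) (V - A) (H, \<sigma>)"
proof -
  let ?E = "\<Union>e\<in>edges G\<^sub>0 - \<mu>. edges (H e)"
  have rel: "relabel (\<tau> \<circ> \<sigma>) (assembled H) = assembled H" using assembled_aut by (simp add: cored_auts_eq)
  have inj: "inj (\<tau> \<circ> \<sigma>)" by (rule permutes_inj[OF assembled_total])
  have tA: "\<tau> ` A = A" by (rule permutes_image[OF \<tau>])
  have sU: "\<sigma> ` (V - A) = V - A" by (rule permutes_image[OF family_sigma[OF assembled_F]])
  have iA: "(\<tau> \<circ> \<sigma>) ` A = A" using total_image_A[OF assembled_F subset_refl] tA by simp
  have iU: "(\<tau> \<circ> \<sigma>) ` (V - A) = V - A" using total_image_U[OF assembled_F subset_refl] sU by simp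
  have "walsh_weight (assembled H) (\<tau> \<circ> \<sigma>) = vweight V (\<tau> \<circ> \<sigma>) + eweight (\<mu> \<union> ?E) (\<tau> \<circ> \<sigma>)"
    using walsh_weight_eq[OF inj sg] relabel_fixed[OF rel] by (simp add: assembled_def)
  also have "vweight V (\<tau> \<circ> \<sigma>) = vweight A (\<tau> \<circ> \<sigma>) + vweight (V - A) (\<tau> \<circ> \<sigma>)"
  proof -
    have "V = A \<union> (V - A)" using V(2) by blast
    moreover have "vweight (A \<union> (V - A)) (\<tau> \<circ> \<sigma>) = vweight A (\<tau> \<circ> \<sigma>) + vweight (V - A) (\<tau> \<circ> \<sigma>)"
      unfolding vweight_def by (rule cyc_sum_Un) (use finA V(1) iA iU in \<open>simp_all only: subset_refl finite_Diff Diff_disjoint\<close>)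
    ultimately show ?thesis by simp
  qed
  also have "vweight A (\<tau> \<circ> \<sigma>) = vweight A \<tau>"
    by (rule vweight_cong) (use tA total_A[OF assembled_F] in \<open>simp_all only: subset_refl\<close>)
  also have "vweight (V - A) (\<tau> \<circ> \<sigma>) = vweight (V - A) \<sigma>"
    by (rule vweight_cong) (use sU total_U[OF assembled_F] in \<open>simp_all only: subset_refl\<close>)
  also have "eweight (\<mu> \<union> ?E) (\<tau> \<circ> \<sigma>) = eweight \<mu> (\<tau> \<circ> \<sigma>) + eweight ?E (\<tau> \<circ> \<sigma>)"
    unfolding eweight_def
  proof (rule cyc_sum_Un)
    have "finite (edges (assembled H))" by (rule simple_graph_finite_edges[OF sg])
    then show "finite \<mu>" "finite ?E" by (simp_all add: assembled_def)
    show "\<mu> \<inter> ?E = {}"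
      using decomposition_edge_not_matching[OF core_pairs(1) core_UA core_pairs(2) core_\<mu>Z assembled_decomposition] by blast
  qed (simp_all only: assembled_image_matching assembled_image_edges subset_refl)
  also have "eweight \<mu> (\<tau> \<circ> \<sigma>) = eweight \<mu> \<tau>"
  proof (rule eweight_cong)
    fix x assume "x \<in> \<Union>\<mu>"
    then have "x \<in> A" using core_pairs(2) by blast
    then show "(\<tau> \<circ> \<sigma>) x = \<tau> x" by (rule total_A[OF assembled_F])
  qed (simp only: matching_invariant(1)[OF \<tau>aut \<mu>] subset_refl)
  finally show ?thesis by (simp only: family_weight_def case_prod_conv ac_simps)
qed

end

lemma assembled_unique:
  assumes "decomposition (edges G\<^sub>0 - \<mu>) (V - A) H" "decomposition (edges G\<^sub>0 - \<mu>) (V - A) H'" "assembled H = assembled H'"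
  shows "H = H'"
  by (rule decomposition_unique[OF core_pairs(1) core_UA core_pairs(2) core_\<mu>Z assms(1,2)])
    (use assms(3) in \<open>simp_all add: assembled_def\<close>)

text \<open>An automorphism of the cored graph carries the decomposition to another decomposition of
  the same graph. By uniqueness the two agree, which says that the automorphism permutes the
  networks.\<close>

lemma families_of_aut:
  assumes H: "decomposition (edges G\<^sub>0 - \<mu>) (V - A) H" and aut: "\<pi> \<in> cored_auts (assembled H, G\<^sub>0, \<mu>)"
    and ag: "\<And>x. x \<in> A \<Longrightarrow> \<pi> x = \<tau> x"
  shows "(H, \<lambda>x. if x \<in> V - A then \<pi> x else x) \<in> families (edges G\<^sub>0 - \<mu>) (V - A)"
    and "\<tau> \<circ> (\<lambda>x. if x \<in> V - A then \<pi> x else x) = \<pi>"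
proof -
  let ?Z = "edges G\<^sub>0 - \<mu>" and ?s = "\<lambda>x. if x \<in> V - A then \<pi> x else x"
  have p: "\<pi> permutes V" and r: "relabel \<pi> (assembled H) = assembled H" and m: "(`) \<pi> ` \<mu> = \<mu>"
    using aut by (auto simp: cored_auts_eq assembled_def)
  have b: "bij \<pi>" and i: "inj \<pi>" using permutes_bij[OF p] permutes_inj[OF p] .
  have tA: "\<tau> ` A = A" by (rule permutes_image[OF \<tau>])
  have pA: "\<pi> ` A = A" using ag tA by simp
  have pU: "\<pi> ` (V - A) = V - A" using image_set_diff[OF i, of V A] permutes_image[OF p] pA by simp
  have s: "?s permutes (V - A)" by (rule restrict_permutes[OF i pU])
  show c: "\<tau> \<circ> ?s = \<pi>"
  proof
    fix x
    consider "x \<in> A" | "x \<in> V - A" | "x \<notin> V" using V(2) by blast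
    then show "(\<tau> \<circ> ?s) x = \<pi> x"
    proof cases
      case 2
      then have "\<pi> x \<in> V - A" using pU by blast
      then show ?thesis using 2 permutes_not_in[OF \<tau>, of "\<pi> x"] by simp
    next
      case 3
      then show ?thesis using permutes_not_in[OF \<tau>, of x] permutes_not_in[OF p, of x] V(2) by auto
    qed (use ag in simp)
  qed
  have pe: "\<pi> ` e = \<tau> ` e" if "e \<subseteq> A" for e by (rule image_cong[OF refl]) (use ag that in blast)
  have "(`) \<pi> ` ?Z = (`) \<tau> ` ?Z" by (rule image_cong[OF refl]) (use pe core_pairs(1) in blast)
  then have pZ: "(`) \<pi> ` ?Z = ?Z" using matching_invariant(2)[OF \<tau>aut \<mu>] by simp
  let ?K = "restrict (\<lambda>e. relabel \<pi> (H (inv \<pi> ` e))) ?Z"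
  have K: "decomposition ?Z (V - A) ?K" by (rule decomposition_relabel[OF H b pA pU pZ])
  have Ke: "?K (\<pi> ` e) = relabel \<pi> (H e)" if "e \<in> ?Z" for e
  proof -
    have "\<pi> ` e \<in> ?Z" using pZ that by blast
    then show ?thesis by (simp add: image_inv_f_f[OF i])
  qed
  have "(\<Union>e\<in>?Z. edges (?K e)) = (\<Union>e\<in>(`) \<pi> ` ?Z. edges (?K e))" unfolding pZ ..
  also have "\<dots> = (\<Union>e\<in>?Z. (`) \<pi> ` edges (H e))" unfolding image_image by (rule SUP_cong[OF refl]) (simp only: Ke edges_relabel)
  also have "\<dots> = (`) \<pi> ` (\<Union>e\<in>?Z. edges (H e))" by (rule image_UN[symmetric])
  finally have "\<mu> \<union> (\<Union>e\<in>?Z. edges (?K e)) = (`) \<pi> ` (\<mu> \<union> (\<Union>e\<in>?Z. edges (H e)))" using m by (simp only: image_Un)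
  also have "\<dots> = \<mu> \<union> (\<Union>e\<in>?Z. edges (H e))" using relabel_fixed(2)[OF r] by (simp only: assembled_def graph.sel)
  finally have "assembled ?K = assembled H" by (simp only: assembled_def)
  then have "?K = H" using assembled_unique[OF K H] by simp
  then have "relabel (\<tau> \<circ> ?s) (H e) = H (\<tau> ` e)" if "e \<in> ?Z" for e
    unfolding c using Ke[OF that] pe[of e] core_pairs(1)[OF that] by simp
  then show "(H, ?s) \<in> families ?Z (V - A)" unfolding families_iff using H s by blast
qed

end

end

section \<open>The substitution formula\<close>

lemma sum_Sigma_pair:
  "finite A \<Longrightarrow> (\<And>x. x \<in> A \<Longrightarrow> finite (B x)) \<Longrightarrow> (\<Sum>x\<in>A. \<Sum>y\<in>B x. f (x, y)) = (\<Sum>z\<in>Sigma A B. f z)"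
  by (subst sum.Sigma) (auto simp: case_prod_unfold)

lemma core_aut_graph:
  assumes "graph_species \<G>" "network_species \<N>" "symmetric_species \<N>" "G \<in> \<G>" "\<tau> \<in> graph_auts G"
  shows "core_aut \<N> (verts G) \<tau>"
  using assms simple_graph_finite[OF graph_species_simple[OF assms(1,4)]]
  by unfold_locales (auto simp: graph_auts_def)

lemma finite_fixed_matchings: "simple_graph G \<Longrightarrow> finite (fixed_matchings G \<sigma>)"
  by (rule finite_subset[of _ "Pow (edges G)"])
    (auto simp: fixed_matchings_def is_matching_def simple_graph_finite_edges)

text \<open>Pairs of a structure on \<open>V\<close> and an automorphism correspond to tuples of a
  core, a core automorphism, an invariant matching and a family: restriction to the core one way,
  assembly the other.\<close>

lemma structure_sum:
  fixes \<G> :: "'a graph set" and g :: "(walsh_var \<Rightarrow>\<^sub>0 nat) \<Rightarrow> rat"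
  assumes \<G>: "graph_species \<G>" and \<N>: "network_species \<N>" and sym: "symmetric_species \<N>" and V: "finite V"
  shows "(\<Sum>S\<in>{S\<in>edge_substitution \<G> \<N>. verts (fst S) = V}. \<Sum>\<sigma>\<in>cored_auts S. g (walsh_weight (fst S) \<sigma>)) =
    (\<Sum>G\<in>{G\<in>\<G>. verts G \<subseteq> V}. \<Sum>\<tau>\<in>graph_auts G. \<Sum>\<mu>\<in>fixed_matchings G \<tau>.
      \<Sum>x\<in>core_aut.families \<N> (verts G) \<tau> (edges G - \<mu>) (V - verts G).
        g (vweight (verts G) \<tau> + eweight \<mu> \<tau> + core_aut.family_weight \<tau> (edges G - \<mu>) (V - verts G) x))"
proof -
  let ?T = "{S\<in>edge_substitution \<G> \<N>. verts (fst S) = V}"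
  let ?G = "{G\<in>\<G>. verts G \<subseteq> V}"
  let ?F = "\<lambda>G \<tau> \<mu>. core_aut.families \<N> (verts G) \<tau> (edges G - \<mu>) (V - verts G)"
  let ?B2 = "\<lambda>G \<tau>. SIGMA \<mu>:fixed_matchings G \<tau>. ?F G \<tau> \<mu>"
  let ?B3 = "\<lambda>G. SIGMA \<tau>:graph_auts G. ?B2 G \<tau>"
  let ?B = "SIGMA G:?G. ?B3 G"
  let ?W = "\<lambda>(G, \<tau>, \<mu>, x). g (vweight (verts G) \<tau> + eweight \<mu> \<tau> + core_aut.family_weight \<tau> (edges G - \<mu>) (V - verts G) x)"
  note sg = graph_species_simple[OF \<G>]
  have core: "core_aut \<N> (verts G) \<tau>" if "G \<in> ?G" "\<tau> \<in> graph_auts G" for G \<tau>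
    using core_aut_graph[OF \<G> \<N> sym] that by blast
  have finG: "finite ?G" by (rule finite_subset[OF _ finite_simple_graphs[OF V]]) (use sg in auto)
  have finA: "finite (graph_auts G)" if "G \<in> ?G" for G using finite_graph_auts sg that by blast
  have finM: "finite (fixed_matchings G \<tau>)" if "G \<in> ?G" for G \<tau> using finite_fixed_matchings sg that by blast
  have finF: "finite (?F G \<tau> \<mu>)" if "G \<in> ?G" "\<tau> \<in> graph_auts G" "\<mu> \<in> fixed_matchings G \<tau>" for G \<tau> \<mu>
  proof -
    have s: "simple_graph G" using sg that(1) by blast
    show ?thesis
      by (rule core_aut.finite_families[OF core[OF that(1,2)] _
        core_aut.core_invariant[OF core[OF that(1,2)] s refl that(2,3) V]]) (use V that(1) in auto)
  qed
  \<comment> \<open>The decomposition is picked by choice; \<open>assembled_unique\<close>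
    identifies it, so that disassembling an assembled graph returns the family it came from.\<close>
  define dec where "dec G G0 \<mu> = (SOME H. core_aut.decomposition \<N> (verts G0) (edges G0 - \<mu>) (verts G - verts G0) H \<and>
     edges G = \<mu> \<union> (\<Union>e\<in>edges G0 - \<mu>. edges (H e)))" for G G0 :: "'a graph" and \<mu>
  have decI: "core_aut.decomposition \<N> (verts G0) (edges G0 - \<mu>) (verts G - verts G0) (dec G G0 \<mu>) \<and>
     edges G = \<mu> \<union> (\<Union>e\<in>edges G0 - \<mu>. edges (dec G G0 \<mu> e))"
    if "\<exists>H. core_aut.decomposition \<N> (verts G0) (edges G0 - \<mu>) (verts G - verts G0) H \<and>
     edges G = \<mu> \<union> (\<Union>e\<in>edges G0 - \<mu>. edges (H e))" for G G0 :: "'a graph" and \<mu>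
    unfolding dec_def by (rule someI_ex[OF that])
  define R where "R X \<sigma> = (\<lambda>x::'a. if x \<in> X then \<sigma> x else x)" for X and \<sigma> :: "'a \<Rightarrow> 'a"
  define j where "j = (\<lambda>((G, G0, \<mu>), \<sigma>). (G0, R (verts G0) \<sigma>, \<mu>, (dec G G0 \<mu>, R (V - verts G0) \<sigma>)))"
  define i where "i = (\<lambda>(G0 :: 'a graph, \<tau> :: 'a \<Rightarrow> 'a, \<mu>, (H :: 'a set \<Rightarrow> 'a graph, \<sigma> :: 'a \<Rightarrow> 'a)).
     ((core_aut.assembled G0 \<mu> V H, G0, \<mu>), \<tau> \<circ> \<sigma>))"
  have finC: "finite (cored_auts S)" if "S \<in> ?T" for S
    unfolding cored_auts_def by (rule finite_subset[OF _ finite_permutations[OF V]]) (use that in auto)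
  \<comment> \<open>The finiteness statement carries a degree condition on a monomial; the power of
    \<open>VA 1\<close> with exponent |V| fulfils it.\<close>
  have finT: "finite ?T"
    using coeff_walsh_substitution(2)[OF \<G> \<N> V, of "Poly_Mapping.single (VA 1) (card V)"] by (simp add: vdeg_def)
  have "(\<Sum>S\<in>?T. \<Sum>\<sigma>\<in>cored_auts S. g (walsh_weight (fst S) \<sigma>)) =
      (\<Sum>z\<in>Sigma ?T cored_auts. g (walsh_weight (fst (fst z)) (snd z)))"
    using sum_Sigma_pair[OF finT finC, where f="\<lambda>z. g (walsh_weight (fst (fst z)) (snd z))"] by simp
  also have "\<dots> = (\<Sum>z\<in>?B. ?W z)"
  proof (rule sum.reindex_bij_witness[where i = i and j = j])
    fix z assume "z \<in> Sigma ?T cored_auts"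
    then obtain G G0 \<mu> \<sigma> where z: "z = ((G, G0, \<mu>), \<sigma>)" and S: "(G, G0, \<mu>) \<in> edge_substitution \<G> \<N>"
      and GV: "verts G = V" and aut: "\<sigma> \<in> cored_auts (G, G0, \<mu>)" by (cases z) auto
    note ss = substitution_simple_graph[OF \<G> \<N> S]
    have G0: "G0 \<in> \<G>" "is_matching G0 \<mu>" and fam: "\<exists>N. substitution_family \<N> G0 \<mu> G N"
      using S unfolding edge_substitution_iff by auto
    let ?A = "verts G0"
    let ?t = "R ?A \<sigma>" and ?s = "R (V - ?A) \<sigma>"
    have p: "\<sigma> permutes V" and r: "relabel \<sigma> G0 = G0" and m: "(`) \<sigma> ` \<mu> = \<mu>"
      using aut GV by (auto simp: cored_auts_eq)
    have AV: "?A \<subseteq> V" using ss(3) GV by simp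
    have sA: "\<sigma> ` ?A = ?A" by (rule relabel_fixed(1)[OF r])
    have tp: "?t permutes ?A" unfolding R_def by (rule restrict_permutes[OF permutes_inj[OF p] sA])
    have "relabel ?t G0 = relabel \<sigma> G0" by (rule relabel_cong[OF ss(2)]) (simp add: R_def)
    then have ta: "?t \<in> graph_auts G0" using tp r by (simp add: graph_auts_eq)
    have "?t ` e = \<sigma> ` e" if "e \<in> \<mu>" for e
    proof (rule image_cong[OF refl])
      fix x assume "x \<in> e"
      then have "x \<in> ?A" using edge_subset[OF ss(2), of e] ss(4) that by blast
      then show "?t x = \<sigma> x" by (simp add: R_def)
    qed
    then have "(`) ?t ` \<mu> = (`) \<sigma> ` \<mu>" by (rule image_cong[OF refl])
    then have mu: "\<mu> \<in> fixed_matchings G0 ?t" using m G0(2) by (simp add: fixed_matchings_def)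
    have GG: "G0 \<in> ?G" using G0(1) AV by simp
    interpret core_aut \<N> ?A ?t by (rule core[OF GG ta])
    note C = ss(2) refl ta mu V AV
    have "\<exists>H. decomposition (edges G0 - \<mu>) (verts G - ?A) H \<and> edges G = \<mu> \<union> (\<Union>e\<in>edges G0 - \<mu>. edges (H e))"
      using fam unfolding edge_substitution_iff_decomposition[OF ss(2) refl G0(2)] by blast
    from decI[OF this] have dec: "decomposition (edges G0 - \<mu>) (V - ?A) (dec G G0 \<mu>)"
      and edG: "edges G = \<mu> \<union> (\<Union>e\<in>edges G0 - \<mu>. edges (dec G G0 \<mu> e))"
      unfolding GV by (rule conjunct1, rule conjunct2)
    have asm: "assembled G0 \<mu> V (dec G G0 \<mu>) = G"
      by (rule graph_eqI) (simp_all add: assembled_def[OF C] GV edG)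
    have aut': "\<sigma> \<in> cored_auts (assembled G0 \<mu> V (dec G G0 \<mu>), G0, \<mu>)" using aut asm by simp
    have ag: "\<sigma> x = ?t x" if "x \<in> ?A" for x using that by (simp add: R_def)
    note fo = families_of_aut[OF C dec aut' ag]
    have mem: "(dec G G0 \<mu>, ?s) \<in> families (edges G0 - \<mu>) (V - ?A)" unfolding R_def by (rule fo(1)[unfolded R_def]) 
    have tot: "?t \<circ> ?s = \<sigma>" using fo(2) unfolding R_def by simp
    show "i (j z) = z" unfolding z i_def j_def case_prod_conv asm tot ..
    show "j z \<in> ?B" unfolding z j_def case_prod_conv using GG ta mu mem by simp
    have "simple_graph (assembled G0 \<mu> V (dec G G0 \<mu>))" using ss(1) asm by simp
    from assembled_weight[OF C mem this]
    show "?W (j z) = g (walsh_weight (fst (fst z)) (snd z))"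
      unfolding z j_def case_prod_conv asm tot by simp
  next
    fix z assume zB: "z \<in> ?B"
    obtain G0 \<tau> \<mu> H \<sigma> where z: "z = (G0, \<tau>, \<mu>, (H, \<sigma>))" by (cases z) auto
    let ?A = "verts G0"
    have G0: "G0 \<in> ?G" and ta: "\<tau> \<in> graph_auts G0" and mu: "\<mu> \<in> fixed_matchings G0 \<tau>" and mem: "(H, \<sigma>) \<in> ?F G0 \<tau> \<mu>"
      using zB z by auto
    have s: "simple_graph G0" and AV: "?A \<subseteq> V" using sg G0 by auto
    interpret core_aut \<N> ?A \<tau> by (rule core[OF G0 ta])
    note C = s refl ta mu V AV
    have mt: "is_matching G0 \<mu>" using mu by (simp add: fixed_matchings_def)
    let ?H = "assembled G0 \<mu> V H"
    have S: "(?H, G0, \<mu>) \<in> edge_substitution \<G> \<N>"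
      unfolding edge_substitution_iff using G0 mt assembled_substitution[OF C mem] by simp
    have vH: "verts ?H = V" by (simp add: assembled_def[OF C])
    show "i z \<in> Sigma ?T cored_auts"
      unfolding z i_def case_prod_conv using S vH assembled_aut[OF C mem] by simp
    have d: "decomposition (edges G0 - \<mu>) (V - ?A) H" by (rule assembled_decomposition[OF C mem])
    have "\<exists>H'. decomposition (edges G0 - \<mu>) (verts ?H - ?A) H' \<and> edges ?H = \<mu> \<union> (\<Union>e\<in>edges G0 - \<mu>. edges (H' e))"
      using d vH by (intro exI[of _ H]) (simp add: assembled_def[OF C])
    from decI[OF this] have dec: "decomposition (edges G0 - \<mu>) (V - ?A) (dec ?H G0 \<mu>)"
      and edH: "edges ?H = \<mu> \<union> (\<Union>e\<in>edges G0 - \<mu>. edges (dec ?H G0 \<mu> e))"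
      unfolding vH by (rule conjunct1, rule conjunct2)
    have "assembled G0 \<mu> V (dec ?H G0 \<mu>) = ?H"
      by (rule graph_eqI) (simp_all add: assembled_def[OF C, of "dec ?H G0 \<mu>"] vH edH[symmetric])
    then have deq: "dec ?H G0 \<mu> = H" by (rule assembled_unique[OF C dec d])
    have sp: "\<sigma> permutes (V - ?A)" using mem by (simp add: families_iff)
    have tp: "\<tau> permutes ?A" using ta by (simp add: graph_auts_eq)
    have R1: "R ?A (\<tau> \<circ> \<sigma>) = \<tau>"
      using permutes_not_in[OF sp] permutes_not_in[OF tp] by (auto simp: fun_eq_iff R_def)
    have R2: "R (V - ?A) (\<tau> \<circ> \<sigma>) = \<sigma>"
    proof
      fix x
      show "R (V - ?A) (\<tau> \<circ> \<sigma>) x = \<sigma> x"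
        using permutes_not_in[OF sp, of x] permutes_not_in[OF tp, of "\<sigma> x"] permutes_in_image[OF sp, of x] by (auto simp: R_def)
    qed
    show "j (i z) = z" unfolding z i_def j_def case_prod_conv deq R1 R2 ..
  qed
  also have "\<dots> = (\<Sum>G\<in>?G. \<Sum>y\<in>?B3 G. ?W (G, y))"
    by (rule sum_Sigma_pair[symmetric, OF finG]) (intro finite_SigmaI finA finM finF)
  also have "\<dots> = (\<Sum>G\<in>?G. \<Sum>\<tau>\<in>graph_auts G. \<Sum>y\<in>?B2 G \<tau>. ?W (G, \<tau>, y))"
    by (rule sum.cong[OF refl], rule sum_Sigma_pair[symmetric, OF finA]) (auto intro!: finite_SigmaI finM finF)
  also have "\<dots> = (\<Sum>G\<in>?G. \<Sum>\<tau>\<in>graph_auts G. \<Sum>\<mu>\<in>fixed_matchings G \<tau>. \<Sum>x\<in>?F G \<tau> \<mu>. ?W (G, \<tau>, \<mu>, x))"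
    by (rule sum.cong[OF refl], rule sum.cong[OF refl], rule sum_Sigma_pair[symmetric, OF finM]) (auto intro!: finF)
  finally show ?thesis by simp
qed

section \<open>Lower bounds for degrees in substituted series\<close>

definition order_ge :: "nat \<Rightarrow> walsh_var series \<Rightarrow> bool" where
  "order_ge d f \<longleftrightarrow> (\<forall>m. coeff f m \<noteq> 0 \<longrightarrow> d \<le> mdeg vdeg m)"

lemma order_ge_mult: "order_ge d f \<Longrightarrow> order_ge d' g \<Longrightarrow> order_ge (d + d') (f * g)"
  unfolding order_ge_def
proof (intro allI impI)
  fix m assume f: "\<forall>m. coeff f m \<noteq> 0 \<longrightarrow> d \<le> mdeg vdeg m" and g: "\<forall>m. coeff g m \<noteq> 0 \<longrightarrow> d' \<le> mdeg vdeg m"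
    and nz: "coeff (f * g) m \<noteq> 0"
  have "\<exists>z\<in>splits m. (case z of (p, q) \<Rightarrow> coeff f p * coeff g q) \<noteq> 0"
    using nz unfolding coeff_mult by (meson sum.neutral)
  then obtain p q where "p + q = m" "coeff f p \<noteq> 0" "coeff g q \<noteq> 0" by (auto simp: splits_def)
  then show "d + d' \<le> mdeg vdeg m" using f g by (metis add_mono mdeg_add)
qed

lemma order_ge_zero: "order_ge 0 f" by (simp add: order_ge_def)

lemma order_ge_power: "order_ge d f \<Longrightarrow> order_ge (d * j) (f ^ j)"
  by (induction j) (simp_all add: order_ge_zero order_ge_mult)

lemma order_ge_prod: "(\<And>i. i \<in> I \<Longrightarrow> order_ge (d i) (f i)) \<Longrightarrow> order_ge (\<Sum>i\<in>I. d i) (\<Prod>i\<in>I. f i)"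
  by (induction I rule: infinite_finite_induct) (simp_all add: order_ge_zero order_ge_mult)

text \<open>Base variables keep their degree, and the others have degree 0 to begin with.
  Consequently only cores with at most as many vertices as the degree of a monomial can contribute
  to its coefficient.\<close>

lemma order_ge_monomial_subst:
  assumes "\<And>u. s (Base u) = var u"
  shows "order_ge (mdeg edeg n) (monomial_subst s n)"
  unfolding mdeg_def monomial_subst_def
proof (rule order_ge_prod, rule order_ge_power)
  fix v
  show "order_ge (edeg v) (s v)"
  proof (cases v)
    case (Base u)
    then show ?thesis
      by (simp add: assms order_ge_def var_def coeff_monomial_series edeg_def)
  qed (simp_all add: edeg_def order_ge_zero)
qed

section \<open>From single cycles to all substituted edges\<close>

context core_aut
begin

lemma orbit_invariant:
  assumes "invariant Z" "e \<in> Z"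
  shows "invariant (orbit ((`) \<tau>) e)" "e \<in> orbit ((`) \<tau>) e" "orbit ((`) \<tau>) e \<subseteq> Z"
proof -
  have fZ: "finite Z" by (rule finite_subset[of _ "Pow A"]) (use assms(1) finA in \<open>auto simp: invariant_def\<close>)
  have tZ: "(`) \<tau> ` Z = Z" using assms(1) by (simp add: invariant_def)
  have i: "inj ((`) \<tau>)" by (rule inj_image[OF permutes_inj[OF \<tau>]])
  show "e \<in> orbit ((`) \<tau>) e" by (rule self_in_orbit[OF i fZ _ assms(2)]) (simp add: tZ)
  show sub: "orbit ((`) \<tau>) e \<subseteq> Z" by (rule orbit_subset_closed[OF _ assms(2)]) (simp add: tZ)
  have "(`) \<tau> ` orbit ((`) \<tau>) e \<subseteq> orbit ((`) \<tau>) e" by (auto intro: orbit.step)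
  then have "(`) \<tau> ` orbit ((`) \<tau>) e = orbit ((`) \<tau>) e"
    by (rule endo_inj_surj[OF finite_subset[OF sub fZ] _ inj_imp_inj_on[OF i]])
  then show "invariant (orbit ((`) \<tau>) e)" using sub assms(1) unfolding invariant_def by blast
qed

text \<open>The orbits of \<tau> cut \<open>Z\<close> into invariant cycles, and the product rule
  multiplies their generating functions.\<close>

lemma egf_family_sum:
  assumes Z: "invariant Z"
  shows "egf_on A (family_sum Z) (\<Prod>c\<in>orbit ((`) \<tau>) ` Z. dilate (card c) (if cylindrical \<tau> c then walsh_plus \<N> else walsh_minus \<N>))"
proof -
  have fZ: "finite Z" by (rule finite_subset[of _ "Pow A"]) (use Z finA in \<open>auto simp: invariant_def\<close>)
  have tZ: "(`) \<tau> ` Z \<subseteq> Z" using Z by (simp add: invariant_def)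
  have i: "inj ((`) \<tau>)" by (rule inj_image[OF permutes_inj[OF \<tau>]])
  have "egf_on A (family_sum (\<Union>(orbit ((`) \<tau>) ` Z)))
    (\<Prod>c\<in>orbit ((`) \<tau>) ` Z. dilate (card c) (if cylindrical \<tau> c then walsh_plus \<N> else walsh_minus \<N>))"
  proof (rule egf_family_sum_Union)
    show "finite (orbit ((`) \<tau>) ` Z)" using fZ by simp
    show "invariant c" if "c \<in> orbit ((`) \<tau>) ` Z" for c using that orbit_invariant(1)[OF Z] by blast
    show "c \<inter> d = {}" if cd: "c \<in> orbit ((`) \<tau>) ` Z" "d \<in> orbit ((`) \<tau>) ` Z" "c \<noteq> d" for c d
    proof (rule ccontr)
      assume "c \<inter> d \<noteq> {}"
      then obtain x where x: "x \<in> c" "x \<in> d" by blast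
      have "orbit ((`) \<tau>) x = c" "orbit ((`) \<tau>) x = d"
        using cd(1,2) x orbit_eq_of_mem[OF i fZ tZ] by auto
      then show False using cd(3) by simp
    qed
    fix c assume "c \<in> orbit ((`) \<tau>) ` Z"
    then obtain e where e: "e \<in> Z" "c = orbit ((`) \<tau>) e" by blast
    have ec: "e \<in> c" and inv: "invariant c" using orbit_invariant[OF Z e(1)] e(2) by auto
    have fc: "finite c" using finite_subset[OF orbit_invariant(3)[OF Z e(1)] fZ] e(2) by simp
    have k: "0 < card c" using ec fc card_gt_0_iff by blast
    have b: "bij_betw (\<lambda>i. (\<tau> ^^ i) ` e) {..<card c} c"
      using bij_betw_orbit[of e "(`) \<tau>"] ec unfolding e(2) funpow_image by simp
    have pk: "(\<tau> ^^ card c) ` e = e"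
      using funpow_card_orbit[OF i fZ tZ e(1)] unfolding e(2) funpow_image .
    show "egf_on A (family_sum c) (dilate (card c) (if cylindrical \<tau> c then walsh_plus \<N> else walsh_minus \<N>))"
      using egf_family_sum_cycle[OF inv k b pk] unfolding cycle_series_def[OF inv k b pk] .
  qed
  moreover have "\<Union>(orbit ((`) \<tau>) ` Z) = Z" using orbit_invariant(2,3)[OF Z] by blast
  ultimately show ?thesis by simp
qed

end

definition walsh_subst :: "'a network set \<Rightarrow> ext_var \<Rightarrow> walsh_var series" where
  "walsh_subst \<N> v = (case v of Base u \<Rightarrow> var u | VBeta k \<Rightarrow> dilate k (walsh_plus \<N>) | VGamma k \<Rightarrow> dilate k (walsh_minus \<N>))"

text \<open>Vertices and matching edges keep their variables, while each cycle of substituted edges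
  is replaced by the generating function that \<open>egf_family_sum\<close> assigns to it.\<close>

lemma monomial_subst_ext_weight:
  assumes "simple_graph G" "\<tau> \<in> graph_auts G" "\<mu> \<in> fixed_matchings G \<tau>"
  shows "monomial_subst (walsh_subst \<N>) (ext_weight G \<mu> \<tau>) = monomial_series (vweight (verts G) \<tau> + eweight \<mu> \<tau>) *
    (\<Prod>c\<in>orbit ((`) \<tau>) ` (edges G - \<mu>). dilate (card c) (if cylindrical \<tau> c then walsh_plus \<N> else walsh_minus \<N>))"
proof -
  let ?s = "walsh_subst \<N>"
  have v: "monomial_subst ?s (cyc_sum (\<lambda>c. Base (VA (card c))) \<tau> (verts G)) = monomial_series (vweight (verts G) \<tau>)"
    by (simp add: cyc_sum_def vweight_def monomial_subst_sum walsh_subst_def var_def prod_monomial_series)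
  have e: "monomial_subst ?s (cyc_sum (edge_var (\<lambda>k. Base (VB k)) (\<lambda>k. Base (VC k)) \<tau>) ((`) \<tau>) \<mu>) = monomial_series (eweight \<mu> \<tau>)"
  proof -
    have "?s (edge_var (\<lambda>k. Base (VB k)) (\<lambda>k. Base (VC k)) \<tau> c) = monomial_series (Poly_Mapping.single (edge_var VB VC \<tau> c) 1)" for c
      by (simp add: edge_var_def walsh_subst_def var_def)
    then show ?thesis by (simp add: cyc_sum_def eweight_def monomial_subst_sum prod_monomial_series)
  qed
  have z: "monomial_subst ?s (cyc_sum (edge_var VBeta VGamma \<tau>) ((`) \<tau>) (edges G - \<mu>)) =
    (\<Prod>c\<in>orbit ((`) \<tau>) ` (edges G - \<mu>). dilate (card c) (if cylindrical \<tau> c then walsh_plus \<N> else walsh_minus \<N>))"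
    unfolding cyc_sum_def monomial_subst_sum by (rule prod.cong[OF refl]) (simp add: edge_var_def walsh_subst_def)
  show ?thesis unfolding ext_weight_eq'[OF assms] monomial_subst_add v e z monomial_series_mult ..
qed

text \<open>The factor \<open>r\<close> is required only at monomials complementary to
  \<open>b\<close>, since \<open>egf_on\<close> supplies the factorial in a single degree.\<close>

lemma coeff_monomial_mult:
  assumes "\<And>q. b + q = m \<Longrightarrow> coeff F q = r * coeff P q"
  shows "coeff (monomial_series b * F) m = r * coeff (monomial_series b * P) m"
  unfolding coeff_mult sum_distrib_left
  by (rule sum.cong[OF refl]) (auto simp: splits_def coeff_monomial_series assms)

lemma egf_onD:
  "egf_on A F W \<Longrightarrow> finite U \<Longrightarrow> U \<inter> A = {} \<Longrightarrow> mdeg vdeg m = card U \<Longrightarrow> coeff (F U) m = fact (card U) * coeff W m"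
  by (simp add: egf_on_def)

text \<open>The core uses up its own vertices, so the networks share the remaining labels of
  \<open>V\<close>; the factorial of their number comes from the exponential generating function of
  the families.\<close>

lemma core_family_sum:
  assumes \<G>: "graph_species \<G>" and \<N>: "network_species \<N>" and sym: "symmetric_species \<N>"
    and V: "finite V" and m: "mdeg vdeg m = card V"
    and G: "G \<in> \<G>" "verts G \<subseteq> V" and ta: "\<tau> \<in> graph_auts G" and mu: "\<mu> \<in> fixed_matchings G \<tau>"
  shows "(\<Sum>x\<in>core_aut.families \<N> (verts G) \<tau> (edges G - \<mu>) (V - verts G).
        coeff (monomial_series (vweight (verts G) \<tau> + eweight \<mu> \<tau> + core_aut.family_weight \<tau> (edges G - \<mu>) (V - verts G) x)) m) =
    fact (card V - card (verts G)) * coeff (monomial_subst (walsh_subst \<N>) (ext_weight G \<mu> \<tau>)) m"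
proof -
  interpret core_aut \<N> "verts G" \<tau> by (rule core_aut_graph[OF \<G> \<N> sym G(1) ta])
  have sg: "simple_graph G" by (rule graph_species_simple[OF \<G> G(1)])
  let ?Z = "edges G - \<mu>" and ?U = "V - verts G" and ?b = "vweight (verts G) \<tau> + eweight \<mu> \<tau>"
  let ?P = "\<Prod>c\<in>orbit ((`) \<tau>) ` ?Z. dilate (card c) (if cylindrical \<tau> c then walsh_plus \<N> else walsh_minus \<N>)"
  have inv: "invariant ?Z" by (rule core_invariant[OF sg refl ta mu V G(2)])
  have db: "mdeg vdeg ?b = card (verts G)"
    using mdeg_cyc_sum_vertices[OF graph_auts_inj[OF ta] simple_graph_finite[OF sg]] permutes_image[of \<tau> "verts G"] ta
    by (simp add: vweight_def eweight_def mdeg_cyc_sum_edges graph_auts_eq)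
  have cU: "card ?U = card V - card (verts G)" by (rule card_Diff_subset[OF simple_graph_finite[OF sg] G(2)])
  have "(\<Sum>x\<in>families ?Z ?U. coeff (monomial_series (?b + family_weight ?Z ?U x)) m) = coeff (monomial_series ?b * family_sum ?Z ?U) m"
    by (simp add: family_sum_def sum_distrib_left monomial_series_mult)
  also have "\<dots> = fact (card V - card (verts G)) * coeff (monomial_series ?b * ?P) m"
  proof (rule coeff_monomial_mult)
    fix q assume "?b + q = m"
    then have "mdeg vdeg ?b + mdeg vdeg q = card V" using m mdeg_add by metis
    then have q: "mdeg vdeg q = card ?U" using db cU by simp
    have "finite ?U" "?U \<inter> verts G = {}" using V by auto
    then show "coeff (family_sum ?Z ?U) q = fact (card V - card (verts G)) * coeff ?P q"
      unfolding cU[symmetric] by (rule egf_onD[OF egf_family_sum[OF inv] _ _ q])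
  qed
  also have "monomial_series ?b * ?P = monomial_subst (walsh_subst \<N>) (ext_weight G \<mu> \<tau>)"
    by (rule monomial_subst_ext_weight[OF sg ta mu, symmetric])
  finally show ?thesis .
qed

theorem proposition7:
  fixes \<G> :: "'a::infinite graph set" and \<N> :: "'a network set"
  assumes "graph_species \<G>" and "network_species \<N>" and "symmetric_species \<N>"
  shows "walsh_substitution \<G> \<N> =
    substitute
      (\<lambda>v. case v of
          Base u \<Rightarrow> var u
        | VBeta k \<Rightarrow> dilate k (walsh_plus \<N>)
        | VGamma k \<Rightarrow> dilate k (walsh_minus \<N>))
      (extended_walsh \<G>)"
proof (rule series_eqI)
  fix m
  let ?s = "walsh_subst \<N>"
  have s_eq: "(\<lambda>v. case v of Base u \<Rightarrow> var u | VBeta k \<Rightarrow> dilate k (walsh_plus \<N>) | VGamma k \<Rightarrow> dilate k (walsh_minus \<N>)) = ?s"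
    by (rule ext) (simp add: walsh_subst_def)
  define D where "D = mdeg vdeg m"
  \<comment> \<open>The infinite label type provides a set with exactly as many labels as the degree
    of \<open>m\<close>.\<close>
  obtain V :: "'a set" where V: "finite V" "card V = D"
    using infinite_arbitrarily_large[OF infinite_UNIV] by blast
  have mV: "mdeg vdeg m = card V" using V(2) D_def by simp
  note sg = graph_species_simple[OF assms(1)]
  let ?G = "{G\<in>\<G>. verts G \<subseteq> V}"
  let ?GA = "\<lambda>A. {G\<in>\<G>. verts G = A}"
  have finG: "finite ?G" by (rule finite_subset[OF _ finite_simple_graphs[OF V(1)]]) (use sg in auto)
  have finGA: "finite (?GA A)" if "A \<subseteq> V" for A by (rule finite_subset[OF _ finG]) (use that in auto)
  define Q where "Q G f = (\<Sum>\<tau>\<in>graph_auts G. \<Sum>\<mu>\<in>fixed_matchings G \<tau>. f (ext_weight G \<mu> \<tau>))" for G :: "'a graph" and f :: "_ \<Rightarrow> rat"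
  \<comment> \<open>Exponent vectors realised by graphs inside \<open>V\<close>: a finite set that
    contains every vector contributing to the coefficient of \<open>m\<close>.\<close>
  define T where "T = (\<Union>G\<in>?G. \<Union>\<tau>\<in>graph_auts G. (\<lambda>\<mu>. ext_weight G \<mu> \<tau>) ` fixed_matchings G \<tau>)"
  have finT: "finite T" unfolding T_def
    using finG finite_graph_auts[OF sg] finite_fixed_matchings[OF sg] by auto
  have T_mem: "ext_weight G \<mu> \<tau> \<in> T" if "G \<in> ?G" "\<tau> \<in> graph_auts G" "\<mu> \<in> fixed_matchings G \<tau>" for G \<mu> \<tau>
    unfolding T_def using that by blast
  have T_deg: "mdeg edeg n \<le> card V" if nT: "n \<in> T" for n
  proof -
    obtain G \<tau> \<mu> where "G \<in> ?G" "\<tau> \<in> graph_auts G" "\<mu> \<in> fixed_matchings G \<tau>" "n = ext_weight G \<mu> \<tau>"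
      using nT unfolding T_def by blast
    then show ?thesis using mdeg_ext_weight[OF sg] card_mono[OF V(1)] by auto
  qed
  have ext: "fact (card A) * coeff (extended_walsh \<G>) n = (\<Sum>G\<in>?GA A. Q G (\<lambda>w. if n = w then 1 else 0))"
    if A: "A \<subseteq> V" "mdeg edeg n = card A" for A n
    unfolding Q_def using coeff_extended_walsh[OF assms(1) finite_subset[OF A(1) V(1)] A(2)]
    by (simp add: coeff_monomial_series)
  let ?c = "\<lambda>n. coeff (monomial_subst ?s n) m"
  \<comment> \<open>Graphs on a given vertex set are sorted by exponent vector. The degree condition
    selects the vectors of cores of size |A|, to which the labelled form of the extended series
    applies.\<close>
  have QA: "(\<Sum>G\<in>?GA A. Q G ?c) = (\<Sum>n\<in>T. if mdeg edeg n = card A then fact (card A) * (coeff (extended_walsh \<G>) n * ?c n) else 0)"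
    if A: "A \<subseteq> V" for A
  proof -
    have w: "?c (ext_weight G \<mu> \<tau>) = (\<Sum>n\<in>T. if mdeg edeg n = card A then (if n = ext_weight G \<mu> \<tau> then 1 else 0) * ?c n else 0)"
      if G: "G \<in> ?GA A" "\<tau> \<in> graph_auts G" "\<mu> \<in> fixed_matchings G \<tau>" for G \<tau> \<mu>
    proof -
      have wT: "ext_weight G \<mu> \<tau> \<in> T" using T_mem[of G \<tau> \<mu>] G A by auto
      have wd: "mdeg edeg (ext_weight G \<mu> \<tau>) = card A" using mdeg_ext_weight[OF sg, of G \<tau> \<mu>] G by auto
      have "(\<Sum>n\<in>T. if mdeg edeg n = card A then (if n = ext_weight G \<mu> \<tau> then 1 else 0) * ?c n else 0) =
        (\<Sum>n\<in>T. if n = ext_weight G \<mu> \<tau> then ?c n else 0)"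
        by (rule sum.cong[OF refl]) (use wd in auto)
      also have "\<dots> = ?c (ext_weight G \<mu> \<tau>)" using finT wT by (simp add: sum.delta)
      finally show ?thesis ..
    qed
    have "(\<Sum>G\<in>?GA A. Q G ?c) = (\<Sum>G\<in>?GA A. \<Sum>\<tau>\<in>graph_auts G. \<Sum>\<mu>\<in>fixed_matchings G \<tau>.
        \<Sum>n\<in>T. if mdeg edeg n = card A then (if n = ext_weight G \<mu> \<tau> then 1 else 0) * ?c n else 0)"
      unfolding Q_def by (intro sum.cong refl w)
    also have "\<dots> = (\<Sum>n\<in>T. \<Sum>G\<in>?GA A. \<Sum>\<tau>\<in>graph_auts G. \<Sum>\<mu>\<in>fixed_matchings G \<tau>.
        if mdeg edeg n = card A then (if n = ext_weight G \<mu> \<tau> then 1 else 0) * ?c n else 0)"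
      by (simp only: sum.swap[of _ T])
    also have "\<dots> = (\<Sum>n\<in>T. if mdeg edeg n = card A then fact (card A) * (coeff (extended_walsh \<G>) n * ?c n) else 0)"
    proof (rule sum.cong[OF refl])
      fix n
      show "(\<Sum>G\<in>?GA A. \<Sum>\<tau>\<in>graph_auts G. \<Sum>\<mu>\<in>fixed_matchings G \<tau>.
          if mdeg edeg n = card A then (if n = ext_weight G \<mu> \<tau> then 1 else 0) * ?c n else 0) =
        (if mdeg edeg n = card A then fact (card A) * (coeff (extended_walsh \<G>) n * ?c n) else 0)"
      proof (cases "mdeg edeg n = card A")
        case True
        have "fact (card A) * (coeff (extended_walsh \<G>) n * ?c n) = (\<Sum>G\<in>?GA A. Q G (\<lambda>w. if n = w then 1 else 0)) * ?c n"
          by (simp only: ext[OF A True, symmetric] mult.assoc)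
        also have "\<dots> = (\<Sum>G\<in>?GA A. \<Sum>\<tau>\<in>graph_auts G. \<Sum>\<mu>\<in>fixed_matchings G \<tau>. (if n = ext_weight G \<mu> \<tau> then 1 else 0) * ?c n)"
          unfolding Q_def sum_distrib_right ..
        finally show ?thesis unfolding if_P[OF True] ..
      qed simp
    qed
    finally show ?thesis .
  qed
  have "fact D * coeff (walsh_substitution \<G> \<N>) m = (\<Sum>G\<in>?G. fact (card V - card (verts G)) * Q G ?c)"
  proof -
    have "fact (card V) * coeff (walsh_substitution \<G> \<N>) m =
      (\<Sum>S\<in>{S\<in>edge_substitution \<G> \<N>. verts (fst S) = V}. \<Sum>\<sigma>\<in>cored_auts S. coeff (monomial_series (walsh_weight (fst S) \<sigma>)) m)"
      by (rule coeff_walsh_substitution(1)[OF assms(1,2) V(1) mV])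
    also have "\<dots> = (\<Sum>G\<in>?G. \<Sum>\<tau>\<in>graph_auts G. \<Sum>\<mu>\<in>fixed_matchings G \<tau>.
      \<Sum>x\<in>core_aut.families \<N> (verts G) \<tau> (edges G - \<mu>) (V - verts G).
        coeff (monomial_series (vweight (verts G) \<tau> + eweight \<mu> \<tau> + core_aut.family_weight \<tau> (edges G - \<mu>) (V - verts G) x)) m)"
      by (rule structure_sum[OF assms V(1), of "\<lambda>w. coeff (monomial_series w) m"])
    also have "\<dots> = (\<Sum>G\<in>?G. \<Sum>\<tau>\<in>graph_auts G. \<Sum>\<mu>\<in>fixed_matchings G \<tau>.
      fact (card V - card (verts G)) * ?c (ext_weight G \<mu> \<tau>))"
      by (intro sum.cong refl core_family_sum[OF assms V(1) mV]) auto
    also have "\<dots> = (\<Sum>G\<in>?G. fact (card V - card (verts G)) * Q G ?c)"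
      unfolding Q_def sum_distrib_left ..
    finally show ?thesis unfolding V(2)[symmetric] .
  qed
  also have "\<dots> = (\<Sum>A\<in>Pow V. \<Sum>G\<in>{G\<in>?G. verts G = A}. fact (card V - card (verts G)) * Q G ?c)"
    by (rule sum.group[symmetric, OF finG]) (use V(1) in auto)
  also have "\<dots> = (\<Sum>A\<in>Pow V. fact (card V - card A) * (\<Sum>G\<in>?GA A. Q G ?c))"
  proof (rule sum.cong[OF refl])
    fix A assume "A \<in> Pow V"
    then have "{G\<in>?G. verts G = A} = ?GA A" by auto
    then show "(\<Sum>G\<in>{G\<in>?G. verts G = A}. fact (card V - card (verts G)) * Q G ?c) = fact (card V - card A) * (\<Sum>G\<in>?GA A. Q G ?c)"
      by (simp add: sum_distrib_left)
  qed
  also have "\<dots> = (\<Sum>A\<in>Pow V. \<Sum>n\<in>T. if mdeg edeg n = card A then fact (card V - card A) * (fact (card A) * (coeff (extended_walsh \<G>) n * ?c n)) else 0)"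
    by (rule sum.cong[OF refl]) (simp add: QA sum_distrib_left if_distrib cong: if_cong)
  also have "\<dots> = (\<Sum>n\<in>T. \<Sum>A\<in>Pow V. if mdeg edeg n = card A then fact (card V - card A) * (fact (card A) * (coeff (extended_walsh \<G>) n * ?c n)) else 0)"
    by (rule sum.swap)
  also have "\<dots> = (\<Sum>n\<in>T. fact (card V) * (coeff (extended_walsh \<G>) n * ?c n))"
  proof (rule sum.cong[OF refl])
    fix n assume n: "n \<in> T"
    let ?l = "mdeg edeg n"
    \<comment> \<open>A core with l vertices has binom(|V|, l) possible vertex sets; together with
      the factorials of l and of the number of remaining labels this gives |V|!, the same factor as
      on the left-hand side.\<close>
    have "(\<Sum>A\<in>Pow V. if ?l = card A then fact (card V - card A) * (fact (card A) * (coeff (extended_walsh \<G>) n * ?c n)) else 0) =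
      (\<Sum>A\<in>{A. A \<subseteq> V \<and> card A = ?l}. fact (card V - ?l) * (fact ?l * (coeff (extended_walsh \<G>) n * ?c n)))"
      by (rule sum.mono_neutral_cong_right) (use V(1) in auto)
    also have "\<dots> = of_nat (card V choose ?l) * (fact (card V - ?l) * (fact ?l * (coeff (extended_walsh \<G>) n * ?c n)))"
      by (simp add: n_subsets[OF V(1)])
    also have "\<dots> = of_nat (fact ?l * fact (card V - ?l) * (card V choose ?l)) * (coeff (extended_walsh \<G>) n * ?c n)"
      by (simp add: mult.commute mult.left_commute)
    also have "fact ?l * fact (card V - ?l) * (card V choose ?l) = fact (card V)"
      by (rule binomial_fact_lemma[OF T_deg[OF n]])
    finally show "(\<Sum>A\<in>Pow V. if ?l = card A then fact (card V - card A) * (fact (card A) * (coeff (extended_walsh \<G>) n * ?c n)) else 0) =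
      fact (card V) * (coeff (extended_walsh \<G>) n * ?c n)" by simp
  qed
  also have "\<dots> = fact D * (\<Sum>n\<in>T. coeff (extended_walsh \<G>) n * ?c n)"
    unfolding V(2) sum_distrib_left ..
  \<comment> \<open>Vectors outside \<open>T\<close> contribute nothing: by the degree bound a
    contributing vector belongs to cores with at most |V| vertices, and such a core can be taken on
    a subset of \<open>V\<close>.\<close>
  also have "(\<Sum>n\<in>T. coeff (extended_walsh \<G>) n * ?c n) = coeff (substitute ?s (extended_walsh \<G>)) m"
  proof (rule coeff_substitute[OF finT, symmetric])
    fix n assume n: "coeff (extended_walsh \<G>) n \<noteq> 0" "?c n \<noteq> 0"
    have "order_ge (mdeg edeg n) (monomial_subst ?s n)"
      by (rule order_ge_monomial_subst) (simp add: walsh_subst_def)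
    then have "mdeg edeg n \<le> card V" using n(2) mV unfolding order_ge_def by auto
    then obtain A where A: "A \<subseteq> V" "card A = mdeg edeg n" using obtain_subset_with_card_n by metis
    have "(\<Sum>G\<in>?GA A. Q G (\<lambda>w. if n = w then 1 else 0)) \<noteq> 0"
      using ext[OF A(1) A(2)[symmetric]] n(1) by (metis fact_nonzero mult_eq_0_iff)
    then obtain G where G: "G \<in> ?GA A" "Q G (\<lambda>w. if n = w then 1 else 0) \<noteq> 0"
      by (rule sum.not_neutral_contains_not_neutral)
    from G(2) obtain \<tau> where t: "\<tau> \<in> graph_auts G" "(\<Sum>\<mu>\<in>fixed_matchings G \<tau>. if n = ext_weight G \<mu> \<tau> then 1 else (0::rat)) \<noteq> 0"
      unfolding Q_def by (rule sum.not_neutral_contains_not_neutral)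
    from t(2) obtain \<mu> where mu: "\<mu> \<in> fixed_matchings G \<tau>" "(if n = ext_weight G \<mu> \<tau> then 1 else (0::rat)) \<noteq> 0"
      by (rule sum.not_neutral_contains_not_neutral)
    then have "\<mu> \<in> fixed_matchings G \<tau>" "n = ext_weight G \<mu> \<tau>" by (auto split: if_splits)
    then show "n \<in> T" using T_mem[of G \<tau> \<mu>] G(1) A(1) t(1) by auto
  qed
  finally have "coeff (walsh_substitution \<G> \<N>) m = coeff (substitute ?s (extended_walsh \<G>)) m" by simp
  then show "coeff (walsh_substitution \<G> \<N>) m = coeff (substitute
      (\<lambda>v. case v of Base u \<Rightarrow> var u | VBeta k \<Rightarrow> dilate k (walsh_plus \<N>) | VGamma k \<Rightarrow> dilate k (walsh_minus \<N>)) (extended_walsh \<G>)) m"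
    unfolding s_eq .
qed

end
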